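(* Let $d\ge1$, let $K:[0,1]\to\mathbb{R}^+$ be positive, decreasing and Lipschitz continuous with $\int_0^1K(z)\,dz=\gamma$, and fix $T>0$, $R_x,R_v>0$. Let $f_0\in L^\infty(\mathbb{R}^d\times\mathbb{R}^d)$ be a probability density supported in $B_{R_x}\times B_{R_v}$ and let $f_t$ be the weak solution in $C_w([0,T];L^\infty(\mathbb{R}^d\times\mathbb{R}^d))$ of the topological Cucker-Smale equation with initial datum $f_0$. Let $\mu^N_0=\frac1N\sum_{i=1}^N\delta_{x_i}\delta_{v_i}$ be supported in $B_{R_x}\times B_{R_v}$, let $(X^N_i(t),V^N_i(t))_{i=1}^N$ be a global solution of the topological Cucker-Smale agent system with initial datum $(x_i,v_i)_{i=1}^N$, and let $\mu^N_t=\frac1N\sum_{i=1}^N\delta_{X^N_i(t)}\delta_{V^N_i(t)}$. Then, for $0\le t\le T$, $$\mathscr{W}(f_t,\mu^N_t)\le C(T)\max\left\{\mathscr{W}(f_0,\mu^N_0),\sqrt{\mathscr{W}(f_0,\mu^N_0)}\right\},$$ where $C(T)$ is a constant depending only on $T$, $R_x$, $R_v$ and $\|f_0\|_\infty$ (and on the fixed data $d$, $K$); in particular it does not depend on $N$.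
   Context: $B_R$ is the closed ball of center $0$ and radius $R$ in $\mathbb{R}^d$. $\mathscr{W}$ is the 1-Wasserstein distance, $\mathscr{W}(\mu,\nu)=\sup\{\int\phi\,(d\mu-d\nu):\phi\in C_b,\ \mathrm{Lip}(\phi)\le1\}$. For probability measures $\rho$ on $\mathbb{R}^d$ and $f$ on $\mathbb{R}^d\times\mathbb{R}^d$, $$W[\rho,f](x,v)=\int K\bigl(M[\rho](x,|x-y|)\bigr)(w-v)\,df(y,w),\qquad M[\rho](x,r)=\rho(\{x':|x'-x|\le r\}),$$ and $Sf$ is the spatial marginal ($x$-marginal) of $f$. Topological Cucker-Smale equation: $\partial_t f_t+v\cdot\nabla_x f_t+\nabla_v\cdot(W[Sf_t,f_t]f_t)=0$. $C_w([0,T];L^\infty)$ is the set of families of bounded probability densities weakly continuous in time in the sense of measures. A weak solution with initial datum $f_0$ is such that $f_t$ is the push-forward of $f_0$ along the flow $\dot X_t=V_t$, $\dot V_t=W[Sf_t,f_t](X_t,V_t)$, $(X_0,V_0)(x,v)=(x,v)$. For $f_0$ as in the claim such a solution exists, is unique, and satisfies $\mathrm{supp}(f_t)\subset B_{R_x+tR_v}\times B_{R_v}$. Agent system: $\dot X^N_i=V^N_i$, $\dot V^N_i=W[S\mu^N_t,\mu^N_t](X^N_i,V^N_i)$, that is $\dot V_i^N=\frac1N\sum_jK(M[S\mu^N_t](X^N_i,|X^N_i-X^N_j|))(V^N_j-V^N_i)$. Since the right-hand side jumps when two agents are at equal distance from a third, a solution means $X^N_i\in C^1$ with $\dot X^N_i=V^N_i$,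 and $V^N_i$ continuous satisfying the second equation in integrated form in time. (For Lebesgue-almost every initial datum a unique global solution exists, and it satisfies $|X^N_i(t)|\le R_x+tR_v$, $|V^N_i(t)|\le R_v$.) *)

theory Defs
  imports "HOL-Probability.Probability"
begin

definition Linf_norm :: "('b::euclidean_space \<Rightarrow> real) \<Rightarrow> ereal" where
  "Linf_norm f = esssup lborel (\<lambda>z. ereal \<bar>f z\<bar>)"

text \<open>Nonnegativity is required almost everywhere only, because elements of \<open>L\<^sup>\<infinity>\<close> are classes of
  functions. Measurability and integrability are part of \<^const>\<open>has_bochner_integral\<close>.\<close>

definition bounded_prob_density :: "('b::euclidean_space \<Rightarrow> real) \<Rightarrow> bool" where
  "bounded_prob_density f \<longleftrightarrow>
     (AE z in lborel. 0 \<le> f z) \<and> has_bochner_integral lborel f 1 \<and> Linf_norm f < \<infinity>"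

definition law :: "('b::euclidean_space \<Rightarrow> real) \<Rightarrow> 'b measure" where
  "law f = density lborel (\<lambda>z. ennreal (f z))"

text \<open>For a closed set \<open>S\<close> and a Borel measure \<open>\<mu>\<close> on a Euclidean space this says that the
  topological support of \<open>\<mu>\<close> is contained in \<open>S\<close>.\<close>

definition supported_in :: "'b measure \<Rightarrow> 'b set \<Rightarrow> bool" where
  "supported_in \<mu> S \<longleftrightarrow> (AE z in \<mu>. z \<in> S)"

text \<open>Weak continuity in time in the sense of measures is tested on bounded continuous functions.\<close>

definition Cw_Linf :: "real \<Rightarrow> (real \<Rightarrow> 'b::euclidean_space \<Rightarrow> real) \<Rightarrow> bool" where
  "Cw_Linf T f \<longleftrightarrow>
     (\<forall>t\<in>{0..T}. bounded_prob_density (f t)) \<and>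
     (\<forall>\<phi> :: 'b \<Rightarrow> real. continuous_on UNIV \<phi> \<and> bounded (range \<phi>) \<longrightarrow>
        continuous_on {0..T} (\<lambda>t. LINT z|law (f t). \<phi> z))"

text \<open>The supremum is taken in \<^typ>\<open>real\<close>. It is meaningful for probability measures with finite first
  moments, for which the set is nonempty and bounded above. The metric on a product type is the
  Euclidean one.\<close>

definition wasserstein1 :: "'b::metric_space measure \<Rightarrow> 'b measure \<Rightarrow> real" where
  "wasserstein1 \<mu> \<nu> =
     (SUP \<phi> \<in> {\<phi> :: 'b \<Rightarrow> real. continuous_on UNIV \<phi> \<and> bounded (range \<phi>) \<and> 1-lipschitz_on UNIV \<phi>}.
        (LINT z|\<mu>. \<phi> z) - (LINT z|\<nu>. \<phi> z))"

definition spatial_marginal :: "('a::euclidean_space \<times> 'a) measure \<Rightarrow> 'a measure" where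
  "spatial_marginal f = distr f borel fst"

definition mass_within :: "'a::euclidean_space measure \<Rightarrow> 'a \<Rightarrow> real \<Rightarrow> real" where
  "mass_within \<rho> x r = measure \<rho> {x'. norm (x' - x) \<le> r}"

definition interaction ::
    "(real \<Rightarrow> real) \<Rightarrow> 'a::euclidean_space measure \<Rightarrow> ('a \<times> 'a) measure \<Rightarrow> 'a \<Rightarrow> 'a \<Rightarrow> 'a" where
  "interaction K \<rho> f x v =
     (LINT z|f. K (mass_within \<rho> x (norm (x - fst z))) *\<^sub>R (snd z - v))"

text \<open>The finite first velocity moment makes the integral defining the interaction a genuine one
  (a Bochner integral is \<open>0\<close> by convention when the integrand is not integrable). Measurability of
  the flow map is what gives \<^const>\<open>distr\<close> the meaning of a push-forward. Derivatives at the endpoints of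
  the time interval are one-sided.\<close>

definition weak_solution ::
    "(real \<Rightarrow> real) \<Rightarrow> real \<Rightarrow> ('a::euclidean_space \<times> 'a \<Rightarrow> real) \<Rightarrow> (real \<Rightarrow> 'a \<times> 'a \<Rightarrow> real) \<Rightarrow> bool"
  where
  "weak_solution K T f0 f \<longleftrightarrow>
     Cw_Linf T f \<and>
     (\<forall>t\<in>{0..T}. integrable (law (f t)) snd) \<and>
     (\<exists>X V :: real \<Rightarrow> 'a \<times> 'a \<Rightarrow> 'a.
        (\<forall>x v. X 0 (x, v) = x \<and> V 0 (x, v) = v) \<and>
        (\<forall>t\<in>{0..T}. \<forall>z.
           ((\<lambda>s. X s z) has_vector_derivative V t z) (at t within {0..T}) \<and>
           ((\<lambda>s. V s z) has_vector_derivative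
              interaction K (spatial_marginal (law (f t))) (law (f t)) (X t z) (V t z))
             (at t within {0..T})) \<and>
        (\<forall>t\<in>{0..T}. (\<lambda>z. (X t z, V t z)) \<in> borel_measurable borel \<and>
           law (f t) = distr (law f0) borel (\<lambda>z. (X t z, V t z))))"

text \<open>Agents are indexed by \<open>{..<N}\<close> instead of \<open>{1..N}\<close>. The image of the uniform probability
  measure on the indices is \<open>(1/N) \<Sum>\<^sub>i \<delta>\<^bsub>(x\<^sub>i, v\<^sub>i)\<^esub>\<close>; it counts coinciding agents with
  multiplicity. It is used for \<open>N > 0\<close> only.\<close>

definition empirical ::
    "nat \<Rightarrow> (nat \<Rightarrow> 'a::euclidean_space) \<Rightarrow> (nat \<Rightarrow> 'a) \<Rightarrow> ('a \<times> 'a) measure" where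
  "empirical N x v = distr (uniform_count_measure {..<N}) borel (\<lambda>i. (x i, v i))"

definition agent_solution ::
    "(real \<Rightarrow> real) \<Rightarrow> nat \<Rightarrow> (nat \<Rightarrow> 'a::euclidean_space) \<Rightarrow> (nat \<Rightarrow> 'a) \<Rightarrow>
     (nat \<Rightarrow> real \<Rightarrow> 'a) \<Rightarrow> (nat \<Rightarrow> real \<Rightarrow> 'a) \<Rightarrow> bool" where
  "agent_solution K N x v X V \<longleftrightarrow>
     (let \<mu> = (\<lambda>s. empirical N (\<lambda>i. X i s) (\<lambda>i. V i s)) in
      \<forall>i<N. X i 0 = x i \<and> V i 0 = v i \<and>
        continuous_on {0..} (V i) \<and>
        (\<forall>t\<ge>0. (X i has_vector_derivative V i t) (at t within {0..})) \<and>
        (\<forall>t\<ge>0. ((\<lambda>s. interaction K (spatial_marginal (\<mu> s)) (\<mu> s) (X i s) (V i s))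
                  has_integral (V i t - V i 0)) {0..t}))"

end

theory Submission
  imports Defs
begin

text \<open>Let \<open>\<Phi>\<^sub>t\<close> be the flow of the mean-field solution. The agents are compared with the images
  \<open>\<Phi>\<^sub>t(x\<^sub>i, v\<^sub>i)\<close> of their initial data: since \<open>\<Phi>\<^sub>t\<close> is Lipschitz, the empirical measure of these images
  stays at distance \<open>O(W\<^sub>0)\<close> from \<open>f\<^sub>t\<close>, where \<open>W\<^sub>0\<close> is the initial Wasserstein distance, and no
  optimal coupling is needed. As \<open>f\<^sub>t\<close> has a bounded density, spherical shells of width \<open>h\<close> have mass
  \<open>O(h)\<close>; smoothing indicators of balls at scale \<open>\<eta>\<close> then costs \<open>O(\<eta> + W\<^sub>0/\<eta>)\<close>, and
  \<open>\<eta> = sqrt W\<^sub>0\<close> is the source of the square root. The remaining gap between \<open>\<Phi>\<^sub>t(x\<^sub>i, v\<^sub>i)\<close> and the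
  agents obeys a linear Gronwall inequality with source \<open>W\<^sub>0 + sqrt W\<^sub>0\<close>.

  A weak solution comes without bounds on its density or its first moment that are uniform in time.
  Both quantities are lower semicontinuous in time and, on intervals where they are bounded, comparable
  at any two times in both time directions (for the density this is Liouville's theorem); a Baire
  category argument turns this into a uniform bound.\<close>

section \<open>Gronwall and Baire category arguments on an interval\<close>

text \<open>The agents' force jumps and an empirical measure has no shell bound, so all regularity
  is taken from the mean field: every shift of a radius, a centre or a time is charged to
  \<open>M\<close>, the mass function of the mean-field law. Density bound and regularity of the
  force are circular: the force is Lipschitz only if the density is bounded, and the volume estimate
  is proved only for Lipschitz coefficients. The way out is that the Lipschitz constant controls
  only the error of an Euler scheme, which vanishes in the limit, while the volume factor
  \<open>exp (d * \<kappa> * T)\<close> sees only the bound \<kappa> of the kernel, since the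
  velocity divergence of the force is at most \<open>d * \<kappa>\<close> in modulus. So the
  comparison constant is independent of the local bound that made the comparison possible, which is
  what the Baire argument requires. Gronwall is used for suprema over segments, in both time
  directions: the moment and the gap are not known to be differentiable. A weak solution carries no
  velocity bound by definition; it is recovered from the first moment by Gronwall, hence
  \<open>RV\<close> in place of \<open>Rv\<close>.\<close>

lemma norm_diff_le_of_derivative_bound:
  fixes f :: "real \<Rightarrow> 'b::real_normed_vector"
  assumes der: "\<And>\<tau>. \<tau> \<in> {a..b} \<Longrightarrow> (f has_vector_derivative f' \<tau>) (at \<tau> within {a..b})"
    and st: "s \<in> {a..b}" "t \<in> {a..b}"
    and bnd: "\<And>\<tau>. \<tau> \<in> closed_segment s t \<Longrightarrow> norm (f' \<tau>) \<le> B"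
  shows "norm (f t - f s) \<le> B * \<bar>t - s\<bar>"
proof -
  have sub: "closed_segment s t \<subseteq> {a..b}"
    using st by (simp add: closed_segment_eq_real_ivl)
  have "norm (f t - f s) \<le> B * norm (t - s)"
  proof (rule differentiable_bound[where f'="\<lambda>\<tau> h. h *\<^sub>R f' \<tau>" and S="closed_segment s t"])
    show "(f has_derivative (\<lambda>h. h *\<^sub>R f' \<tau>)) (at \<tau> within closed_segment s t)"
      if "\<tau> \<in> closed_segment s t" for \<tau>
      using der[of \<tau>] that sub
      unfolding has_vector_derivative_def by (blast intro: has_derivative_subset)
    show "onorm (\<lambda>h. h *\<^sub>R f' \<tau>) \<le> B" if "\<tau> \<in> closed_segment s t" for \<tau>
    proof (rule onorm_le)
      fix h :: real
      show "norm (h *\<^sub>R f' \<tau>) \<le> B * norm h"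
        using mult_left_mono[OF bnd[OF that], of "\<bar>h\<bar>"] by (simp add: mult.commute)
    qed
  qed auto
  then show ?thesis by simp
qed

text \<open>If \<open>c * \<bar>t - s\<bar> \<le> 1/2\<close>, half of the supremum on the right-hand side is absorbed on the left, so that
  \<open>U + E\<close> at most doubles.\<close>

lemma gronwall_sup:
  fixes U :: "real \<Rightarrow> real"
  assumes c: "c > 0" and E: "E \<ge> 0"
    and pos: "\<And>t. t \<in> {a..b} \<Longrightarrow> 0 \<le> U t"
    and bdd: "bdd_above (U ` {a..b})"
    and step: "\<And>s t S. \<lbrakk>s \<in> {a..b}; t \<in> {a..b}; c * \<bar>t - s\<bar> \<le> 1/2; 0 \<le> S;
        \<And>\<tau>. \<tau> \<in> closed_segment s t \<Longrightarrow> U \<tau> \<le> S\<rbrakk> \<Longrightarrow> U t \<le> U s + c * \<bar>t - s\<bar> * (S + E)"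
    and st: "s \<in> {a..b}" "t \<in> {a..b}" and T: "b - a \<le> T"
  shows "U t + E \<le> 2 ^ nat \<lceil>2 * c * T\<rceil> * (U s + E)"
proof -
  have short: "U t + E \<le> 2 * (U s + E)"
    if st: "s \<in> {a..b}" "t \<in> {a..b}" and d: "c * \<bar>t - s\<bar> \<le> 1/2" for s t
  proof -
    let ?I = "closed_segment s t"
    have sub: "?I \<subseteq> {a..b}" using st by (simp add: closed_segment_eq_real_ivl)
    have bdd': "bdd_above (U ` ?I)" using bdd sub by (meson bdd_above_mono image_mono)
    define S where "S = (SUP \<tau>\<in>?I. U \<tau>)"
    have le: "U \<tau> \<le> S" if "\<tau> \<in> ?I" for \<tau>
      unfolding S_def using that bdd' by (rule cSUP_upper)
    have S0: "0 \<le> S" using le[of s] pos[OF st(1)] by simp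
    have "S \<le> U s + 1/2 * (S + E)"
      unfolding S_def
    proof (rule cSUP_least)
      fix \<tau> assume \<tau>: "\<tau> \<in> ?I"
      have seg: "closed_segment s \<tau> \<subseteq> ?I" using \<tau> by (simp add: subset_closed_segment)
      have "\<bar>\<tau> - s\<bar> \<le> \<bar>t - s\<bar>" using \<tau> by (auto simp: closed_segment_eq_real_ivl split: if_splits)
      then have d': "c * \<bar>\<tau> - s\<bar> \<le> 1/2" using d c by (smt (verit) mult_left_mono)
      have "U \<tau> \<le> U s + c * \<bar>\<tau> - s\<bar> * (S + E)"
        using \<tau> sub seg le d' by (intro step st S0) auto
      also have "\<dots> \<le> U s + 1/2 * (S + E)"
        using d' S0 E by (intro add_left_mono mult_right_mono) auto
      finally show "U \<tau> \<le> U s + 1/2 * ((SUP \<tau>\<in>?I. U \<tau>) + E)" by (simp add: S_def)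
    qed simp
    moreover have "U t \<le> S" by (rule le) simp
    ultimately show ?thesis by (simp add: field_simps)
  qed
  have steps: "U t + E \<le> 2 ^ n * (U s + E)"
    if "s \<in> {a..b}" "t \<in> {a..b}" and "c * \<bar>t - s\<bar> \<le> real n / 2" for n s t
    using that
  proof (induction n arbitrary: t)
    case 0
    then have "t = s" using c by (simp add: mult_le_0_iff)
    then show ?case by simp
  next
    case (Suc n)
    \<comment> \<open>The intermediate time at the fraction \<open>n / (n + 1)\<close> leaves a last
      piece short enough for one doubling and a first piece covered by the induction
      hypothesis.\<close>
    define w where "w = real n / real (Suc n)"
    define r where "r = s + w * (t - s)"
    have "0 \<le> w" "w \<le> 1" by (simp_all add: w_def)
    then have r_seg: "r \<in> closed_segment s t"
      unfolding closed_segment_def by (auto intro!: exI[of _ w] simp: r_def algebra_simps)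
    then have r: "r \<in> {a..b}" using Suc.prems by (auto simp: closed_segment_eq_real_ivl split: if_splits)
    have rs: "r - s = (real n / real (Suc n)) * (t - s)" by (simp add: r_def w_def)
    have tr: "t - r = (1 / real (Suc n)) * (t - s)" by (simp add: r_def w_def field_simps)
    have "c * \<bar>r - s\<bar> = (real n / real (Suc n)) * (c * \<bar>t - s\<bar>)"
      by (simp add: rs abs_mult)
    also have "\<dots> \<le> (real n / real (Suc n)) * (real (Suc n) / 2)"
      using Suc.prems(3) by (intro mult_left_mono) auto
    finally have 1: "c * \<bar>r - s\<bar> \<le> real n / 2" by simp
    have "c * \<bar>t - r\<bar> = (1 / real (Suc n)) * (c * \<bar>t - s\<bar>)"
      by (simp add: tr abs_mult)
    also have "\<dots> \<le> (1 / real (Suc n)) * (real (Suc n) / 2)"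
      using Suc.prems(3) by (intro mult_left_mono) auto
    finally have 2: "c * \<bar>t - r\<bar> \<le> 1 / 2" by simp
    have "U t + E \<le> 2 * (U r + E)" using short[OF r Suc.prems(2) 2] .
    also have "\<dots> \<le> 2 * (2 ^ n * (U s + E))"
      using Suc.IH[OF Suc.prems(1) r 1] by simp
    finally show ?case by simp
  qed
  have "c * \<bar>t - s\<bar> \<le> c * T" using st T c by (intro mult_left_mono) auto
  also have "\<dots> \<le> real (nat \<lceil>2 * c * T\<rceil>) / 2" by linarith
  finally show ?thesis using steps st by blast
qed

lemma compact_locally_bdd_above:
  fixes m :: "real \<Rightarrow> real"
  assumes "compact S"
    and loc: "\<And>t. t \<in> S \<Longrightarrow> \<exists>\<epsilon>>0. \<exists>c. \<forall>u\<in>S. \<bar>u - t\<bar> < \<epsilon> \<longrightarrow> m u \<le> c"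
  shows "bdd_above (m ` S)"
proof -
  obtain e c where e: "\<And>t. t \<in> S \<Longrightarrow> e t > (0::real)"
    and c: "\<And>t u. t \<in> S \<Longrightarrow> u \<in> S \<Longrightarrow> \<bar>u - t\<bar> < e t \<Longrightarrow> m u \<le> c t"
    using loc by metis
  obtain F where F: "F \<subseteq> S" "finite F" "S \<subseteq> (\<Union>t\<in>F. ball t (e t))"
    using compactE_image[OF assms(1), of S "\<lambda>t. ball t (e t)"] e by (metis (no_types, lifting) UN_iff centre_in_ball open_ball subsetI)
  have "m u \<le> (\<Sum>t\<in>F. \<bar>c t\<bar>)" if u: "u \<in> S" for u
  proof -
    obtain t where t: "t \<in> F" "u \<in> ball t (e t)" using F u by blast
    have "m u \<le> c t" using c[of t u] t F u by (auto simp: dist_real_def abs_minus_commute)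
    also have "\<dots> \<le> \<bar>c t\<bar>" by simp
    also have "\<dots> \<le> (\<Sum>t\<in>F. \<bar>c t\<bar>)" using t F by (intro member_le_sum) auto
    finally show ?thesis .
  qed
  then show ?thesis by (intro bdd_aboveI) auto
qed

text \<open>The points near which \<open>m\<close> is unbounded form a closed set \<open>P\<close>. If it were nonempty, \<open>m\<close> would be
  bounded on a relatively open part of \<open>P\<close> by Baire's theorem, and the comparison would carry this bound
  from \<open>P\<close> into the adjacent gaps.\<close>

lemma bounded_of_local_comparison:
  fixes m :: "real \<Rightarrow> real"
  assumes lsc: "\<And>c. closed {t \<in> {a..b}. m t \<le> c}"
    and comp: "\<And>s t. \<lbrakk>s \<in> {a..b}; t \<in> {a..b}; bdd_above (m ` closed_segment s t)\<rbrakk> \<Longrightarrow> m t \<le> C * m s"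
    and C: "C \<ge> 0"
    and st: "s \<in> {a..b}" "t \<in> {a..b}"
  shows "m t \<le> C * m s"
proof -
  define good where "good t \<longleftrightarrow> (\<exists>\<epsilon>>0. \<exists>c. \<forall>u\<in>{a..b}. \<bar>u - t\<bar> < \<epsilon> \<longrightarrow> m u \<le> c)" for t
  define P where "P = {t \<in> {a..b}. \<not> good t}"
  have bdd_seg: "bdd_above (m ` closed_segment s t)"
    if "closed_segment s t \<subseteq> {a..b}" "closed_segment s t \<inter> P = {}" for s t
  proof (rule compact_locally_bdd_above)
    fix u assume "u \<in> closed_segment s t"
    then have "good u" using that unfolding P_def by blast
    then show "\<exists>\<epsilon>>0. \<exists>c. \<forall>u'\<in>closed_segment s t. \<bar>u' - u\<bar> < \<epsilon> \<longrightarrow> m u' \<le> c"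
      unfolding good_def using that(1) by (meson subsetD)
  qed simp
  have closedP: "closed P"
  proof -
    have "open {t. good t}"
      unfolding open_dist
    proof
      fix t assume "t \<in> {t. good t}"
      then obtain \<epsilon> c where \<epsilon>: "\<epsilon> > 0" and c: "\<And>u. u \<in> {a..b} \<Longrightarrow> \<bar>u - t\<bar> < \<epsilon> \<Longrightarrow> m u \<le> c"
        unfolding good_def mem_Collect_eq by blast
      have "good y" if "dist y t < \<epsilon>/2" for y
        unfolding good_def
      proof (rule exI[of _ "\<epsilon>/2"], intro exI[of _ c] conjI ballI impI)
        fix u assume u: "u \<in> {a..b}" "\<bar>u - y\<bar> < \<epsilon> / 2"
        have "\<bar>u - t\<bar> < \<epsilon>"
          using u(2) that unfolding dist_real_def by linarith
        with u(1) show "m u \<le> c" by (rule c)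
      qed (use \<epsilon> in simp)
      then show "\<exists>e>0. \<forall>y. dist y t < e \<longrightarrow> y \<in> {t. good t}" using \<epsilon> half_gt_zero by blast
    qed
    moreover have "P = {a..b} - {t. good t}" unfolding P_def by auto
    ultimately show ?thesis by (simp add: closed_Diff)
  qed
  have "P = {}"
  proof (rule ccontr)
    assume ne: "P \<noteq> {}"
    \<comment> \<open>These sets are relatively open in \<open>P\<close> by lower semicontinuity,
      and their intersection is empty because \<open>m\<close> is finite everywhere. By Baire one of
      them is not dense, so near some \<open>p\<close> in \<open>P\<close> the function is at most
      \<open>n\<close> on \<open>P\<close>.\<close>
    let ?G = "(\<lambda>n::nat. P - {t \<in> {a..b}. m t \<le> real n}) ` UNIV"
    have int: "\<Inter>?G = {}"
    proof -
      have "\<exists>n::nat. m t \<le> real n" for t using real_arch_simple by blast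
      then show ?thesis unfolding P_def by auto
    qed
    have "\<not> (\<forall>T\<in>?G. openin (top_of_set P) T \<and> P \<subseteq> closure T)"
    proof
      assume "\<forall>T\<in>?G. openin (top_of_set P) T \<and> P \<subseteq> closure T"
      then have "P \<subseteq> closure (\<Inter>?G)" by (intro Baire closedP) auto
      then show False using ne unfolding int by simp
    qed
    moreover have "openin (top_of_set P) (P - {t \<in> {a..b}. m t \<le> real n})" for n :: nat
    proof -
      have "P - {t \<in> {a..b}. m t \<le> real n} = P \<inter> (- {t \<in> {a..b}. m t \<le> real n})" by blast
      then show ?thesis using lsc[of "real n"] by (metis openin_open open_Compl)
    qed
    ultimately obtain n :: nat where "\<not> P \<subseteq> closure (P - {t \<in> {a..b}. m t \<le> real n})" by auto
    then obtain p where p: "p \<in> P" and "p \<notin> closure (P - {t \<in> {a..b}. m t \<le> real n})" by blast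
    then obtain \<epsilon> where \<epsilon>: "\<epsilon> > 0" and "\<And>y. y \<in> P - {t \<in> {a..b}. m t \<le> real n} \<Longrightarrow> \<not> dist y p < \<epsilon>"
      by (auto simp: closure_approachable)
    then have near: "m y \<le> real n" if "y \<in> P" "dist y p < \<epsilon>" for y
      using that unfolding P_def by auto
    have "m t \<le> max (real n) (C * real n)" if t: "t \<in> {a..b}" "\<bar>t - p\<bar> < \<epsilon>" for t
    proof (cases "t \<in> P")
      case True
      then show ?thesis using near[of t] t by (simp add: dist_real_def)
    next
      case False
      let ?Q = "P \<inter> closed_segment p t"
      have pab: "p \<in> {a..b}" using p unfolding P_def by simp
      have pt: "closed_segment p t \<subseteq> {a..b}" using pab t by (simp add: closed_segment_eq_real_ivl)
      have "closed ?Q" "?Q \<noteq> {}" using closedP p by auto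
      \<comment> \<open>The point of \<open>P\<close> on the segment that is nearest to
        \<open>t\<close>: what lies between \<open>q\<close> and \<open>t\<close> avoids
        \<open>P\<close>, and \<open>q\<close> is still close enough to \<open>p\<close> for
        \<open>m q \<le> n\<close>.\<close>
      then obtain q where q: "q \<in> ?Q" and qmin: "\<And>y. y \<in> ?Q \<Longrightarrow> dist t q \<le> dist t y"
        using distance_attains_inf[of ?Q t] by blast
      have qp: "dist q p < \<epsilon>" using q t
        by (auto simp: dist_real_def closed_segment_eq_real_ivl split: if_splits)
      have mq: "m q \<le> real n" using near q qp by blast
      have qab: "q \<in> {a..b}" using q pt by blast
      have qt: "closed_segment q t \<subseteq> closed_segment p t" using q by (simp add: subset_closed_segment)
      have free: "closed_segment s t \<inter> P = {}" if s: "s \<in> closed_segment q t" "s \<noteq> q" for s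
      proof (rule ccontr)
        assume "closed_segment s t \<inter> P \<noteq> {}"
        then obtain y where y: "y \<in> closed_segment s t" "y \<in> P" by blast
        then have "y \<in> ?Q" using s qt by (meson IntI ends_in_segment(2) subsetD subset_closed_segment)
        then have "dist t q \<le> dist t y" by (rule qmin)
        then show False using y(1) s by (auto simp: dist_real_def closed_segment_eq_real_ivl split: if_splits)
      qed
      \<comment> \<open>Comparison backwards from \<open>t\<close> gives a bound that is uniform as
        \<open>s\<close> approaches \<open>q\<close>. It depends on \<open>t\<close> and serves only
        to license the forward comparison from \<open>q\<close>, whose bound \<open>C * n\<close>
        does not.\<close>
      have "m s \<le> max (real n) (C * m t)" if s: "s \<in> closed_segment q t" for s
      proof (cases "s = q")
        case False
        have sab: "s \<in> {a..b}" using s qt pt by blast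
        have "closed_segment t s \<subseteq> {a..b}" using sab t by (simp add: closed_segment_eq_real_ivl)
        then have "bdd_above (m ` closed_segment t s)"
          using free[OF s False] by (intro bdd_seg) (auto simp: closed_segment_commute)
        then have "m s \<le> C * m t" using comp t sab by blast
        then show ?thesis by simp
      qed (use mq in simp)
      then have "bdd_above (m ` closed_segment q t)" by (intro bdd_aboveI) auto
      then have "m t \<le> C * m q" using comp qab t by blast
      also have "\<dots> \<le> C * real n" using mq C by (simp add: mult_left_mono)
      finally show ?thesis by simp
    qed
    then have "good p" unfolding good_def using \<epsilon> by blast
    then show False using p unfolding P_def by simp
  qed
  then show ?thesis
    using st by (intro comp bdd_seg) (auto simp: closed_segment_eq_real_ivl)
qed

section \<open>Transport of density bounds\<close>

text \<open>For Borel measures this expresses a Lebesgue density bounded by \<open>c\<close> without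
  naming one; inequalities between sets pass directly to push-forwards and to limits. By
  \<open>ennreal\<close>, a negative \<open>c\<close> acts as 0.\<close>

definition density_le :: "real \<Rightarrow> 'b::euclidean_space measure \<Rightarrow> bool" where
  "density_le c \<mu> \<longleftrightarrow> (\<forall>A\<in>sets borel. emeasure \<mu> A \<le> ennreal c * emeasure lborel A)"

definition thickening :: "real \<Rightarrow> 'b::euclidean_space set \<Rightarrow> 'b set" where
  "thickening \<epsilon> F = {z. \<exists>y\<in>F. dist z y \<le> \<epsilon>}"

lemma compact_thickening:
  assumes "compact F" shows "compact (thickening \<epsilon> F)"
proof -
  have "thickening \<epsilon> F = (\<Union>y\<in>F. cball y \<epsilon>)"
    by (auto simp: thickening_def dist_commute)
  also have "\<dots> = (\<Union>x\<in>F. \<Union>y\<in>cball 0 \<epsilon>. {x + y})"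
  proof -
    have "\<exists>z\<in>cball 0 \<epsilon>. x = y + z" if "x \<in> cball y \<epsilon>" for x y :: 'a
      using that by (intro bexI[of _ "x - y"]) (auto simp: dist_norm norm_minus_commute)
    then show ?thesis by (fastforce simp: dist_norm)
  qed
  finally show ?thesis
    using compact_sums'[OF assms compact_cball[of 0 \<epsilon>]] by simp
qed

lemma lborel_thickening_tendsto:
  assumes F: "compact F" and \<epsilon>: "\<epsilon> \<longlonglongrightarrow> 0" "decseq \<epsilon>"
  shows "(\<lambda>n. emeasure lborel (thickening (\<epsilon> n) F)) \<longlonglongrightarrow> emeasure lborel F"
proof -
  have pos: "\<epsilon> n \<ge> 0" for n using \<epsilon> by (simp add: decseq_ge)
  have "(\<lambda>n. emeasure lborel (thickening (\<epsilon> n) F)) \<longlonglongrightarrow>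
      emeasure lborel (\<Inter>n. thickening (\<epsilon> n) F)"
  proof (rule Lim_emeasure_decseq)
    show "range (\<lambda>n. thickening (\<epsilon> n) F) \<subseteq> sets lborel"
      using compact_thickening[OF F] by (auto intro: borel_compact)
    show "decseq (\<lambda>n. thickening (\<epsilon> n) F)"
      using \<open>decseq \<epsilon>\<close> unfolding decseq_def thickening_def by (fastforce intro: order_trans)
    show "emeasure lborel (thickening (\<epsilon> n) F) \<noteq> \<infinity>" for n
      using emeasure_compact_finite[OF compact_thickening[OF F]] by (simp add: less_top)
  qed
  also have "(\<Inter>n. thickening (\<epsilon> n) F) = F"
  proof
    show "F \<subseteq> (\<Inter>n. thickening (\<epsilon> n) F)"
      using pos by (force simp: thickening_def)
    show "(\<Inter>n. thickening (\<epsilon> n) F) \<subseteq> F"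
    proof
      fix z assume z: "z \<in> (\<Inter>n. thickening (\<epsilon> n) F)"
      have "z \<in> closure F"
        unfolding closure_approachable
      proof safe
        fix e :: real assume "e > 0"
        then obtain n where "\<epsilon> n < e"
          using order_tendstoD(2)[OF \<epsilon>(1), of e] by (auto simp: eventually_sequentially)
        moreover obtain y where "y \<in> F" "dist z y \<le> \<epsilon> n" using z by (auto simp: thickening_def)
        ultimately show "\<exists>y\<in>F. dist y z < e" by (auto simp: dist_commute intro!: bexI[of _ y])
      qed
      then show "z \<in> F" using compact_imp_closed[OF F] by simp
    qed
  qed
  finally show ?thesis .
qed

text \<open>Inner regularity of a finite measure reduces the claim to compact \<open>F\<close>, and
  the volume of the thickenings of a compact set decreases to its volume. The slack
  \<open>\<epsilon>\<close> absorbs a uniform displacement of the points and \<open>c\<close> a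
  converging factor.\<close>

lemma density_le_limit:
  fixes \<mu> :: "'b::euclidean_space measure"
  assumes sets: "sets \<mu> = sets borel" and fin: "emeasure \<mu> (space \<mu>) \<noteq> \<infinity>"
    and \<epsilon>: "\<epsilon> \<longlonglongrightarrow> 0" "decseq \<epsilon>" and c: "c \<longlonglongrightarrow> l"
    and le: "\<And>F. compact F \<Longrightarrow>
      \<forall>\<^sub>F n in sequentially. emeasure \<mu> F \<le> ennreal (c n) * emeasure lborel (thickening (\<epsilon> n) F)"
  shows "density_le l \<mu>"
proof -
  have cpt: "emeasure \<mu> F \<le> ennreal l * emeasure lborel F" if F: "compact F" for F
  proof (rule tendsto_lowerbound[OF _ le[OF F]])
    show "(\<lambda>n. ennreal (c n) * emeasure lborel (thickening (\<epsilon> n) F)) \<longlonglongrightarrow> ennreal l * emeasure lborel F"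
      using emeasure_compact_finite[OF F]
      by (intro tendsto_mult_ennreal tendsto_ennrealI c lborel_thickening_tendsto F \<epsilon>) auto
  qed simp
  show ?thesis
    unfolding density_le_def
  proof
    fix A :: "'b set" assume A: "A \<in> sets borel"
    have "emeasure \<mu> A = (SUP F\<in>{F. F \<subseteq> A \<and> compact F}. emeasure \<mu> F)"
      by (rule inner_regular[OF sets fin A])
    also have "\<dots> \<le> ennreal l * emeasure lborel A"
    proof (rule SUP_least)
      fix F assume "F \<in> {F. F \<subseteq> A \<and> compact F}"
      then have F: "F \<subseteq> A" "compact F" by auto
      have "emeasure lborel F \<le> emeasure lborel A" using A F(1) by (intro emeasure_mono) auto
      then show "emeasure \<mu> F \<le> ennreal l * emeasure lborel A"
        using cpt[OF F(2)] by (meson mult_left_mono order_trans zero_le)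
    qed
    finally show "emeasure \<mu> A \<le> ennreal l * emeasure lborel A" .
  qed
qed

lemma density_le_distr:
  assumes \<mu>: "density_le c \<mu>" "sets \<mu> = sets borel" and q: "q \<ge> 0"
    and S: "S \<in> borel_measurable borel"
    and vol: "\<And>A. A \<in> sets borel \<Longrightarrow> emeasure lborel (S -` A) \<le> ennreal q * emeasure lborel A"
  shows "density_le (c * q) (distr \<mu> borel S)"
  unfolding density_le_def
proof
  fix A :: "'b set" assume A: "A \<in> sets borel"
  have sp: "space \<mu> = UNIV" using sets_eq_imp_space_eq[OF \<mu>(2)] by simp
  have S': "S \<in> \<mu> \<rightarrow>\<^sub>M borel" using S \<mu>(2) by (simp cong: measurable_cong_sets)
  have SA: "S -` A \<in> sets borel" using measurable_sets[OF S A] by simp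
  have "emeasure (distr \<mu> borel S) A = emeasure \<mu> (S -` A)"
    by (simp add: emeasure_distr[OF S' A] sp)
  also have "\<dots> \<le> ennreal c * emeasure lborel (S -` A)"
    using \<mu>(1) SA unfolding density_le_def by blast
  also have "\<dots> \<le> ennreal c * (ennreal q * emeasure lborel A)"
    by (intro mult_left_mono vol A) simp
  finally show "emeasure (distr \<mu> borel S) A \<le> ennreal (c * q) * emeasure lborel A"
    using q by (simp add: ennreal_mult'' mult.assoc)
qed

section \<open>Volume distortion of drifts and kicks\<close>

lemma emeasure_lborel_affine_vimage:
  fixes A :: "'b::euclidean_space set"
  assumes A: "A \<in> sets borel" and \<beta>: "\<beta> \<noteq> 0"
  shows "emeasure lborel A = ennreal (\<bar>\<beta>\<bar> ^ DIM('b)) * emeasure lborel ((\<lambda>v. \<alpha> + \<beta> *\<^sub>R v) -` A)"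
proof -
  have "emeasure lborel A =
      emeasure (density (distr lborel borel (\<lambda>x. \<alpha> + \<beta> *\<^sub>R x)) (\<lambda>_. \<bar>\<beta>\<bar> ^ DIM('b))) A"
    using lborel_affine[OF \<beta>, of \<alpha>] by simp
  also have "\<dots> = ennreal (\<bar>\<beta>\<bar> ^ DIM('b)) * emeasure (distr lborel borel (\<lambda>x. \<alpha> + \<beta> *\<^sub>R x)) A"
    using A by (subst emeasure_density) (simp_all add: nn_integral_cmult)
  finally show ?thesis using A by (simp add: emeasure_distr)
qed

text \<open>At fixed velocity the map is a translation in position, so Fubini gives preservation of
  volume.\<close>

lemma emeasure_drift_vimage:
  fixes A :: "('a::euclidean_space \<times> 'a) set"
  assumes A: "A \<in> sets borel"
  shows "emeasure lborel ((\<lambda>(x, v). (x + h *\<^sub>R v, v)) -` A) = emeasure lborel A"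
proof -
  interpret pair_sigma_finite "lborel :: 'a measure" "lborel :: 'a measure" ..
  let ?S = "\<lambda>(x, v). (x + h *\<^sub>R v, v :: 'a)"
  have m: "?S \<in> borel_measurable borel"
    by (simp add: split_beta') (intro borel_measurable_continuous_onI continuous_intros)
  have A': "A \<in> sets (lborel \<Otimes>\<^sub>M lborel)" using A unfolding lborel_prod by simp
  have SA: "?S -` A \<in> sets (lborel \<Otimes>\<^sub>M lborel)"
    using measurable_sets[OF m A] unfolding lborel_prod by simp
  have slice: "emeasure lborel ((\<lambda>x. (x, v)) -` (?S -` A)) = emeasure lborel ((\<lambda>x. (x, v)) -` A)" for v :: 'a
  proof -
    have "(\<lambda>x. (x, v)) -` A \<in> sets borel" using sets_Pair2[OF A', of v] by simp
    from emeasure_lborel_affine_vimage[OF this, of 1 "h *\<^sub>R v"]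
    have "emeasure lborel ((\<lambda>x. (x, v)) -` A) = emeasure lborel ((\<lambda>w. h *\<^sub>R v + 1 *\<^sub>R w) -` (\<lambda>x. (x, v)) -` A)"
      by simp
    also have "(\<lambda>w. h *\<^sub>R v + 1 *\<^sub>R w) -` (\<lambda>x. (x, v)) -` A = (\<lambda>x. (x, v)) -` (?S -` A)"
      by (auto simp: add.commute)
    finally show ?thesis by simp
  qed
  show ?thesis
    using lborel_pair.emeasure_pair_measure_alt2[OF A'] lborel_pair.emeasure_pair_measure_alt2[OF SA] slice
    by (simp add: lborel_prod)
qed

text \<open>At fixed position the map is affine in the velocity with slope at least \<open>q\<close>
  in modulus; Fubini then yields the factor, and no smoothness of the coefficients in the position
  enters.\<close>

lemma emeasure_kick_vimage_le:
  fixes A :: "('a::euclidean_space \<times> 'a) set" and \<beta> :: "'a \<Rightarrow> real"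
  assumes A: "A \<in> sets borel" and m: "\<alpha> \<in> borel_measurable borel" "\<beta> \<in> borel_measurable borel"
    and \<beta>: "\<And>x. q \<le> \<bar>\<beta> x\<bar>" and q: "q > 0"
  shows "emeasure lborel ((\<lambda>(x, v). (x, \<alpha> x + \<beta> x *\<^sub>R v)) -` A)
    \<le> ennreal (inverse (q ^ DIM('a))) * emeasure lborel A"
proof -
  let ?S = "\<lambda>(x, v). (x, \<alpha> x + \<beta> x *\<^sub>R v)"
  have mS: "?S \<in> borel_measurable borel"
    unfolding borel_prod[symmetric] using m by (simp add: split_beta')
  have A': "A \<in> sets (lborel \<Otimes>\<^sub>M lborel)" using A unfolding lborel_prod by simp
  have SA: "?S -` A \<in> sets (lborel \<Otimes>\<^sub>M lborel)"
    using measurable_sets[OF mS A] unfolding lborel_prod by simp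
  have slice: "emeasure lborel (Pair x -` (?S -` A)) \<le> ennreal (inverse (q ^ DIM('a))) * emeasure lborel (Pair x -` A)" for x
  proof -
    have P: "Pair x -` A \<in> sets borel" using sets_Pair1[OF A', of x] by simp
    have \<beta>0: "\<beta> x \<noteq> 0" using \<beta>[of x] q by auto
    have "q ^ DIM('a) \<le> \<bar>\<beta> x\<bar> ^ DIM('a)" using \<beta>[of x] q by (intro power_mono) auto
    then have "ennreal (q ^ DIM('a)) * emeasure lborel ((\<lambda>v. \<alpha> x + \<beta> x *\<^sub>R v) -` Pair x -` A)
        \<le> emeasure lborel (Pair x -` A)"
      unfolding emeasure_lborel_affine_vimage[OF P \<beta>0, of "\<alpha> x"]
      by (intro mult_right_mono ennreal_leI) auto
    then have "ennreal (inverse (q ^ DIM('a))) * (ennreal (q ^ DIM('a)) * emeasure lborel ((\<lambda>v. \<alpha> x + \<beta> x *\<^sub>R v) -` Pair x -` A))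
        \<le> ennreal (inverse (q ^ DIM('a))) * emeasure lborel (Pair x -` A)"
      by (rule mult_left_mono) simp
    moreover have "ennreal (inverse (q ^ DIM('a))) * ennreal (q ^ DIM('a)) = 1"
      using q by (simp flip: ennreal_mult')
    moreover have "(\<lambda>v. \<alpha> x + \<beta> x *\<^sub>R v) -` Pair x -` A = Pair x -` (?S -` A)" by auto
    ultimately show ?thesis by (simp flip: mult.assoc)
  qed
  have "emeasure lborel (?S -` A) = (\<integral>\<^sup>+x. emeasure lborel (Pair x -` (?S -` A)) \<partial>lborel)"
    using lborel.emeasure_pair_measure_alt[OF SA] by (simp add: lborel_prod)
  also have "\<dots> \<le> (\<integral>\<^sup>+x. ennreal (inverse (q ^ DIM('a))) * emeasure lborel (Pair x -` A) \<partial>lborel)"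
    by (intro nn_integral_mono slice)
  also have "\<dots> = ennreal (inverse (q ^ DIM('a))) * (\<integral>\<^sup>+x. emeasure lborel (Pair x -` A) \<partial>lborel)"
    using lborel.measurable_emeasure_Pair[OF A'] by (intro nn_integral_cmult) simp
  also have "(\<integral>\<^sup>+x. emeasure lborel (Pair x -` A) \<partial>lborel) = emeasure lborel A"
    using lborel.emeasure_pair_measure_alt[OF A'] by (simp add: lborel_prod)
  finally show ?thesis .
qed

text \<open>The flow need not be differentiable, so there is no Jacobian to bound. Instead it is approximated by
  compositions of shears, which change Lebesgue measure by an explicit factor.\<close>

definition drift :: "real \<Rightarrow> 'a::euclidean_space \<times> 'a \<Rightarrow> 'a \<times> 'a" where
  "drift h = (\<lambda>(x, v). (x + h *\<^sub>R v, v))"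

text \<open>An explicit Euler step of length \<open>h\<close> for
  \<open>v' = A x - B x *\<^sub>R v\<close> at frozen position. The force is affine in the velocity,
  so this is affine in \<open>v\<close> with slope \<open>1 - h * B x\<close>.\<close>

definition kick :: "('a::euclidean_space \<Rightarrow> 'a) \<Rightarrow> ('a \<Rightarrow> real) \<Rightarrow> real \<Rightarrow> 'a \<times> 'a \<Rightarrow> 'a \<times> 'a" where
  "kick A B h = (\<lambda>(x, v). (x, h *\<^sub>R A x + (1 - h * B x) *\<^sub>R v))"

text \<open>Each step drifts first; the kick then uses the new position but the coefficients at the
  old time.\<close>

primrec symplectic_euler ::
    "(real \<Rightarrow> 'a::euclidean_space \<Rightarrow> 'a) \<Rightarrow> (real \<Rightarrow> 'a \<Rightarrow> real) \<Rightarrow> real \<Rightarrow> real \<Rightarrow> nat \<Rightarrow> 'a \<times> 'a \<Rightarrow> 'a \<times> 'a"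
  where
  "symplectic_euler A B a h 0 = id"
| "symplectic_euler A B a h (Suc k) =
     kick (A (a + k * h)) (B (a + k * h)) h \<circ> (drift h \<circ> symplectic_euler A B a h k)"

lemma drift_measurable: "drift h \<in> borel_measurable borel"
  unfolding drift_def split_beta'
  by (intro borel_measurable_continuous_onI continuous_intros)

lemma kick_measurable:
  assumes "A \<in> borel_measurable borel" "B \<in> borel_measurable borel"
  shows "kick A B h \<in> borel_measurable borel"
  unfolding kick_def borel_prod[symmetric] using assms by (simp add: split_beta')

text \<open>Drifts keep the density bound and each of the \<open>k\<close> kicks multiplies it by at
  most \<open>(1 - h * \<kappa>)\<close> to the power \<open>-d\<close>. Measurability is part of
  the induction because composing push-forwards needs it.\<close>

lemma symplectic_euler_density_le:
  fixes \<mu> :: "('a::euclidean_space \<times> 'a) measure"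
  assumes \<mu>: "density_le c \<mu>" "sets \<mu> = sets borel"
    and m: "\<And>j. j < k \<Longrightarrow> A (a + real j * h) \<in> borel_measurable borel"
      "\<And>j. j < k \<Longrightarrow> B (a + real j * h) \<in> borel_measurable borel"
    and B: "\<And>j x. j < k \<Longrightarrow> \<bar>B (a + real j * h) x\<bar> \<le> \<kappa>" and h: "h \<ge> 0" "h * \<kappa> < 1"
  shows "symplectic_euler A B a h k \<in> borel_measurable borel \<and>
    density_le (c * (inverse ((1 - h * \<kappa>) ^ DIM('a))) ^ k) (distr \<mu> borel (symplectic_euler A B a h k))"
  using m B
proof (induction k)
  case 0
  have "distr \<mu> borel (\<lambda>z. z) = \<mu>" by (rule distr_id2[OF \<mu>(2)[symmetric]])
  then show ?case using \<mu>(1) by (simp add: id_def)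
next
  case (Suc k)
  let ?q = "inverse ((1 - h * \<kappa>) ^ DIM('a))"
  let ?K = "kick (A (a + real k * h)) (B (a + real k * h)) h"
  let ?E = "symplectic_euler A B a h k"
  have q: "?q \<ge> 0" using h(2) by simp
  have IH: "?E \<in> borel_measurable borel" "density_le (c * ?q ^ k) (distr \<mu> borel ?E)"
    using Suc by auto
  have mE: "?E \<in> \<mu> \<rightarrow>\<^sub>M borel" using IH(1) \<mu>(2) by (simp cong: measurable_cong_sets)
  have mK: "?K \<in> borel_measurable borel" using Suc.prems by (intro kick_measurable) auto
  have md: "drift h \<in> borel \<rightarrow>\<^sub>M (borel :: ('a \<times> 'a) measure)" by (rule drift_measurable)
  have "density_le (c * ?q ^ k * 1) (distr (distr \<mu> borel ?E) borel (drift h))"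
    by (rule density_le_distr[OF IH(2) _ _ md]) (simp_all add: drift_def emeasure_drift_vimage)
  then have D: "density_le (c * ?q ^ k) (distr (distr \<mu> borel ?E) borel (drift h))" by simp
  have "density_le (c * ?q ^ k * ?q) (distr (distr (distr \<mu> borel ?E) borel (drift h)) borel ?K)"
  proof (rule density_le_distr[OF D _ q mK])
    fix S :: "('a \<times> 'a) set" assume S: "S \<in> sets borel"
    have le: "1 - h * \<kappa> \<le> \<bar>1 - h * B (a + real k * h) x\<bar>" for x
      using mult_left_mono[of "B (a + real k * h) x" \<kappa> h] Suc.prems(3)[of k x] h(1) by linarith
    have m1: "(\<lambda>x. h *\<^sub>R A (a + real k * h) x) \<in> borel_measurable borel"
      "(\<lambda>x. 1 - h * B (a + real k * h) x) \<in> borel_measurable borel"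
      using Suc.prems(1)[of k] Suc.prems(2)[of k] by auto
    show "emeasure lborel (?K -` S) \<le> ennreal ?q * emeasure lborel S"
      unfolding kick_def by (rule emeasure_kick_vimage_le[OF S m1 le]) (use h(2) in simp)
  qed simp_all
  moreover have "distr (distr (distr \<mu> borel ?E) borel (drift h)) borel ?K
      = distr \<mu> borel (symplectic_euler A B a h (Suc k))"
    using mK md mE by (simp add: distr_distr measurable_comp[OF mE md] comp_assoc)
  moreover have "symplectic_euler A B a h (Suc k) \<in> borel_measurable borel"
    using mK md IH(1) by (simp add: measurable_comp comp_def)
  moreover have "c * ?q ^ k * ?q = c * ?q ^ Suc k" by simp
  ultimately show ?case by metis
qed

text \<open>The coefficients and the constants are shared by all trajectories, which makes the
  scheme error uniform over them. Only the modulus of \<open>B\<close> is bounded, since time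
  reversal changes its sign.\<close>

locale second_order_curve =
  fixes x v :: "real \<Rightarrow> 'a::euclidean_space" and A :: "real \<Rightarrow> 'a \<Rightarrow> 'a" and B :: "real \<Rightarrow> 'a \<Rightarrow> real"
    and a b \<Lambda> R \<alpha> \<kappa> :: real
  assumes derx: "\<And>\<tau>. \<tau> \<in> {a..b} \<Longrightarrow> (x has_vector_derivative v \<tau>) (at \<tau> within {a..b})"
    and derv: "\<And>\<tau>. \<tau> \<in> {a..b} \<Longrightarrow>
      (v has_vector_derivative A \<tau> (x \<tau>) - B \<tau> (x \<tau>) *\<^sub>R v \<tau>) (at \<tau> within {a..b})"
    and v_le: "\<And>\<tau>. \<tau> \<in> {a..b} \<Longrightarrow> norm (v \<tau>) \<le> R"
    and A_lip: "\<And>\<sigma> \<tau> y z. \<sigma> \<in> {a..b} \<Longrightarrow> \<tau> \<in> {a..b} \<Longrightarrow>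
      norm (A \<sigma> y - A \<tau> z) \<le> \<Lambda> * (\<bar>\<sigma> - \<tau>\<bar> + norm (y - z))"
    and B_lip: "\<And>\<sigma> \<tau> y z. \<sigma> \<in> {a..b} \<Longrightarrow> \<tau> \<in> {a..b} \<Longrightarrow>
      \<bar>B \<sigma> y - B \<tau> z\<bar> \<le> \<Lambda> * (\<bar>\<sigma> - \<tau>\<bar> + norm (y - z))"
    and A_le: "\<And>\<tau> y. \<tau> \<in> {a..b} \<Longrightarrow> norm (A \<tau> y) \<le> \<alpha>"
    and B_le: "\<And>\<tau> y. \<tau> \<in> {a..b} \<Longrightarrow> \<bar>B \<tau> y\<bar> \<le> \<kappa>"
    and nonneg: "0 \<le> \<Lambda>" "0 \<le> R" "0 \<le> \<alpha>" "0 \<le> \<kappa>"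
begin

text \<open>\<open>acc_max\<close> bounds the acceleration, \<open>kick_err\<close> and
  \<open>acc_max\<close> are the factors of \<open>h\<^sup>2\<close> in the local errors of kick and
  drift, \<open>err_rate\<close> is the amplification rate of one step and \<open>err_src\<close>
  its total local error.\<close>

definition acc_max :: real where "acc_max = \<alpha> + \<kappa> * R"
definition kick_err :: real where "kick_err = \<Lambda> * (1 + R) * (1 + R) + \<kappa> * acc_max"
definition err_rate :: real where "err_rate = 1 + \<Lambda> * (1 + R) + \<kappa>"
definition err_src :: real where "err_src = acc_max + kick_err + \<Lambda> * (1 + R) * acc_max"

lemma err_nonneg: "0 \<le> acc_max" "0 \<le> kick_err" "0 \<le> err_rate" "0 \<le> err_src"
  using nonneg by (auto simp: acc_max_def kick_err_def err_rate_def err_src_def)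

lemma acc_le: "\<tau> \<in> {a..b} \<Longrightarrow> norm (A \<tau> (x \<tau>) - B \<tau> (x \<tau>) *\<^sub>R v \<tau>) \<le> acc_max"
proof -
  assume \<tau>: "\<tau> \<in> {a..b}"
  have "\<bar>B \<tau> (x \<tau>)\<bar> * norm (v \<tau>) \<le> \<kappa> * R"
    using B_le[OF \<tau>] v_le[OF \<tau>] nonneg by (intro mult_mono) auto
  then show ?thesis
    using A_le[OF \<tau>, of "x \<tau>"] norm_triangle_ineq4[of "A \<tau> (x \<tau>)" "B \<tau> (x \<tau>) *\<^sub>R v \<tau>"]
    by (simp add: acc_max_def)
qed

lemma v_diff: "s \<in> {a..b} \<Longrightarrow> t \<in> {a..b} \<Longrightarrow> norm (v t - v s) \<le> acc_max * \<bar>t - s\<bar>"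
  by (rule norm_diff_le_of_derivative_bound[OF derv])
    (auto intro!: acc_le simp: closed_segment_eq_real_ivl split: if_splits)

lemma x_diff: "s \<in> {a..b} \<Longrightarrow> t \<in> {a..b} \<Longrightarrow> norm (x t - x s) \<le> R * \<bar>t - s\<bar>"
  by (rule norm_diff_le_of_derivative_bound[OF derx])
    (auto intro!: v_le simp: closed_segment_eq_real_ivl split: if_splits)

text \<open>Subtracting the straight line with slope \<open>v t\<close> leaves the derivative
  \<open>v \<tau> - v t\<close>, which is of order \<open>h\<close> because the acceleration is
  bounded.\<close>

lemma drift_consistent:
  assumes t: "t \<in> {a..b}" "t + h \<in> {a..b}" and h: "h \<ge> 0"
  shows "norm (x (t + h) - x t - h *\<^sub>R v t) \<le> acc_max * h\<^sup>2"
proof -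
  have "norm ((\<lambda>s. x s - (s - t) *\<^sub>R v t) (t + h) - (\<lambda>s. x s - (s - t) *\<^sub>R v t) t) \<le> (acc_max * h) * \<bar>t + h - t\<bar>"
  proof (rule norm_diff_le_of_derivative_bound[OF _ t])
    show "((\<lambda>s. x s - (s - t) *\<^sub>R v t) has_vector_derivative v \<tau> - v t) (at \<tau> within {a..b})"
      if "\<tau> \<in> {a..b}" for \<tau>
      by (auto intro!: derivative_eq_intros derx[OF that])
    fix \<tau> assume "\<tau> \<in> closed_segment t (t + h)"
    then have \<tau>: "t \<le> \<tau>" "\<tau> \<le> t + h" using h by (auto simp: closed_segment_eq_real_ivl)
    then have "norm (v \<tau> - v t) \<le> acc_max * \<bar>\<tau> - t\<bar>" using t by (intro v_diff) auto
    also have "\<dots> \<le> acc_max * h" using \<tau> err_nonneg by (intro mult_left_mono) auto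
    finally show "norm (v \<tau> - v t) \<le> acc_max * h" .
  qed
  then show ?thesis using h by (simp add: power2_eq_square algebra_simps)
qed

lemma kick_consistent:
  assumes t: "t \<in> {a..b}" "t + h \<in> {a..b}" and h: "h \<ge> 0"
  shows "norm (v (t + h) - v t - h *\<^sub>R (A t (x (t + h)) - B t (x (t + h)) *\<^sub>R v t)) \<le> kick_err * h\<^sup>2"
proof -
  define x1 where "x1 = x (t + h)"
  define w where "w = A t x1 - B t x1 *\<^sub>R v t"
  have "norm ((\<lambda>s. v s - (s - t) *\<^sub>R w) (t + h) - (\<lambda>s. v s - (s - t) *\<^sub>R w) t) \<le> (kick_err * h) * \<bar>t + h - t\<bar>"
  proof (rule norm_diff_le_of_derivative_bound[OF _ t])
    show "((\<lambda>s. v s - (s - t) *\<^sub>R w) has_vector_derivative (A \<tau> (x \<tau>) - B \<tau> (x \<tau>) *\<^sub>R v \<tau>) - w) (at \<tau> within {a..b})"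
      if "\<tau> \<in> {a..b}" for \<tau>
      by (auto intro!: derivative_eq_intros derv[OF that])
    fix \<tau> assume "\<tau> \<in> closed_segment t (t + h)"
    then have \<tau>: "t \<le> \<tau>" "\<tau> \<le> t + h" using h by (auto simp: closed_segment_eq_real_ivl)
    then have \<tau>': "\<tau> \<in> {a..b}" using t by auto
    have "norm (x \<tau> - x1) \<le> R * \<bar>\<tau> - (t + h)\<bar>" unfolding x1_def using x_diff[OF t(2) \<tau>'] .
    also have "\<dots> \<le> R * h" using \<tau> nonneg by (intro mult_left_mono) auto
    finally have dist: "\<bar>\<tau> - t\<bar> + norm (x \<tau> - x1) \<le> (1 + R) * h" using \<tau> by (auto simp: algebra_simps)
    have 1: "\<Lambda> * (\<bar>\<tau> - t\<bar> + norm (x \<tau> - x1)) \<le> \<Lambda> * ((1 + R) * h)"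
      using dist nonneg by (intro mult_left_mono) auto
    have dA: "norm (A \<tau> (x \<tau>) - A t x1) \<le> \<Lambda> * ((1 + R) * h)"
      using A_lip[OF \<tau>' t(1), of "x \<tau>" x1] 1 by linarith
    have dB: "\<bar>B \<tau> (x \<tau>) - B t x1\<bar> \<le> \<Lambda> * ((1 + R) * h)"
      using B_lip[OF \<tau>' t(1), of "x \<tau>" x1] 1 by linarith
    have dBv: "norm ((B \<tau> (x \<tau>) - B t x1) *\<^sub>R v \<tau>) \<le> \<Lambda> * ((1 + R) * h) * R"
      using dB v_le[OF \<tau>'] nonneg h by (simp, intro mult_mono) auto
    have "norm (v \<tau> - v t) \<le> acc_max * \<bar>\<tau> - t\<bar>" using v_diff[OF t(1) \<tau>'] .
    also have "\<dots> \<le> acc_max * h" using \<tau> err_nonneg by (intro mult_left_mono) auto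
    finally have dvv: "norm (B t x1 *\<^sub>R (v \<tau> - v t)) \<le> \<kappa> * (acc_max * h)"
      using B_le[OF t(1), of x1] nonneg by (simp, intro mult_mono) auto
    have "(A \<tau> (x \<tau>) - B \<tau> (x \<tau>) *\<^sub>R v \<tau>) - w =
        (A \<tau> (x \<tau>) - A t x1) - ((B \<tau> (x \<tau>) - B t x1) *\<^sub>R v \<tau> + B t x1 *\<^sub>R (v \<tau> - v t))"
      by (simp add: w_def algebra_simps)
    also have "norm \<dots> \<le> \<Lambda> * ((1 + R) * h) + (\<Lambda> * ((1 + R) * h) * R + \<kappa> * (acc_max * h))"
      by (rule order_trans[OF norm_triangle_ineq4 add_mono[OF dA order_trans[OF norm_triangle_ineq add_mono[OF dBv dvv]]]])
    also have "\<dots> = kick_err * h" by (simp add: kick_err_def algebra_simps)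
    finally show "norm ((A \<tau> (x \<tau>) - B \<tau> (x \<tau>) *\<^sub>R v \<tau>) - w) \<le> kick_err * h" .
  qed
  then show ?thesis using h by (simp add: w_def x1_def power2_eq_square algebra_simps)
qed

text \<open>Stability and consistency together: the kick is evaluated at the new position, so the
  position error after the drift feeds into the velocity error through
  \<open>\<Lambda> * (1 + R)\<close>, while \<kappa> carries the old velocity error.\<close>

lemma euler_step_error:
  assumes t: "t \<in> {a..b}" "t + h \<in> {a..b}" and h: "0 \<le> h" "h \<le> 1"
    and y: "(y', w') = kick (A t) (B t) h (drift h (y, w))"
  shows "norm (y' - x (t + h)) + norm (w' - v (t + h))
    \<le> (1 + err_rate * h) * (norm (y - x t) + norm (w - v t)) + err_src * h\<^sup>2"
proof -
  let ?dx = "norm (y - x t)" and ?dv = "norm (w - v t)"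
  define x1 where "x1 = x (t + h)"
  have y': "y' = y + h *\<^sub>R w" and w': "w' = w + h *\<^sub>R (A t y' - B t y' *\<^sub>R w)"
    using y by (auto simp: kick_def drift_def algebra_simps)
  have "y' - x1 = (y - x t) + h *\<^sub>R (w - v t) - (x1 - x t - h *\<^sub>R v t)"
    by (simp add: y' algebra_simps)
  also have "norm \<dots> \<le> (?dx + h * ?dv) + acc_max * h\<^sup>2"
  proof (rule order_trans[OF norm_triangle_ineq4 add_mono])
    show "norm ((y - x t) + h *\<^sub>R (w - v t)) \<le> ?dx + h * ?dv"
      using norm_triangle_ineq[of "y - x t" "h *\<^sub>R (w - v t)"] h by simp
    show "norm (x1 - x t - h *\<^sub>R v t) \<le> acc_max * h\<^sup>2"
      using drift_consistent[OF t h(1)] by (simp add: x1_def)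
  qed
  finally have dx': "norm (y' - x1) \<le> ?dx + h * ?dv + acc_max * h\<^sup>2" .
  have dA: "norm (A t y' - A t x1) \<le> \<Lambda> * norm (y' - x1)"
    using A_lip[OF t(1) t(1), of y' x1] by simp
  have dB: "\<bar>B t y' - B t x1\<bar> \<le> \<Lambda> * norm (y' - x1)"
    using B_lip[OF t(1) t(1), of y' x1] by simp
  have dB1: "norm ((B t y' - B t x1) *\<^sub>R v t) \<le> \<Lambda> * norm (y' - x1) * R"
    using dB v_le[OF t(1)] nonneg by (simp, intro mult_mono) auto
  have dB2: "norm (B t y' *\<^sub>R (w - v t)) \<le> \<kappa> * ?dv"
    using B_le[OF t(1), of y'] nonneg by (simp, intro mult_mono) auto
  have eq: "w' - v (t + h) = (w - v t) + h *\<^sub>R ((A t y' - A t x1) - ((B t y' - B t x1) *\<^sub>R v t + B t y' *\<^sub>R (w - v t)))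
      - (v (t + h) - v t - h *\<^sub>R (A t x1 - B t x1 *\<^sub>R v t))"
    by (simp add: w' algebra_simps)
  have "norm (w' - v (t + h)) \<le> ?dv + h * (\<Lambda> * norm (y' - x1) + (\<Lambda> * norm (y' - x1) * R + \<kappa> * ?dv)) + kick_err * h\<^sup>2"
    unfolding eq
  proof (rule order_trans[OF norm_triangle_ineq4 add_mono[OF order_trans[OF norm_triangle_ineq add_mono]]])
    show "norm (h *\<^sub>R ((A t y' - A t x1) - ((B t y' - B t x1) *\<^sub>R v t + B t y' *\<^sub>R (w - v t))))
        \<le> h * (\<Lambda> * norm (y' - x1) + (\<Lambda> * norm (y' - x1) * R + \<kappa> * ?dv))"
    proof -
      have "norm ((A t y' - A t x1) - ((B t y' - B t x1) *\<^sub>R v t + B t y' *\<^sub>R (w - v t)))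
        \<le> \<Lambda> * norm (y' - x1) + (\<Lambda> * norm (y' - x1) * R + \<kappa> * ?dv)"
        by (rule order_trans[OF norm_triangle_ineq4 add_mono[OF dA order_trans[OF norm_triangle_ineq add_mono[OF dB1 dB2]]]])
      then show ?thesis using h mult_left_mono by fastforce
    qed
    show "norm (v (t + h) - v t - h *\<^sub>R (A t x1 - B t x1 *\<^sub>R v t)) \<le> kick_err * h\<^sup>2"
      using kick_consistent[OF t h(1)] by (simp add: x1_def)
  qed simp
  also have "\<dots> = ?dv + (h * (\<Lambda> * (1 + R))) * norm (y' - x1) + h * \<kappa> * ?dv + kick_err * h\<^sup>2"
    by (simp add: algebra_simps)
  \<comment> \<open>\<open>h \<le> 1\<close> enters twice: it replaces \<open>h * ?dv\<close> by
    \<open>?dv\<close> and absorbs the surplus power of \<open>h\<close>.\<close>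
  also have "(h * (\<Lambda> * (1 + R))) * norm (y' - x1) \<le> (h * (\<Lambda> * (1 + R))) * (?dx + ?dv) + \<Lambda> * (1 + R) * acc_max * h\<^sup>2"
  proof -
    have "h * ?dv \<le> ?dv" using h mult_right_mono[of h 1 ?dv] by simp
    then have "(h * (\<Lambda> * (1 + R))) * norm (y' - x1) \<le> (h * (\<Lambda> * (1 + R))) * (?dx + ?dv + acc_max * h\<^sup>2)"
      using dx' h nonneg by (intro mult_left_mono) auto
    also have "\<dots> = (h * (\<Lambda> * (1 + R))) * (?dx + ?dv) + h * (\<Lambda> * (1 + R) * acc_max * h\<^sup>2)"
      by (simp add: algebra_simps)
    also have "h * (\<Lambda> * (1 + R) * acc_max * h\<^sup>2) \<le> 1 * (\<Lambda> * (1 + R) * acc_max * h\<^sup>2)"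
      using h nonneg err_nonneg by (intro mult_right_mono) auto
    finally show ?thesis by simp
  qed
  finally have dv': "norm (w' - v (t + h)) \<le> ?dv + (h * (\<Lambda> * (1 + R)) * (?dx + ?dv) + \<Lambda> * (1 + R) * acc_max * h\<^sup>2) + h * \<kappa> * ?dv + kick_err * h\<^sup>2"
    by simp
  have "h * \<kappa> * ?dv \<le> h * \<kappa> * (?dx + ?dv)" "h * ?dv \<le> h * (?dx + ?dv)"
    using h nonneg by (auto intro!: mult_left_mono)
  then have "norm (y' - x1) + norm (w' - v (t + h)) \<le>
      ?dx + h * (?dx + ?dv) + acc_max * h\<^sup>2 + (?dv + (h * (\<Lambda> * (1 + R)) * (?dx + ?dv) + \<Lambda> * (1 + R) * acc_max * h\<^sup>2)
      + h * \<kappa> * (?dx + ?dv) + kick_err * h\<^sup>2)"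
    using dx' dv' by linarith
  also have "\<dots> = (1 + err_rate * h) * (?dx + ?dv) + err_src * h\<^sup>2"
    by (simp add: err_rate_def err_src_def algebra_simps)
  finally show ?thesis by (simp add: x1_def)
qed

text \<open>Discrete Gronwall: \<open>k\<close> local errors of order \<open>h\<^sup>2\<close>, each
  amplified by at most \<open>exp (err_rate * h)\<close> per step. With \<open>k * h\<close> fixed
  the total is of order \<open>h\<close>.\<close>

lemma symplectic_euler_error:
  assumes k: "a + real k * h \<in> {a..b}" and h: "0 \<le> h" "h \<le> 1"
  shows "dist (symplectic_euler A B a h k (x a, v a)) (x (a + k * h), v (a + k * h))
    \<le> real k * err_src * h\<^sup>2 * exp (err_rate * (k * h))"
proof -
  define y where "y k = fst (symplectic_euler A B a h k (x a, v a))" for k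
  define w where "w k = snd (symplectic_euler A B a h k (x a, v a))" for k
  have yw: "symplectic_euler A B a h k (x a, v a) = (y k, w k)" for k by (simp add: y_def w_def)
  let ?e = "\<lambda>k. norm (y k - x (a + real k * h)) + norm (w k - v (a + real k * h))"
  have "?e k \<le> real k * err_src * h\<^sup>2 * exp (err_rate * (k * h))"
    using k
  proof (induction k)
    case 0
    then show ?case by (simp add: y_def w_def)
  next
    case (Suc k)
    have t: "a + real k * h \<in> {a..b}" "a + real k * h + h \<in> {a..b}"
      using Suc.prems h(1) by (auto simp: algebra_simps intro: order_trans)
    have eq: "a + real (Suc k) * h = a + real k * h + h" by (simp add: algebra_simps)
    have "(y (Suc k), w (Suc k)) = kick (A (a + real k * h)) (B (a + real k * h)) h (drift h (y k, w k))"
      by (simp flip: yw)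
    from euler_step_error[OF t h this]
    have "?e (Suc k) \<le> (1 + err_rate * h) * ?e k + err_src * h\<^sup>2" unfolding eq .
    also have "\<dots> \<le> exp (err_rate * h) * (real k * err_src * h\<^sup>2 * exp (err_rate * (k * h))) + err_src * h\<^sup>2"
      using Suc.IH[OF t(1)] err_nonneg h by (intro add_mono mult_mono exp_ge_add_one_self) auto
    also have "\<dots> = real k * err_src * h\<^sup>2 * exp (err_rate * (Suc k * h)) + err_src * h\<^sup>2 * 1"
      by (simp add: algebra_simps flip: exp_add)
    also have "\<dots> \<le> real k * err_src * h\<^sup>2 * exp (err_rate * (Suc k * h)) + err_src * h\<^sup>2 * exp (err_rate * (Suc k * h))"
      using err_nonneg h by (intro add_left_mono mult_left_mono) auto
    finally show ?case by (simp add: algebra_simps)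
  qed
  moreover have "dist (y k, w k) (x (a + k * h), v (a + k * h)) \<le> ?e k"
    unfolding dist_norm by (simp add: norm_Pair_le)
  ultimately show ?thesis unfolding yw by simp
qed

end

text \<open>With \<open>n + 1\<close> steps of size \<open>(b - a) / (n + 1)\<close> the kicks cost
  \<open>(1 - h * \<kappa>)\<close> to the power \<open>- d * (n + 1)\<close>, which tends to the
  stated exponential. The constants \<Lambda>, \<open>R\<close> and \<alpha> occur only in the
  distance between scheme and flow, which tends to 0, and so leave no trace in the result.\<close>

theorem liouville_density_le:
  fixes X V :: "real \<Rightarrow> 'z \<Rightarrow> 'a::euclidean_space" and A :: "real \<Rightarrow> 'a \<Rightarrow> 'a"
    and a b c \<Lambda> R \<alpha> \<kappa> :: real
  assumes P: "prob_space P" and ab: "a \<le> b"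
    and meas: "(\<lambda>z. (X a z, V a z)) \<in> borel_measurable P" "(\<lambda>z. (X b z, V b z)) \<in> borel_measurable P"
    and curve: "AE z in P. second_order_curve (\<lambda>s. X s z) (\<lambda>s. V s z) A B a b \<Lambda> R \<alpha> \<kappa>"
    and dens: "density_le c (distr P borel (\<lambda>z. (X a z, V a z)))"
  shows "density_le (c * exp (DIM('a) * \<kappa> * (b - a))) (distr P borel (\<lambda>z. (X b z, V b z)))"
proof -
  interpret prob_space P by (rule P)
  \<comment> \<open>One good trajectory suffices to extract the bounds on \<open>A\<close> and
    \<open>B\<close>, which are the same for all trajectories.\<close>
  have "\<exists>z. second_order_curve (\<lambda>s. X s z) (\<lambda>s. V s z) A B a b \<Lambda> R \<alpha> \<kappa>"
  proof (rule ccontr)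
    assume "\<nexists>z. second_order_curve (\<lambda>s. X s z) (\<lambda>s. V s z) A B a b \<Lambda> R \<alpha> \<kappa>"
    with curve have "AE z in P. False" by simp
    then show False by simp
  qed
  then obtain z0 where z0: "second_order_curve (\<lambda>s. X s z0) (\<lambda>s. V s z0) A B a b \<Lambda> R \<alpha> \<kappa>" ..
  interpret C: second_order_curve "\<lambda>s. X s z0" "\<lambda>s. V s z0" A B a b \<Lambda> R \<alpha> \<kappa> by (rule z0)
  have lip_meas: "A \<tau> \<in> borel_measurable borel" "B \<tau> \<in> borel_measurable borel" if \<tau>: "\<tau> \<in> {a..b}" for \<tau>
  proof -
    have "\<Lambda>-lipschitz_on UNIV (A \<tau>)" "\<Lambda>-lipschitz_on UNIV (B \<tau>)"
      using C.A_lip[OF \<tau> \<tau>] C.B_lip[OF \<tau> \<tau>] C.nonneg(1) by (auto simp: lipschitz_on_def dist_norm)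
    then show "A \<tau> \<in> borel_measurable borel" "B \<tau> \<in> borel_measurable borel"
      by (auto intro!: borel_measurable_continuous_onI lipschitz_on_continuous_on)
  qed
  define h where "h n = (b - a) / real (Suc n)" for n
  define err where "err n = (b - a) * C.err_src * exp (C.err_rate * (b - a)) * h n" for n
  define q where "q n = inverse ((1 - h n * \<kappa>) ^ DIM('a)) ^ Suc n" for n
  have h0: "h n \<ge> 0" for n using ab by (simp add: h_def)
  have hn: "real (Suc n) * h n = b - a" for n by (simp add: h_def)
  have h_lim: "h \<longlonglongrightarrow> 0"
    unfolding h_def using lim_const_over_n[of "b - a"] by (rule LIMSEQ_Suc)
  have h_dec: "h n \<le> h m" if "m \<le> n" for m n
    unfolding h_def using ab that by (intro divide_left_mono) auto
  let ?\<mu> = "distr P borel (\<lambda>z. (X a z, V a z))"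
  show ?thesis
  proof (rule density_le_limit[where \<epsilon>=err and c="\<lambda>n. c * q n"])
    show "err \<longlonglongrightarrow> 0"
      unfolding err_def using tendsto_mult_right_zero[OF h_lim] by simp
    show "decseq err"
      unfolding decseq_def err_def using h_dec ab C.err_nonneg by (auto intro!: mult_left_mono)
    have "(\<lambda>n. (1 + (- ((b - a) * \<kappa>)) / real (Suc n)) ^ Suc n) \<longlonglongrightarrow> exp (- ((b - a) * \<kappa>))"
      using tendsto_exp_limit_sequentially by (rule LIMSEQ_Suc)
    then have "(\<lambda>n. (1 - h n * \<kappa>) ^ Suc n) \<longlonglongrightarrow> exp (- ((b - a) * \<kappa>))"
      by (simp add: h_def)
    then have "(\<lambda>n. inverse (((1 - h n * \<kappa>) ^ Suc n) ^ DIM('a))) \<longlonglongrightarrow> inverse (exp (- ((b - a) * \<kappa>)) ^ DIM('a))"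
      by (intro tendsto_inverse tendsto_power) auto
    also have "(\<lambda>n. inverse (((1 - h n * \<kappa>) ^ Suc n) ^ DIM('a))) = q"
    proof
      have "inverse ((y ^ k) ^ d) = inverse (y ^ d) ^ k" for y :: real and k d :: nat
        by (simp only: power_inverse power_mult[symmetric] mult.commute)
      then show "inverse (((1 - h n * \<kappa>) ^ Suc n) ^ DIM('a)) = q n" for n unfolding q_def .
    qed
    also have "inverse (exp (- ((b - a) * \<kappa>)) ^ DIM('a)) = exp (DIM('a) * \<kappa> * (b - a))"
    proof -
      have "inverse (exp (- y) ^ k) = exp (real k * y)" for y :: real and k :: nat
        by (simp add: exp_minus power_inverse exp_of_nat_mult)
      then show ?thesis by (simp add: mult.assoc mult.commute[of \<kappa>])
    qed
    finally show "(\<lambda>n. c * q n) \<longlonglongrightarrow> c * exp (DIM('a) * \<kappa> * (b - a))"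
      by (intro tendsto_mult_left)
  next
    fix F :: "('a \<times> 'a) set" assume F: "compact F"
    have "(\<lambda>n. h n * \<kappa>) \<longlonglongrightarrow> 0" using tendsto_mult_left_zero[OF h_lim] .
    then have "\<forall>\<^sub>F n in sequentially. h n * \<kappa> < 1" by (rule order_tendstoD) simp
    moreover have "\<forall>\<^sub>F n in sequentially. h n < 1" using h_lim by (rule order_tendstoD) simp
    ultimately show "\<forall>\<^sub>F n in sequentially. emeasure (distr P borel (\<lambda>z. (X b z, V b z))) F
        \<le> ennreal (c * q n) * emeasure lborel (thickening (err n) F)"
    proof eventually_elim
      case (elim n)
      let ?E = "symplectic_euler A B a (h n) (Suc n)"
      have nodes: "a + real j * h n \<in> {a..b}" if "j < Suc n" for j
      proof -
        have "real j * h n \<le> real (Suc n) * h n" using that h0 by (intro mult_right_mono) auto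
        then show ?thesis using hn[of n] h0[of n] by simp
      qed
      have E: "?E \<in> borel_measurable borel" "density_le (c * q n) (distr ?\<mu> borel ?E)"
      proof -
        have "sets ?\<mu> = sets borel" by simp
        note symplectic_euler_density_le[where k="Suc n" and h="h n" and A=A and B=B and a=a and \<kappa>=\<kappa>, OF dens this]
        from this[OF lip_meas(1)[OF nodes] lip_meas(2)[OF nodes] C.B_le[OF nodes] h0 elim(1)]
        show "?E \<in> borel_measurable borel" "density_le (c * q n) (distr ?\<mu> borel ?E)"
          unfolding q_def by blast+
      qed
      have th: "thickening (err n) F \<in> sets borel" using compact_thickening[OF F] by (rule borel_compact)
      have mE: "(\<lambda>z. ?E (X a z, V a z)) \<in> borel_measurable P"
        using measurable_compose[OF meas(1) E(1)] .
      \<comment> \<open>The error constants depend only on \<Lambda>, \<open>R\<close>, \<alpha> and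
        \<kappa>, so \<open>err n\<close> is the same for almost every trajectory and one thickening
        catches all scheme images.\<close>
      have close: "AE z in P. (X b z, V b z) \<in> F \<longrightarrow> ?E (X a z, V a z) \<in> thickening (err n) F"
        using curve
      proof eventually_elim
        case (elim z)
        interpret Z: second_order_curve "\<lambda>s. X s z" "\<lambda>s. V s z" A B a b \<Lambda> R \<alpha> \<kappa> by (rule elim)
        have "dist (?E (X a z, V a z)) (X (a + Suc n * h n) z, V (a + Suc n * h n) z)
            \<le> real (Suc n) * C.err_src * (h n)\<^sup>2 * exp (C.err_rate * (Suc n * h n))"
        proof (rule Z.symplectic_euler_error)
          show "a + real (Suc n) * h n \<in> {a..b}" unfolding hn using ab by simp
        qed (use h0 \<open>h n < 1\<close> in auto)
        also have "\<dots> = (real (Suc n) * h n) * C.err_src * exp (C.err_rate * (Suc n * h n)) * h n"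
          by (simp only: power2_eq_square mult_ac)
        finally have "dist (?E (X a z, V a z)) (X b z, V b z) \<le> err n"
          unfolding hn by (simp add: err_def)
        then show ?case unfolding thickening_def by blast
      qed
      have "emeasure (distr P borel (\<lambda>z. (X b z, V b z))) F = emeasure P ((\<lambda>z. (X b z, V b z)) -` F \<inter> space P)"
        using borel_compact[OF F] by (intro emeasure_distr meas)
      also have "\<dots> \<le> emeasure P ((\<lambda>z. ?E (X a z, V a z)) -` thickening (err n) F \<inter> space P)"
        using close measurable_sets[OF mE th] by (intro emeasure_mono_AE) auto
      also have "\<dots> = emeasure (distr ?\<mu> borel ?E) (thickening (err n) F)"
        using E(1) meas(1) th mE by (simp add: distr_distr emeasure_distr comp_def)
      also have "\<dots> \<le> ennreal (c * q n) * emeasure lborel (thickening (err n) F)"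
        using E(2) th unfolding density_le_def by blast
      finally show ?case .
    qed
  qed (use meas in \<open>simp_all add: emeasure_distr emeasure_space_1\<close>)
qed

section \<open>The mean-field flow\<close>

text \<open>Kept apart from any solution, so that the final constant can be named as a function of
  the data before a solution is given.\<close>

locale flow_constants =
  fixes \<kappa> L T Rx Rv c0 :: real and d :: nat
  assumes \<kappa>_pos: "\<kappa> > 0" and L_nonneg: "L \<ge> 0" and T_pos: "T > 0"
    and Rx_pos: "Rx > 0" and Rv_pos: "Rv > 0" and c0_nonneg: "c0 \<ge> 0"
begin

text \<open>The factor of \<open>gronwall_sup\<close> on a time interval of length \<open>T\<close>,
  in the role of an exponential.\<close>

definition growth :: "real \<Rightarrow> real" where "growth c = 2 ^ nat \<lceil>2 * c * T\<rceil>"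

text \<open>\<open>moment_max\<close> bounds the first velocity moment, with the rate from
  \<open>first_moment_step\<close>; \<open>RV\<close>, \<open>RX\<close> and \<open>RA\<close> bound
  velocity, position and acceleration along trajectories starting in the initial box.\<close>

definition moment_max :: real where "moment_max = growth (5 * \<kappa>) * Rv"
definition RV :: real where "RV = growth \<kappa> * (Rv + moment_max)"
definition RX :: real where "RX = Rx + T * RV"
definition RA :: real where "RA = \<kappa> * (moment_max + RV)"

text \<open>Density bound, times volume per unit width of a shell of radius at most
  \<open>2 * RX + 1\<close>, times volume of the velocity ball. The \<open>max 1\<close> serves
  shells of width at least 1, whose mass is at most 1.\<close>

definition shell_const :: "real \<Rightarrow> real" where
  "shell_const c = max 1
     (c * (unit_ball_vol (real d) * (real d * (2 * RX + 1) ^ (d - 1))) * (unit_ball_vol (real d) * RV ^ d))"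
definition density_max :: real where "density_max = c0 * exp (real d * \<kappa> * T)"
definition shell_max :: real where "shell_max = shell_const density_max"
text \<open>The summand 1 comes from \<open>X' = V\<close>, the others are the Lipschitz constants
  of the force. The 2 in \<open>flow_lip\<close> pays for passing from the sum of the component
  norms to the product metric.\<close>

definition lip_rate :: real where "lip_rate = 1 + 4 * L * shell_max * RV + \<kappa>"
definition flow_lip :: real where "flow_lip = 2 * growth lip_rate"

text \<open>In order: \<open>X' = V\<close>; replacing the mean-field integral by the average over
  flow images; changing the kernel weights, where \<open>5 * shell_max\<close> is 4 from the
  displacements and 1 from the smoothing, times a relative velocity of at most
  \<open>2 * RV\<close>; changing the relative velocities.\<close>

definition agent_rate :: real where
  "agent_rate = 1 + (2 * L * shell_max * RV + \<kappa>) * flow_lip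
     + 2 * L * RV * (5 * shell_max + flow_lip) + 2 * \<kappa>"
definition stability_const :: real where "stability_const = 2 * (flow_lip + growth agent_rate)"

lemma growth_ge_1: "growth c \<ge> 1"
  by (simp add: growth_def)

lemma constants_nonneg: "0 \<le> moment_max" "0 \<le> RV" "0 \<le> RX" "0 \<le> RA"
  using growth_ge_1[of "5 * \<kappa>"] growth_ge_1[of \<kappa>] Rv_pos Rx_pos T_pos \<kappa>_pos
  by (auto simp: moment_max_def RV_def RX_def RA_def)

end

text \<open>Lagrangian form: \<open>P\<close> is the law of the initial states, and integrals
  against the law at time \<open>t\<close> become integrals of \<open>X t\<close> and
  \<open>V t\<close> over \<open>P\<close>. The density bound \<open>dens_ex\<close> may vary with
  \<open>t\<close>, and \<open>K\<close> satisfies its bounds on the whole line.\<close>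

locale topological_flow = prob_space P + flow_constants \<kappa> L T Rx Rv c0 "DIM('a)"
  for P :: "('a::euclidean_space \<times> 'a) measure" and \<kappa> L T Rx Rv c0 +
  fixes K :: "real \<Rightarrow> real" and X V :: "real \<Rightarrow> 'a \<times> 'a \<Rightarrow> 'a"
  assumes K_nonneg: "\<And>r. 0 \<le> K r" and K_le: "\<And>r. K r \<le> \<kappa>"
    and K_lip: "\<And>r s. \<bar>K r - K s\<bar> \<le> L * \<bar>r - s\<bar>"
    and sets_P: "sets P = sets borel"
    and supp: "AE z in P. z \<in> cball 0 Rx \<times> cball 0 Rv"
    and dens0: "density_le c0 P"
    and flow_meas: "\<And>t. t \<in> {0..T} \<Longrightarrow> (\<lambda>z. (X t z, V t z)) \<in> borel_measurable borel"
    and init: "\<And>z. X 0 z = fst z" "\<And>z. V 0 z = snd z"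
    and integrable_V: "\<And>t. t \<in> {0..T} \<Longrightarrow> integrable P (V t)"
    and dens_ex: "\<And>t. t \<in> {0..T} \<Longrightarrow> \<exists>c\<ge>0. density_le c (distr P borel (\<lambda>z. (X t z, V t z)))"
    and derX: "\<And>t z. t \<in> {0..T} \<Longrightarrow> ((\<lambda>s. X s z) has_vector_derivative V t z) (at t within {0..T})"
    and derV: "\<And>t z. t \<in> {0..T} \<Longrightarrow> ((\<lambda>s. V s z) has_vector_derivative
        (LINT z'|P. K (measure P {z''. norm (X t z'' - X t z) \<le> norm (X t z - X t z')}) *\<^sub>R (V t z' - V t z)))
        (at t within {0..T})"
begin

abbreviation D :: "('a \<times> 'a) set" where "D \<equiv> cball 0 Rx \<times> cball 0 Rv"

definition M :: "real \<Rightarrow> 'a \<Rightarrow> real \<Rightarrow> real" where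
  "M t x r = measure P {z. norm (X t z - x) \<le> r}"

definition weight :: "real \<Rightarrow> 'a \<Rightarrow> 'a \<times> 'a \<Rightarrow> real" where
  "weight t x z = K (M t x (norm (x - X t z)))"

text \<open>The force at \<open>(x, v)\<close> is \<open>A t x - B t x *\<^sub>R v\<close>, the
  affine form that the volume estimate for kicks relies on.\<close>

definition A :: "real \<Rightarrow> 'a \<Rightarrow> 'a" where "A t x = (LINT z|P. weight t x z *\<^sub>R V t z)"
definition B :: "real \<Rightarrow> 'a \<Rightarrow> real" where "B t x = (LINT z|P. weight t x z)"

definition first_moment :: "real \<Rightarrow> real" where "first_moment t = (LINT z|P. norm (V t z))"

lemma space_P [simp]: "space P = UNIV"
  using sets_eq_imp_space_eq[OF sets_P] by simp

lemma prob_UNIV [simp]: "prob UNIV = 1"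
  using prob_space by simp

lemma flow_meas_P: "t \<in> {0..T} \<Longrightarrow> (\<lambda>z. (X t z, V t z)) \<in> borel_measurable P"
  using flow_meas sets_P by (simp cong: measurable_cong_sets)

lemma X_meas: "t \<in> {0..T} \<Longrightarrow> X t \<in> borel_measurable P"
  using measurable_compose[OF flow_meas_P, of t fst borel]
  by (simp add: borel_measurable_continuous_onI continuous_on_fst)

lemma V_meas: "t \<in> {0..T} \<Longrightarrow> V t \<in> borel_measurable P"
  using integrable_V by (rule borel_measurable_integrable)

lemma M_sets: "t \<in> {0..T} \<Longrightarrow> {z. norm (X t z - x) \<le> r} \<in> sets P"
proof -
  assume t: "t \<in> {0..T}"
  have "{z \<in> space P. norm (X t z - x) \<le> r} \<in> sets P"
    using X_meas[OF t] by measurable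
  then show ?thesis by simp
qed

lemma M_mono: "t \<in> {0..T} \<Longrightarrow> mono (M t x)"
  unfolding M_def mono_def by (auto intro!: finite_measure_mono M_sets)

lemma K_cont: "continuous_on UNIV K"
proof -
  have "L-lipschitz_on UNIV K" using K_lip L_nonneg by (auto simp: lipschitz_on_def dist_real_def)
  then show ?thesis by (rule lipschitz_on_continuous_on)
qed

lemma K_meas: "K \<in> borel_measurable borel"
  using K_cont by (rule borel_measurable_continuous_onI)

text \<open>The mass is monotone in the radius and therefore Borel; its continuity becomes available
  only with density bounds.\<close>

lemma weight_meas: "t \<in> {0..T} \<Longrightarrow> weight t x \<in> borel_measurable P"
proof -
  assume t: "t \<in> {0..T}"
  have "(\<lambda>z. norm (x - X t z)) \<in> borel_measurable P" using X_meas[OF t] by simp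
  then show ?thesis
    unfolding weight_def
    by (intro measurable_compose[OF _ K_meas] measurable_compose[OF _ borel_measurable_mono[OF M_mono[OF t]]])
qed

lemma weight_range: "0 \<le> weight t x z" "weight t x z \<le> \<kappa>"
  unfolding weight_def using K_nonneg K_le by auto

lemma weight_integrable: "t \<in> {0..T} \<Longrightarrow> integrable P (weight t x)"
  by (rule integrable_const_bound[where B=\<kappa>]) (auto simp: weight_range weight_meas)

lemma weight_V_integrable: "t \<in> {0..T} \<Longrightarrow> integrable P (\<lambda>z. weight t x z *\<^sub>R V t z)"
proof (rule Bochner_Integration.integrable_bound[where f="\<lambda>z. \<kappa> *\<^sub>R V t z"])
  assume t: "t \<in> {0..T}"
  show "integrable P (\<lambda>z. \<kappa> *\<^sub>R V t z)" using integrable_V[OF t] by simp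
  show "(\<lambda>z. weight t x z *\<^sub>R V t z) \<in> borel_measurable P"
    using weight_meas[OF t] V_meas[OF t] by simp
  show "AE z in P. norm (weight t x z *\<^sub>R V t z) \<le> norm (\<kappa> *\<^sub>R V t z)"
    using weight_range[of t x] \<kappa>_pos by (intro AE_I2) (auto intro!: mult_right_mono)
qed

lemma derV': "t \<in> {0..T} \<Longrightarrow>
    ((\<lambda>s. V s z) has_vector_derivative A t (X t z) - B t (X t z) *\<^sub>R V t z) (at t within {0..T})"
proof -
  assume t: "t \<in> {0..T}"
  have "(LINT z'|P. weight t (X t z) z' *\<^sub>R (V t z' - V t z)) = A t (X t z) - B t (X t z) *\<^sub>R V t z"
    using weight_V_integrable[OF t] weight_integrable[OF t]
    by (simp add: scaleR_diff_right A_def B_def)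
  then show ?thesis using derV[OF t, of z] by (simp add: weight_def M_def)
qed

lemma B_le: "t \<in> {0..T} \<Longrightarrow> \<bar>B t x\<bar> \<le> \<kappa>"
proof -
  assume t: "t \<in> {0..T}"
  have "B t x \<le> (LINT z|P. \<kappa>)"
    unfolding B_def by (intro integral_mono weight_integrable t) (auto simp: weight_range)
  moreover have "0 \<le> B t x" unfolding B_def by (intro integral_nonneg_AE AE_I2 weight_range)
  ultimately show ?thesis by simp
qed

lemma A_le: "t \<in> {0..T} \<Longrightarrow> norm (A t x) \<le> \<kappa> * first_moment t"
proof -
  assume t: "t \<in> {0..T}"
  have "norm (A t x) \<le> (LINT z|P. norm (weight t x z *\<^sub>R V t z))"
    unfolding A_def by (rule integral_norm_bound)
  also have "\<dots> \<le> (LINT z|P. \<kappa> * norm (V t z))"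
    using integrable_V[OF t] weight_range[of t x]
    by (intro integral_mono[OF integrable_norm[OF weight_V_integrable[OF t]]]) (auto intro!: mult_right_mono)
  finally show ?thesis by (simp add: first_moment_def)
qed

lemma acc_le:
  assumes t: "t \<in> {0..T}" and S: "first_moment t \<le> S"
  shows "norm (A t x - B t x *\<^sub>R v) \<le> \<kappa> * (S + norm v)"
proof -
  have "norm (A t x - B t x *\<^sub>R v) \<le> norm (A t x) + \<bar>B t x\<bar> * norm v"
    using norm_triangle_ineq4[of "A t x" "B t x *\<^sub>R v"] by simp
  also have "\<dots> \<le> \<kappa> * S + \<kappa> * norm v"
    using A_le[OF t, of x] mult_left_mono[OF S, of \<kappa>] \<kappa>_pos B_le[OF t, of x]
    by (intro add_mono mult_right_mono) (linarith | simp)+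
  finally show ?thesis by (simp add: algebra_simps)
qed

lemma first_moment_nonneg: "0 \<le> first_moment t"
  unfolding first_moment_def by simp

lemma V_cont: "continuous_on {0..T} (\<lambda>t. V t z)"
  using derV' by (meson continuous_on_eq_continuous_within has_vector_derivative_continuous)

lemma X_cont: "continuous_on {0..T} (\<lambda>t. X t z)"
  using derX by (meson continuous_on_eq_continuous_within has_vector_derivative_continuous)

text \<open>Gronwall along one trajectory, valid for every initial state. The length
  \<open>T'\<close> is kept free: on short intervals the factor is 2, on the whole interval it is
  \<open>growth \<kappa>\<close>.\<close>

lemma V_growth:
  assumes ab: "{a..b} \<subseteq> {0..T}" and S: "\<And>\<tau>. \<tau> \<in> {a..b} \<Longrightarrow> first_moment \<tau> \<le> S"
    and st: "s \<in> {a..b}" "t \<in> {a..b}" and T': "b - a \<le> T'"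
  shows "norm (V t z) + S \<le> 2 ^ nat \<lceil>2 * \<kappa> * T'\<rceil> * (norm (V s z) + S)"
proof (rule gronwall_sup[OF \<kappa>_pos _ _ _ _ st T'])
  show "S \<ge> 0" using S[OF st(1)] first_moment_nonneg[of s] by linarith
  have "compact ((\<lambda>t. norm (V t z)) ` {a..b})"
    using ab by (intro compact_continuous_image continuous_on_norm continuous_on_subset[OF V_cont]) auto
  then show "bdd_above ((\<lambda>t. norm (V t z)) ` {a..b})"
    by (intro bounded_imp_bdd_above compact_imp_bounded)
  fix s t W assume st: "s \<in> {a..b}" "t \<in> {a..b}"
    and W: "\<And>\<tau>. \<tau> \<in> closed_segment s t \<Longrightarrow> norm (V \<tau> z) \<le> W"
  have sub: "closed_segment s t \<subseteq> {a..b}" using st by (simp add: closed_segment_eq_real_ivl)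
  have "norm (V t z - V s z) \<le> (\<kappa> * (S + W)) * \<bar>t - s\<bar>"
  proof (rule norm_diff_le_of_derivative_bound[OF derV'])
    fix \<tau> assume \<tau>: "\<tau> \<in> closed_segment s t"
    then have "norm (A \<tau> (X \<tau> z) - B \<tau> (X \<tau> z) *\<^sub>R V \<tau> z) \<le> \<kappa> * (S + norm (V \<tau> z))"
      using sub ab by (intro acc_le S) auto
    also have "\<dots> \<le> \<kappa> * (S + W)" using W[OF \<tau>] \<kappa>_pos by simp
    finally show "norm (A \<tau> (X \<tau> z) - B \<tau> (X \<tau> z) *\<^sub>R V \<tau> z) \<le> \<kappa> * (S + W)" .
  qed (use st ab in auto)
  then show "norm (V t z) \<le> norm (V s z) + \<kappa> * \<bar>t - s\<bar> * (W + S)"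
    using norm_triangle_sub[of "V t z" "V s z"] by (simp add: algebra_simps)
qed simp

text \<open>A pointwise bound is integrated over \<open>P\<close>, which avoids differentiating
  under the integral. On a short interval \<open>norm (V \<tau> z)\<close> is at most
  \<open>2 * norm (V s z) + S\<close>, so the acceleration is at most
  \<open>\<kappa> * (2 * S + 2 * norm (V s z))\<close>, with mean at most
  \<open>4 * \<kappa> * S\<close>; the 5 leaves some room.\<close>

lemma first_moment_step:
  assumes st: "s \<in> {0..T}" "t \<in> {0..T}" and short: "5 * \<kappa> * \<bar>t - s\<bar> \<le> 1/2"
    and S: "\<And>\<tau>. \<tau> \<in> closed_segment s t \<Longrightarrow> first_moment \<tau> \<le> S"
  shows "first_moment t \<le> first_moment s + 5 * \<kappa> * \<bar>t - s\<bar> * (S + 0)"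
proof -
  let ?a = "min s t" and ?b = "max s t"
  have seg: "{?a..?b} = closed_segment s t" by (auto simp: closed_segment_eq_real_ivl)
  have sub: "{?a..?b} \<subseteq> {0..T}" using st by auto
  have "\<bar>t - s\<bar> \<le> 1 / (2 * \<kappa>)"
    using short \<kappa>_pos by (simp add: field_simps)
  then have len: "?b - ?a \<le> 1 / (2 * \<kappa>)" by simp
  \<comment> \<open>The exponent is 1: the interval is short enough for a single doubling.\<close>
  have two: "2 ^ nat \<lceil>2 * \<kappa> * (1 / (2 * \<kappa>))\<rceil> = (2::real)" using \<kappa>_pos by simp
  have V_le: "norm (V \<tau> z) \<le> 2 * norm (V s z) + S" if \<tau>: "\<tau> \<in> closed_segment s t" for \<tau> z
  proof -
    have "norm (V \<tau> z) + S \<le> 2 ^ nat \<lceil>2 * \<kappa> * (1 / (2 * \<kappa>))\<rceil> * (norm (V s z) + S)"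
      using \<tau> S unfolding seg[symmetric] by (intro V_growth[OF sub _ _ _ len]) auto
    then show ?thesis unfolding two by simp
  qed
  have Vt: "norm (V t z) \<le> norm (V s z) + \<kappa> * \<bar>t - s\<bar> * (2 * S + 2 * norm (V s z))" for z
  proof -
    have "norm (V t z - V s z) \<le> (\<kappa> * (S + (2 * norm (V s z) + S))) * \<bar>t - s\<bar>"
    proof (rule norm_diff_le_of_derivative_bound[OF derV' st])
      fix \<tau> assume \<tau>: "\<tau> \<in> closed_segment s t"
      then have "norm (A \<tau> (X \<tau> z) - B \<tau> (X \<tau> z) *\<^sub>R V \<tau> z) \<le> \<kappa> * (S + norm (V \<tau> z))"
        using sub seg by (intro acc_le S) auto
      also have "\<dots> \<le> \<kappa> * (S + (2 * norm (V s z) + S))" using V_le[OF \<tau>, of z] \<kappa>_pos by simp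
      finally show "norm (A \<tau> (X \<tau> z) - B \<tau> (X \<tau> z) *\<^sub>R V \<tau> z) \<le> \<kappa> * (S + (2 * norm (V s z) + S))" .
    qed
    then show ?thesis
      using norm_triangle_sub[of "V t z" "V s z"] by (simp add: algebra_simps)
  qed
  have "first_moment t \<le> (LINT z|P. norm (V s z) + \<kappa> * \<bar>t - s\<bar> * (2 * S + 2 * norm (V s z)))"
    unfolding first_moment_def
    using integrable_V[OF st(1)] integrable_V[OF st(2)] by (intro integral_mono Vt) auto
  also have "\<dots> = first_moment s + \<kappa> * \<bar>t - s\<bar> * (2 * S + 2 * first_moment s)"
    using integrable_V[OF st(1)] by (simp add: first_moment_def algebra_simps)
  also have "\<dots> \<le> first_moment s + \<kappa> * \<bar>t - s\<bar> * (5 * S)"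
    using S[of s] first_moment_nonneg[of s] \<kappa>_pos by (intro add_left_mono mult_left_mono) auto
  finally show ?thesis by simp
qed

text \<open>Trajectories are continuous in time, so Fatou's lemma gives lower semicontinuity of the
  moment.\<close>

lemma first_moment_sublevel_closed: "closed {t \<in> {0..T}. first_moment t \<le> c}"
  unfolding closed_sequential_limits
proof safe
  fix t l assume t: "\<forall>n. t n \<in> {t \<in> {0..T}. first_moment t \<le> c}" and l: "t \<longlonglongrightarrow> l"
  show lT: "l \<in> {0..T}"
    using closed_sequentially[OF closed_atLeastAtMost, of t 0 T l] t l by auto
  have nn: "(\<integral>\<^sup>+z. ennreal (norm (V s z)) \<partial>P) = ennreal (first_moment s)" if "s \<in> {0..T}" for s
    unfolding first_moment_def using integrable_V[OF that] by (intro nn_integral_eq_integral) auto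
  have "(\<lambda>n. ennreal (norm (V (t n) z))) \<longlonglongrightarrow> ennreal (norm (V l z))" for z
    using t lT by (intro tendsto_ennrealI tendsto_norm continuous_on_tendsto_compose[OF V_cont l]) auto
  then have "(\<integral>\<^sup>+z. ennreal (norm (V l z)) \<partial>P) = (\<integral>\<^sup>+z. liminf (\<lambda>n. ennreal (norm (V (t n) z))) \<partial>P)"
    by (intro nn_integral_cong lim_imp_Liminf[symmetric]) auto
  also have "\<dots> \<le> liminf (\<lambda>n. \<integral>\<^sup>+z. ennreal (norm (V (t n) z)) \<partial>P)"
    using t V_meas by (intro nn_integral_liminf) auto
  also have "\<dots> \<le> liminf (\<lambda>n. ennreal c)"
    using t nn by (intro Liminf_mono always_eventually) (auto intro: ennreal_leI)
  also have "\<dots> = ennreal c" by (simp add: Liminf_const)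
  finally have "ennreal (first_moment l) \<le> ennreal c" using nn[OF lT] by simp
  moreover have "c \<ge> 0" using t first_moment_nonneg[of "t 0"] by (auto intro: order_trans)
  ultimately show "first_moment l \<le> c" by simp
qed

lemma first_moment_0_le: "first_moment 0 \<le> Rv"
proof -
  have "first_moment 0 \<le> (LINT z|P. Rv)"
    unfolding first_moment_def
  proof (rule integral_mono_AE)
    show "integrable P (\<lambda>z. norm (V 0 z))" using integrable_V[of 0] T_pos by (intro integrable_norm) simp
    show "AE z in P. norm (V 0 z) \<le> Rv" using supp by (auto simp: init elim!: eventually_mono)
  qed simp
  then show ?thesis by simp
qed

text \<open>Gronwall compares two times whenever the moment is bounded between them, with a factor
  that does not involve the bound; \<open>bounded_of_local_comparison\<close> then removes the
  boundedness condition.\<close>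

lemma first_moment_le: "t \<in> {0..T} \<Longrightarrow> first_moment t \<le> moment_max"
proof -
  assume t: "t \<in> {0..T}"
  have "first_moment t \<le> growth (5 * \<kappa>) * first_moment 0"
  proof (rule bounded_of_local_comparison[OF first_moment_sublevel_closed _ _ _ t])
    fix s t assume st: "s \<in> {0..T}" "t \<in> {0..T}" and bdd: "bdd_above (first_moment ` closed_segment s t)"
    let ?a = "min s t" and ?b = "max s t"
    have seg: "{?a..?b} = closed_segment s t" by (auto simp: closed_segment_eq_real_ivl)
    have "first_moment t + 0 \<le> 2 ^ nat \<lceil>2 * (5 * \<kappa>) * T\<rceil> * (first_moment s + 0)"
    proof (rule gronwall_sup[where U=first_moment and a="?a" and b="?b" and E=0])
      show "bdd_above (first_moment ` {?a..?b})" using bdd unfolding seg .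
      show "?b - ?a \<le> T" using st by auto
      show "first_moment t' \<le> first_moment s' + 5 * \<kappa> * \<bar>t' - s'\<bar> * (S + 0)"
        if "s' \<in> {?a..?b}" "t' \<in> {?a..?b}" "5 * \<kappa> * \<bar>t' - s'\<bar> \<le> 1 / 2"
          "\<And>\<tau>. \<tau> \<in> closed_segment s' t' \<Longrightarrow> first_moment \<tau> \<le> S" for s' t' S
        using that st by (intro first_moment_step) auto
    qed (use \<kappa>_pos first_moment_nonneg in auto)
    then show "first_moment t \<le> growth (5 * \<kappa>) * first_moment s" by (simp add: growth_def)
  qed (use T_pos growth_ge_1[of "5 * \<kappa>"] in auto)
  also have "\<dots> \<le> moment_max"
    unfolding moment_max_def using first_moment_0_le growth_ge_1[of "5 * \<kappa>"] by (intro mult_left_mono) auto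
  finally show ?thesis .
qed

lemma V_le: "z \<in> D \<Longrightarrow> t \<in> {0..T} \<Longrightarrow> norm (V t z) \<le> RV"
proof -
  assume z: "z \<in> D" and t: "t \<in> {0..T}"
  have "norm (V t z) + moment_max \<le> growth \<kappa> * (norm (V 0 z) + moment_max)"
    unfolding growth_def using t T_pos first_moment_le by (intro V_growth[of 0 T]) auto
  also have "\<dots> \<le> RV"
    unfolding RV_def using z growth_ge_1[of \<kappa>] by (intro mult_left_mono) (auto simp: init)
  finally show ?thesis using constants_nonneg(1) by linarith
qed

lemma acc_le_RA: "z \<in> D \<Longrightarrow> t \<in> {0..T} \<Longrightarrow> norm (A t (X t z) - B t (X t z) *\<^sub>R V t z) \<le> RA"
proof -
  assume z: "z \<in> D" and t: "t \<in> {0..T}"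
  have "norm (A t (X t z) - B t (X t z) *\<^sub>R V t z) \<le> \<kappa> * (moment_max + norm (V t z))"
    by (intro acc_le first_moment_le t)
  also have "\<dots> \<le> RA" unfolding RA_def using V_le[OF z t] \<kappa>_pos by simp
  finally show ?thesis .
qed

lemma X_diff: "z \<in> D \<Longrightarrow> s \<in> {0..T} \<Longrightarrow> t \<in> {0..T} \<Longrightarrow> norm (X t z - X s z) \<le> RV * \<bar>t - s\<bar>"
  by (rule norm_diff_le_of_derivative_bound[OF derX])
    (auto intro!: V_le simp: closed_segment_eq_real_ivl split: if_splits)

lemma V_diff: "z \<in> D \<Longrightarrow> s \<in> {0..T} \<Longrightarrow> t \<in> {0..T} \<Longrightarrow> norm (V t z - V s z) \<le> RA * \<bar>t - s\<bar>"
  by (rule norm_diff_le_of_derivative_bound[OF derV'])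
    (auto intro!: acc_le_RA simp: closed_segment_eq_real_ivl split: if_splits)

lemma X_le: "z \<in> D \<Longrightarrow> t \<in> {0..T} \<Longrightarrow> X t z \<in> cball 0 RX"
proof -
  assume z: "z \<in> D" and t: "t \<in> {0..T}"
  have "norm (X t z - X 0 z) \<le> RV * \<bar>t - 0\<bar>" using t T_pos by (intro X_diff z) auto
  also have "\<dots> \<le> RV * T" using t constants_nonneg by (intro mult_left_mono) auto
  finally have "norm (X t z) \<le> norm (X 0 z) + RV * T"
    using norm_triangle_sub[of "X t z" "X 0 z"] by linarith
  then show ?thesis using z by (auto simp: init RX_def mult.commute)
qed

end

section \<open>Mass of spherical shells and regularity of the mean-field force\<close>

lemma power_Suc_diff_le:
  fixes x y :: real
  assumes "0 \<le> y" "y \<le> x"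
  shows "x ^ Suc n - y ^ Suc n \<le> real (Suc n) * (x - y) * x ^ n"
proof (induction n)
  case (Suc n)
  have "x ^ Suc (Suc n) - y ^ Suc (Suc n) = x * (x ^ Suc n - y ^ Suc n) + (x - y) * y ^ Suc n"
    by (simp add: algebra_simps)
  also have "\<dots> \<le> x * (real (Suc n) * (x - y) * x ^ n) + (x - y) * x ^ Suc n"
    using Suc assms by (intro add_mono mult_left_mono power_mono) auto
  finally show ?case by (simp add: algebra_simps)
qed simp

text \<open>A negative inner radius is allowed, since later comparisons shrink radii. The shell is
  then a ball of radius at most \<open>h\<close>: one factor of its volume is bounded by
  \<open>h\<close>, the others by \<rho>. For \<open>r \<ge> 0\<close> the mean value bound for
  powers applies.\<close>

lemma emeasure_shell_le:
  fixes x :: "'a::euclidean_space"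
  assumes h: "0 \<le> h" and r: "r + h \<le> \<rho>" and \<rho>: "0 \<le> \<rho>"
  shows "emeasure lborel (cball x (r + h) - cball x r)
    \<le> ennreal (unit_ball_vol (DIM('a)) * (real DIM('a) * \<rho> ^ (DIM('a) - 1)) * h)"
proof -
  obtain n where n: "DIM('a) = Suc n" using DIM_positive[where 'a='a] by (metis Suc_pred)
  let ?\<omega> = "unit_ball_vol (DIM('a))"
  consider "r + h < 0" | "0 \<le> r + h" "r < 0" | "0 \<le> r" using h by linarith
  then show ?thesis
  proof cases
    case 2
    have "(r + h) * (r + h) ^ n \<le> real (Suc n) * h * \<rho> ^ n"
    proof (intro mult_mono power_mono)
      have "h \<le> real (Suc n) * h" using h by (simp add: algebra_simps)
      then show "r + h \<le> real (Suc n) * h" using 2 by linarith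
    qed (use 2 h r in auto)
    then have "(r + h) ^ DIM('a) \<le> real DIM('a) * h * \<rho> ^ n" by (simp add: n)
    then have "?\<omega> * (r + h) ^ DIM('a) \<le> ?\<omega> * (real DIM('a) * h * \<rho> ^ n)"
      by (intro mult_left_mono) auto
    moreover have "emeasure lborel (cball x (r + h) - cball x r) \<le> emeasure lborel (cball x (r + h))"
      by (intro emeasure_mono) auto
    ultimately show ?thesis
      using 2 by (auto simp: emeasure_cball n mult_ac intro!: ennreal_leI elim!: order_trans)
  next
    case 3
    have "(r + h) ^ DIM('a) - r ^ DIM('a) \<le> real DIM('a) * h * (r + h) ^ n"
      using power_Suc_diff_le[of r "r + h" n] 3 h unfolding n by simp
    also have "\<dots> \<le> real DIM('a) * h * \<rho> ^ n"
      using 3 h r by (intro mult_left_mono power_mono) auto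
    finally have "?\<omega> * ((r + h) ^ DIM('a) - r ^ DIM('a)) \<le> ?\<omega> * (real DIM('a) * h * \<rho> ^ n)"
      by (intro mult_left_mono) auto
    moreover have "emeasure lborel (cball x (r + h) - cball x r)
        = ennreal (?\<omega> * (r + h) ^ DIM('a)) - ennreal (?\<omega> * r ^ DIM('a))"
      using 3 h by (subst emeasure_Diff) (auto simp: emeasure_cball intro: order_trans)
    moreover have "\<dots> = ennreal (?\<omega> * ((r + h) ^ DIM('a) - r ^ DIM('a)))"
      using 3 by (subst ennreal_minus) (auto simp: algebra_simps)
    ultimately show ?thesis by (auto simp: n mult_ac intro!: ennreal_leI)
  qed simp
qed

context topological_flow
begin

abbreviation state_law :: "real \<Rightarrow> ('a \<times> 'a) measure" where
  "state_law t \<equiv> distr P borel (\<lambda>z. (X t z, V t z))"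

lemma state_law_prob: "t \<in> {0..T} \<Longrightarrow> prob_space (state_law t)"
  using flow_meas_P by (intro prob_space_distr)

text \<open>Three cases: for \<open>h \<ge> 1\<close> the total mass 1 suffices; for
  \<open>r \<ge> 2 * RX\<close> almost no trajectory reaches the shell; otherwise the shell has
  radius at most \<open>2 * RX + 1\<close>, and bounded velocities turn the phase-space density
  bound into a spatial one.\<close>

lemma M_shell:
  assumes t: "t \<in> {0..T}" and c: "density_le c (state_law t)" "0 \<le> c"
    and x: "x \<in> cball 0 RX" and h: "0 \<le> h"
  shows "M t x (r + h) \<le> M t x r + shell_const c * h"
proof -
  let ?S = "cball x (r + h) - cball x r"
  let ?Z = "{z. norm (X t z - x) \<le> r + h} - {z. norm (X t z - x) \<le> r}"
  have Z: "?Z \<in> sets P" using M_sets[OF t] by blast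
  have "M t x (r + h) - M t x r = prob ?Z"
    unfolding M_def using h by (intro finite_measure_Diff[symmetric] M_sets t) auto
  also have "prob ?Z \<le> shell_const c * h"
  proof -
    consider "1 \<le> h" | "2 * RX \<le> r" | "h < 1" "r < 2 * RX" by linarith
    then show ?thesis
    proof cases
      case 1
      have "prob ?Z \<le> 1" by simp
      also have "1 \<le> shell_const c * h" using 1 mult_mono[of 1 "shell_const c" 1 h] by (simp add: shell_const_def)
      finally show ?thesis .
    next
      case 2
      have "AE z in P. z \<notin> ?Z"
        using supp
      proof eventually_elim
        case (elim z)
        have "norm (X t z - x) \<le> norm (X t z) + norm x" by (rule norm_triangle_ineq4)
        also have "\<dots> \<le> RX + RX" using X_le[OF elim t] x by (intro add_mono) auto
        finally show ?case using 2 by simp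
      qed
      then have "prob ?Z = 0" using Z by (simp add: prob_eq_0)
      then show ?thesis using h by (simp add: shell_const_def)
    next
      case 3
      let ?a = "unit_ball_vol (DIM('a)) * (real DIM('a) * (2 * RX + 1) ^ (DIM('a) - 1)) * h"
      let ?b = "unit_ball_vol (DIM('a)) * RV ^ DIM('a)"
      have a0: "0 \<le> ?a" "0 \<le> ?b" using constants_nonneg h by auto
      have box: "?S \<times> cball 0 RV \<in> sets (borel :: ('a \<times> 'a) measure)"
        unfolding borel_prod[symmetric] by (intro pair_measureI) auto
      have "emeasure P ?Z \<le> emeasure P ((\<lambda>z. (X t z, V t z)) -` (?S \<times> cball 0 RV) \<inter> space P)"
      proof (rule emeasure_mono_AE)
        show "AE z in P. z \<in> ?Z \<longrightarrow> z \<in> (\<lambda>z. (X t z, V t z)) -` (?S \<times> cball 0 RV) \<inter> space P"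
          using supp by eventually_elim (auto simp: dist_norm norm_minus_commute intro: V_le[OF _ t])
        show "(\<lambda>z. (X t z, V t z)) -` (?S \<times> cball 0 RV) \<inter> space P \<in> sets P"
          using measurable_sets[OF flow_meas_P[OF t] box] .
      qed
      also have "\<dots> = emeasure (state_law t) (?S \<times> cball 0 RV)"
        by (rule emeasure_distr[OF flow_meas_P[OF t] box, symmetric])
      also have "\<dots> \<le> ennreal c * emeasure lborel (?S \<times> (cball 0 RV :: 'a set))"
        using c(1) box unfolding density_le_def by blast
      also have "emeasure lborel (?S \<times> (cball 0 RV :: 'a set)) = emeasure lborel ?S * emeasure lborel (cball 0 RV :: 'a set)"
        unfolding lborel_prod[symmetric] by (rule lborel.emeasure_pair_measure_Times) auto
      also have "\<dots> \<le> ennreal ?a * ennreal ?b"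
        using 3 h constants_nonneg
        by (intro mult_mono emeasure_shell_le) (auto simp: emeasure_cball)
      finally have "emeasure P ?Z \<le> ennreal c * (ennreal ?a * ennreal ?b)"
        by (simp add: mult_left_mono)
      also have "\<dots> = ennreal (c * (?a * ?b))"
        using a0 c(2) by (simp add: ennreal_mult)
      finally have "prob ?Z \<le> c * (?a * ?b)"
        using a0 c(2) by (simp add: emeasure_eq_measure)
      also have "\<dots> = (c * (unit_ball_vol (DIM('a)) * (real DIM('a) * (2 * RX + 1) ^ (DIM('a) - 1))) * ?b) * h"
        by simp
      also have "\<dots> \<le> shell_const c * h"
        unfolding shell_const_def using h by (intro mult_right_mono) auto
      finally show ?thesis .
    qed
  qed
  finally show ?thesis by simp
qed

text \<open>Shifts of centre, radius and time embed one ball, for almost every trajectory, into the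
  other one enlarged by the sum of the shifts; the shell bound at \<open>(t, y)\<close> pays for the
  enlargement.\<close>

lemma M_lipschitz:
  assumes st: "s \<in> {0..T}" "t \<in> {0..T}" and c: "density_le c (state_law t)" "0 \<le> c"
    and y: "y \<in> cball 0 RX"
  shows "M s x q \<le> M t y r + shell_const c * (norm (x - y) + \<bar>q - r\<bar> + RV * \<bar>s - t\<bar>)"
proof -
  let ?h = "norm (x - y) + \<bar>q - r\<bar> + RV * \<bar>s - t\<bar>"
  have "M s x q \<le> M t y (r + ?h)"
    unfolding M_def
  proof (rule finite_measure_mono_AE)
    show "AE z in P. z \<in> {z. norm (X s z - x) \<le> q} \<longrightarrow> z \<in> {z. norm (X t z - y) \<le> r + ?h}"
      using supp
    proof eventually_elim
      case (elim z)
      have "X t z - y = (X t z - X s z) + (X s z - x) + (x - y)" by simp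
      also have "norm \<dots> \<le> norm (X t z - X s z) + norm (X s z - x) + norm (x - y)"
        by (intro order_trans[OF norm_triangle_ineq] add_right_mono norm_triangle_ineq)
      finally show ?case using X_diff[OF elim st] by (auto simp: abs_minus_commute)
    qed
  qed (intro M_sets st)
  also have "\<dots> \<le> M t y r + shell_const c * ?h"
    using constants_nonneg by (intro M_shell st c y) auto
  finally show ?thesis .
qed

text \<open>The shift \<open>norm (x - y) + RV * \<bar>s - t\<bar>\<close> counts twice: it moves
  the ball, and it changes the radius, which is itself a distance to a moving trajectory.\<close>

lemma weight_lipschitz:
  assumes st: "s \<in> {0..T}" "t \<in> {0..T}"
    and c: "density_le c (state_law s)" "density_le c (state_law t)" "0 \<le> c"
    and xy: "x \<in> cball 0 RX" "y \<in> cball 0 RX" and z: "z \<in> D"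
  shows "\<bar>weight s x z - weight t y z\<bar> \<le> 2 * L * shell_const c * (norm (x - y) + RV * \<bar>s - t\<bar>)"
proof -
  let ?q = "norm (x - X s z)" and ?r = "norm (y - X t z)"
  have "x - X s z = (x - y) + (y - X t z) + (X t z - X s z)" by simp
  then have "?q \<le> norm (x - y) + ?r + norm (X t z - X s z)"
    by (metis norm_triangle_le norm_triangle_mono order_refl)
  moreover have "y - X t z = (y - x) + (x - X s z) + (X s z - X t z)" by simp
  then have "?r \<le> norm (y - x) + ?q + norm (X s z - X t z)"
    by (metis norm_triangle_le norm_triangle_mono order_refl)
  ultimately have qr: "\<bar>?q - ?r\<bar> \<le> norm (x - y) + RV * \<bar>s - t\<bar>"
    using X_diff[OF z st] by (auto simp: norm_minus_commute abs_minus_commute abs_le_iff)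
  have C0: "0 \<le> shell_const c" by (simp add: shell_const_def)
  have sum: "norm (x - y) + \<bar>?q - ?r\<bar> + RV * \<bar>s - t\<bar> \<le> 2 * (norm (x - y) + RV * \<bar>s - t\<bar>)"
    using add_mono[OF qr order_refl[of "norm (x - y) + RV * \<bar>s - t\<bar>"]] by (simp only: mult_2 ac_simps)
  have "M s x ?q \<le> M t y ?r + shell_const c * (norm (x - y) + \<bar>?q - ?r\<bar> + RV * \<bar>s - t\<bar>)"
    by (rule M_lipschitz[OF st c(2,3) xy(2)])
  moreover have "M t y ?r \<le> M s x ?q + shell_const c * (norm (y - x) + \<bar>?r - ?q\<bar> + RV * \<bar>t - s\<bar>)"
    by (rule M_lipschitz[OF st(2,1) c(1,3) xy(1)])
  ultimately have "\<bar>M s x ?q - M t y ?r\<bar> \<le> shell_const c * (norm (x - y) + \<bar>?q - ?r\<bar> + RV * \<bar>s - t\<bar>)"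
    by (simp add: norm_minus_commute abs_minus_commute abs_le_iff)
  also have "\<dots> \<le> shell_const c * (2 * (norm (x - y) + RV * \<bar>s - t\<bar>))"
    using sum C0 by (rule mult_left_mono)
  finally have "L * \<bar>M s x ?q - M t y ?r\<bar> \<le> L * (shell_const c * (2 * (norm (x - y) + RV * \<bar>s - t\<bar>)))"
    using L_nonneg by (rule mult_left_mono)
  then show ?thesis
    unfolding weight_def using K_lip[of "M s x ?q" "M t y ?r"] by (simp add: algebra_simps)
qed

lemma integral_diff_le:
  fixes f g :: "'a \<times> 'a \<Rightarrow> 'c::euclidean_space"
  assumes "integrable P f" "integrable P g" and le: "\<And>z. z \<in> D \<Longrightarrow> norm (f z - g z) \<le> e"
  shows "norm ((LINT z|P. f z) - (LINT z|P. g z)) \<le> e"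
proof -
  have "norm ((LINT z|P. f z) - (LINT z|P. g z)) = norm (LINT z|P. f z - g z)"
    using assms by simp
  also have "\<dots> \<le> (LINT z|P. norm (f z - g z))" by (rule integral_norm_bound)
  also have "\<dots> \<le> (LINT z|P. e)"
    using assms supp by (intro integral_mono_AE) (auto elim!: eventually_mono)
  finally show ?thesis by simp
qed

lemma B_lipschitz:
  assumes st: "s \<in> {0..T}" "t \<in> {0..T}"
    and c: "density_le c (state_law s)" "density_le c (state_law t)" "0 \<le> c"
    and xy: "x \<in> cball 0 RX" "y \<in> cball 0 RX"
  shows "\<bar>B s x - B t y\<bar> \<le> 2 * L * shell_const c * (norm (x - y) + RV * \<bar>s - t\<bar>)"
  using integral_diff_le[OF weight_integrable[OF st(1)] weight_integrable[OF st(2)], of x y]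
    weight_lipschitz[OF st c xy] by (simp add: B_def)

lemma A_lipschitz:
  assumes st: "s \<in> {0..T}" "t \<in> {0..T}"
    and c: "density_le c (state_law s)" "density_le c (state_law t)" "0 \<le> c"
    and xy: "x \<in> cball 0 RX" "y \<in> cball 0 RX"
  shows "norm (A s x - A t y) \<le> 2 * L * shell_const c * (norm (x - y) + RV * \<bar>s - t\<bar>) * RV + \<kappa> * (RA * \<bar>s - t\<bar>)"
  unfolding A_def
proof (rule integral_diff_le)
  fix z assume z: "z \<in> D"
  have "weight s x z *\<^sub>R V s z - weight t y z *\<^sub>R V t z
      = (weight s x z - weight t y z) *\<^sub>R V s z + weight t y z *\<^sub>R (V s z - V t z)"
    by (simp add: algebra_simps)
  also have "norm \<dots> \<le> \<bar>weight s x z - weight t y z\<bar> * norm (V s z) + weight t y z * norm (V s z - V t z)"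
    using weight_range[of t y z] by (intro order_trans[OF norm_triangle_ineq]) simp
  also have "\<dots> \<le> (2 * L * shell_const c * (norm (x - y) + RV * \<bar>s - t\<bar>)) * RV + \<kappa> * (RA * \<bar>s - t\<bar>)"
  proof (intro add_mono mult_mono weight_lipschitz[OF st c xy z] V_le[OF z] st weight_range V_diff[OF z st(2,1)])
    show "0 \<le> 2 * L * shell_const c * (norm (x - y) + RV * \<bar>s - t\<bar>)"
      using L_nonneg constants_nonneg by (simp add: shell_const_def)
  qed (use \<kappa>_pos in auto)
  finally show "norm (weight s x z *\<^sub>R V s z - weight t y z *\<^sub>R V t z) \<le> \<dots>" .
qed (intro weight_V_integrable st)+

end

section \<open>Time reversal\<close>

lemma has_vector_derivative_reflect:
  fixes f :: "real \<Rightarrow> 'b::real_normed_vector"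
  assumes "(f has_vector_derivative f') (at (a + b - \<tau>) within {a..b})"
  shows "((\<lambda>s. f (a + b - s)) has_vector_derivative - f') (at \<tau> within {a..b})"
proof -
  have img: "(\<lambda>s. a + b - s) ` {a..b} = {a..b}"
    by (auto simp: image_iff intro!: bexI[of _ "a + b - x" for x])
  have "((\<lambda>s. a + b - s) has_vector_derivative -1) (at \<tau> within {a..b})"
    by (auto intro!: derivative_eq_intros)
  from vector_diff_chain_within[OF this, of f f'] assms img
  show ?thesis by (simp add: comp_def)
qed

text \<open>Run backwards with negated velocity \<open>w\<close>, the curve obeys
  \<open>w' = A - (- B) *\<^sub>R w\<close>: the class of curves is preserved with the same
  constants, so the volume estimate also works backwards in time.\<close>

lemma second_order_curve_reflect:
  assumes "second_order_curve x v A B a b \<Lambda> R \<alpha> \<kappa>"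
  shows "second_order_curve (\<lambda>s. x (a + b - s)) (\<lambda>s. - v (a + b - s))
    (\<lambda>s. A (a + b - s)) (\<lambda>s y. - B (a + b - s) y) a b \<Lambda> R \<alpha> \<kappa>"
proof -
  interpret second_order_curve x v A B a b \<Lambda> R \<alpha> \<kappa> by (rule assms)
  have r: "a + b - \<tau> \<in> {a..b}" if "\<tau> \<in> {a..b}" for \<tau> using that by auto
  show ?thesis
  proof
    fix \<tau> assume \<tau>: "\<tau> \<in> {a..b}"
    show "((\<lambda>s. x (a + b - s)) has_vector_derivative - v (a + b - \<tau>)) (at \<tau> within {a..b})"
      by (rule has_vector_derivative_reflect[OF derx[OF r[OF \<tau>]]])
    show "((\<lambda>s. - v (a + b - s)) has_vector_derivative
        A (a + b - \<tau>) (x (a + b - \<tau>)) - (- B (a + b - \<tau>) (x (a + b - \<tau>))) *\<^sub>R (- v (a + b - \<tau>))) (at \<tau> within {a..b})"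
      using has_vector_derivative_minus[OF has_vector_derivative_reflect[OF derv[OF r[OF \<tau>]]]] by simp
  next
    fix \<sigma> \<tau> y z assume "\<sigma> \<in> {a..b}" "\<tau> \<in> {a..b}"
    note st = r[OF this(1)] r[OF this(2)]
    show "norm (A (a + b - \<sigma>) y - A (a + b - \<tau>) z) \<le> \<Lambda> * (\<bar>\<sigma> - \<tau>\<bar> + norm (y - z))"
      using A_lip[OF st, of y z] by (simp add: abs_minus_commute)
    show "\<bar>- B (a + b - \<sigma>) y - - B (a + b - \<tau>) z\<bar> \<le> \<Lambda> * (\<bar>\<sigma> - \<tau>\<bar> + norm (y - z))"
      using B_lip[OF st, of y z] by (simp add: abs_minus_commute)
  qed (use r v_le A_le B_le nonneg in auto)
qed

lemma density_le_mono: "density_le c \<mu> \<Longrightarrow> c \<le> c' \<Longrightarrow> density_le c' \<mu>"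
  unfolding density_le_def by (meson ennreal_leI mult_right_mono order_trans zero_le)

text \<open>The flip is a kick with slope -1, for which the volume factor is 1.\<close>

lemma density_le_flip_velocity:
  fixes X V :: "'z \<Rightarrow> 'a::euclidean_space"
  assumes "density_le c (distr P borel (\<lambda>z. (X z, V z)))" and m: "(\<lambda>z. (X z, V z)) \<in> borel_measurable P"
  shows "density_le c (distr P borel (\<lambda>z. (X z, - V z)))"
proof -
  let ?S = "\<lambda>(x, v). (x, 0 + (-1) *\<^sub>R v) :: 'a \<times> 'a"
  have S: "?S \<in> borel_measurable borel"
    unfolding split_beta' by (intro borel_measurable_continuous_onI continuous_intros)
  have "density_le (c * 1) (distr (distr P borel (\<lambda>z. (X z, V z))) borel ?S)"
  proof (rule density_le_distr[OF assms(1) _ _ S])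
    fix E :: "('a \<times> 'a) set" assume "E \<in> sets borel"
    from emeasure_kick_vimage_le[OF this, of "\<lambda>_. 0" "\<lambda>_. -1" 1]
    show "emeasure lborel (?S -` E) \<le> ennreal 1 * emeasure lborel E" by simp
  qed auto
  then show ?thesis using S m by (simp add: distr_distr comp_def)
qed

section \<open>Uniform density bound and Lipschitz flow\<close>

context topological_flow
begin

text \<open>The Lipschitz bounds on the coefficients hold in the ball of radius \<open>RX\<close> only, which contains all
  trajectories; clipping extends them to the whole space.\<close>

definition clip :: "'a \<Rightarrow> 'a" where "clip = closest_point (cball 0 RX)"

lemma clip_in: "clip x \<in> cball 0 RX"
  unfolding clip_def using constants_nonneg by (intro closest_point_in_set) auto

lemma clip_id: "x \<in> cball 0 RX \<Longrightarrow> clip x = x"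
  unfolding clip_def by (rule closest_point_self)

lemma clip_lip: "norm (clip x - clip y) \<le> norm (x - y)"
  unfolding clip_def dist_norm[symmetric] using constants_nonneg by (intro closest_point_lipschitz) auto

text \<open>The local density bound \<open>c\<close> enters the Lipschitz constant only. There, one
  factor \<open>1 + RV\<close> merges position and time shifts, the other dominates the velocity
  factor in \<open>A\<close>.\<close>

lemma flow_second_order_curve:
  assumes ab: "{a..b} \<subseteq> {0..T}" and c: "\<And>\<tau>. \<tau> \<in> {a..b} \<Longrightarrow> density_le c (state_law \<tau>)" "0 \<le> c"
    and z: "z \<in> D"
  shows "second_order_curve (\<lambda>s. X s z) (\<lambda>s. V s z) (\<lambda>\<tau> x. A \<tau> (clip x)) (\<lambda>\<tau> x. B \<tau> (clip x)) a b
    (2 * L * shell_const c * (1 + RV) * (1 + RV) + \<kappa> * RA) RV (\<kappa> * moment_max) \<kappa>"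
proof
  let ?C = "2 * L * shell_const c"
  let ?\<Lambda> = "?C * (1 + RV) * (1 + RV) + \<kappa> * RA"
  have C0: "0 \<le> ?C" using L_nonneg by (simp add: shell_const_def)
  have \<kappa>RA: "0 \<le> \<kappa> * RA" using \<kappa>_pos constants_nonneg by simp
  show "0 \<le> ?\<Lambda>" "0 \<le> RV" "0 \<le> \<kappa> * moment_max" "0 \<le> \<kappa>"
    using C0 constants_nonneg \<kappa>_pos by auto
  fix \<tau> assume \<tau>: "\<tau> \<in> {a..b}"
  then have \<tau>': "\<tau> \<in> {0..T}" using ab by blast
  show "((\<lambda>s. X s z) has_vector_derivative V \<tau> z) (at \<tau> within {a..b})"
    using derX[OF \<tau>'] ab by (rule has_vector_derivative_within_subset)
  show "((\<lambda>s. V s z) has_vector_derivative A \<tau> (clip (X \<tau> z)) - B \<tau> (clip (X \<tau> z)) *\<^sub>R V \<tau> z) (at \<tau> within {a..b})"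
    unfolding clip_id[OF X_le[OF z \<tau>']] using derV'[OF \<tau>'] ab by (rule has_vector_derivative_within_subset)
  show "norm (V \<tau> z) \<le> RV" by (rule V_le[OF z \<tau>'])
  show "norm (A \<tau> (clip y)) \<le> \<kappa> * moment_max" for y
    using A_le[OF \<tau>', of "clip y"] first_moment_le[OF \<tau>'] \<kappa>_pos
    by (meson mult_left_mono less_imp_le order_trans)
  show "\<bar>B \<tau> (clip y)\<bar> \<le> \<kappa>" for y by (rule B_le[OF \<tau>'])
  fix \<sigma> and y y' :: 'a assume \<sigma>: "\<sigma> \<in> {a..b}"
  then have \<sigma>': "\<sigma> \<in> {0..T}" using ab by blast
  let ?d = "\<bar>\<sigma> - \<tau>\<bar> + norm (y - y')"
  have "norm (clip y - clip y') + RV * \<bar>\<sigma> - \<tau>\<bar> \<le> (1 + RV) * ?d"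
    using clip_lip[of y y'] mult_nonneg_nonneg[OF constants_nonneg(2) norm_ge_zero[of "y - y'"]]
    by (simp add: algebra_simps)
  then have *: "?C * (norm (clip y - clip y') + RV * \<bar>\<sigma> - \<tau>\<bar>) \<le> ?C * ((1 + RV) * ?d)"
    using C0 by (rule mult_left_mono)
  have d0: "0 \<le> ?C * ((1 + RV) * ?d)" using C0 constants_nonneg by auto
  note lip_args = \<sigma>' \<tau>' c(1)[OF \<sigma>] c(1)[OF \<tau>] c(2) clip_in clip_in
  have "\<bar>B \<sigma> (clip y) - B \<tau> (clip y')\<bar> \<le> ?C * ((1 + RV) * ?d)"
    using B_lipschitz[OF lip_args, of y y'] * by linarith
  also have "\<dots> \<le> ?C * ((1 + RV) * ?d) * (1 + RV) + \<kappa> * RA * ?d"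
  proof -
    have "q \<le> q * (1 + RV) + e" if "0 \<le> q" "0 \<le> e" for q e
      using mult_nonneg_nonneg[OF that(1) constants_nonneg(2)] that by (simp add: algebra_simps)
    from this[OF d0] show ?thesis using \<kappa>RA by simp
  qed
  finally show "\<bar>B \<sigma> (clip y) - B \<tau> (clip y')\<bar> \<le> ?\<Lambda> * ?d" by (simp add: algebra_simps)
  have "norm (A \<sigma> (clip y) - A \<tau> (clip y')) \<le> ?C * (norm (clip y - clip y') + RV * \<bar>\<sigma> - \<tau>\<bar>) * RV + \<kappa> * (RA * \<bar>\<sigma> - \<tau>\<bar>)"
    by (rule A_lipschitz[OF lip_args])
  also have "\<dots> \<le> ?C * ((1 + RV) * ?d) * (1 + RV) + \<kappa> * (RA * ?d)"
  proof (rule add_mono)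
    show "?C * (norm (clip y - clip y') + RV * \<bar>\<sigma> - \<tau>\<bar>) * RV \<le> ?C * ((1 + RV) * ?d) * (1 + RV)"
      by (rule mult_mono[OF * _ d0]) (use constants_nonneg in auto)
    show "\<kappa> * (RA * \<bar>\<sigma> - \<tau>\<bar>) \<le> \<kappa> * (RA * ?d)"
      using constants_nonneg \<kappa>_pos by (intro mult_left_mono) auto
  qed
  finally show "norm (A \<sigma> (clip y) - A \<tau> (clip y')) \<le> ?\<Lambda> * ?d" by (simp add: algebra_simps)
qed

text \<open>\<open>c\<close> provides Lipschitz coefficients between the two times and then
  disappears: the factor involves only \<kappa>, \<open>T\<close> and the dimension. For
  \<open>t < s\<close> the flow is reversed: flip velocities, transport forwards, flip back.\<close>

lemma density_transport:
  assumes st: "s \<in> {0..T}" "t \<in> {0..T}"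
    and c: "\<And>\<tau>. \<tau> \<in> closed_segment s t \<Longrightarrow> density_le c (state_law \<tau>)" "0 \<le> c"
    and e: "density_le e (state_law s)" "0 \<le> e"
  shows "density_le (e * exp (DIM('a) * \<kappa> * T)) (state_law t)"
proof -
  have mono: "e * exp (DIM('a) * \<kappa> * l) \<le> e * exp (DIM('a) * \<kappa> * T)" if "l \<le> T" for l
    using that e(2) \<kappa>_pos by (intro mult_left_mono) auto
  have P: "prob_space P" by (rule prob_space_axioms)
  show ?thesis
  proof (cases "s \<le> t")
    case True
    then have "AE z in P. second_order_curve (\<lambda>s. X s z) (\<lambda>s. V s z) (\<lambda>\<tau> x. A \<tau> (clip x)) (\<lambda>\<tau> x. B \<tau> (clip x)) s t
        (2 * L * shell_const c * (1 + RV) * (1 + RV) + \<kappa> * RA) RV (\<kappa> * moment_max) \<kappa>"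
      using supp st c by (auto elim!: eventually_mono intro!: flow_second_order_curve simp: closed_segment_eq_real_ivl)
    from liouville_density_le[OF P True flow_meas_P[OF st(1)] flow_meas_P[OF st(2)] this e(1)]
    show ?thesis by (rule density_le_mono) (use st mono in auto)
  next
    case False
    let ?r = "\<lambda>\<tau>. t + s - \<tau>"
    from False have "AE z in P. second_order_curve (\<lambda>s. X s z) (\<lambda>s. V s z) (\<lambda>\<tau> x. A \<tau> (clip x)) (\<lambda>\<tau> x. B \<tau> (clip x)) t s
        (2 * L * shell_const c * (1 + RV) * (1 + RV) + \<kappa> * RA) RV (\<kappa> * moment_max) \<kappa>"
      using supp st c by (auto elim!: eventually_mono intro!: flow_second_order_curve simp: closed_segment_eq_real_ivl)
    then have curve: "AE z in P. second_order_curve (\<lambda>\<tau>. X (?r \<tau>) z) (\<lambda>\<tau>. - V (?r \<tau>) z)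
        (\<lambda>\<tau> x. A (?r \<tau>) (clip x)) (\<lambda>\<tau> x. - B (?r \<tau>) (clip x)) t s
        (2 * L * shell_const c * (1 + RV) * (1 + RV) + \<kappa> * RA) RV (\<kappa> * moment_max) \<kappa>"
      by eventually_elim (rule second_order_curve_reflect)
    have meas: "(\<lambda>z. (X (?r \<tau>) z, - V (?r \<tau>) z)) \<in> borel_measurable P" if "\<tau> \<in> {t, s}" for \<tau>
      using that X_meas V_meas st by (auto simp: borel_prod[symmetric])
    have "density_le e (distr P borel (\<lambda>z. (X (?r t) z, - V (?r t) z)))"
      using density_le_flip_velocity[OF e(1) flow_meas_P[OF st(1)]] by simp
    then have "density_le (e * exp (DIM('a) * \<kappa> * (s - t))) (distr P borel (\<lambda>z. (X (?r s) z, - V (?r s) z)))"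
      using False by (intro liouville_density_le[OF P _ meas meas curve]) auto
    then have "density_le (e * exp (DIM('a) * \<kappa> * (s - t))) (distr P borel (\<lambda>z. (X t z, - (- V t z))))"
      using meas[of s] by (intro density_le_flip_velocity[where V="\<lambda>z. - V t z"]) auto
    then have "density_le (e * exp (DIM('a) * \<kappa> * (s - t))) (state_law t)" by simp
    then show ?thesis by (intro density_le_mono[OF _ mono]) (use st in auto)
  qed
qed

text \<open>The essential supremum of the density at time \<open>t\<close>, obtained without
  choosing a density.\<close>

definition density_sup :: "real \<Rightarrow> real" where
  "density_sup t = Inf {c. 0 \<le> c \<and> density_le c (state_law t)}"

lemma density_sup_nonneg: "t \<in> {0..T} \<Longrightarrow> 0 \<le> density_sup t"
  unfolding density_sup_def using dens_ex[of t] by (intro cInf_greatest) blast+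

lemma density_sup_le: "density_le c (state_law t) \<Longrightarrow> 0 \<le> c \<Longrightarrow> density_sup t \<le> c"
  unfolding density_sup_def by (intro cInf_lower) (auto intro: bdd_belowI[of _ 0])

text \<open>The infimum is attained: the limit lemma is applied with thickenings of width 0, so that
  only the constants converge.\<close>

lemma density_le_density_sup:
  assumes t: "t \<in> {0..T}" shows "density_le (density_sup t) (state_law t)"
proof (rule density_le_limit[where \<epsilon>="\<lambda>_. 0" and c="\<lambda>n. density_sup t + 1 / real (Suc n)"])
  interpret S: prob_space "state_law t" by (rule state_law_prob[OF t])
  show "emeasure (state_law t) (space (state_law t)) \<noteq> \<infinity>" by simp
  have "(\<lambda>n. density_sup t + 1 / real (Suc n)) \<longlonglongrightarrow> density_sup t + 0"
    by (rule tendsto_add[OF tendsto_const LIMSEQ_Suc[OF lim_const_over_n]])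
  then show "(\<lambda>n. density_sup t + 1 / real (Suc n)) \<longlonglongrightarrow> density_sup t" by simp
  fix F :: "('a \<times> 'a) set" assume F: "compact F"
  show "\<forall>\<^sub>F n in sequentially. emeasure (state_law t) F
      \<le> ennreal (density_sup t + 1 / real (Suc n)) * emeasure lborel (thickening 0 F)"
  proof (rule always_eventually, rule allI)
    fix n
    have "{c. 0 \<le> c \<and> density_le c (state_law t)} \<noteq> {}" using dens_ex[OF t] by blast
    then have "\<exists>c\<in>{c. 0 \<le> c \<and> density_le c (state_law t)}. c < density_sup t + 1 / real (Suc n)"
      by (rule cInf_lessD) (simp add: density_sup_def)
    then obtain c where "density_le c (state_law t)" "c < density_sup t + 1 / real (Suc n)" by blast
    then have "density_le (density_sup t + 1 / real (Suc n)) (state_law t)"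
      using density_le_mono less_imp_le by blast
    then have "emeasure (state_law t) F \<le> ennreal (density_sup t + 1 / real (Suc n)) * emeasure lborel F"
      using borel_compact[OF F] unfolding density_le_def by blast
    moreover have "thickening 0 F = F" by (simp add: thickening_def)
    ultimately show "emeasure (state_law t) F
      \<le> ennreal (density_sup t + 1 / real (Suc n)) * emeasure lborel (thickening 0 F)"
      by metis
  qed
qed (simp_all add: decseq_def)

text \<open>Almost all states move by at most \<open>(RV + RA) * \<bar>l - t m\<bar>\<close>, so the
  mass of a compact set at the limit time is at most the mass of a small thickening at a nearby time
  of the sequence.\<close>

lemma density_sup_sublevel_closed: "closed {t \<in> {0..T}. density_sup t \<le> c}"
  unfolding closed_sequential_limits
proof safe
  fix t l assume t: "\<forall>n. t n \<in> {t \<in> {0..T}. density_sup t \<le> c}" and l: "t \<longlonglongrightarrow> l"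
  show lT: "l \<in> {0..T}"
    using closed_sequentially[OF closed_atLeastAtMost, of t 0 T l] t l by auto
  have c0: "0 \<le> c" using t density_sup_nonneg[of "t 0"] by (auto intro: order_trans)
  have dens: "density_le c (state_law (t n))" for n
    using t by (intro density_le_mono[OF density_le_density_sup]) auto
  interpret S: prob_space "state_law l" by (rule state_law_prob[OF lT])
  have "density_le c (state_law l)"
  proof (rule density_le_limit[where \<epsilon>="\<lambda>n. 1 / real (Suc n)" and c="\<lambda>_. c"])
    show "emeasure (state_law l) (space (state_law l)) \<noteq> \<infinity>" by simp
    show "(\<lambda>n. 1 / real (Suc n)) \<longlonglongrightarrow> 0" by (rule LIMSEQ_Suc[OF lim_const_over_n])
    show "decseq (\<lambda>n. 1 / real (Suc n))" by (auto simp: decseq_def intro!: divide_left_mono)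
    fix F :: "('a \<times> 'a) set" assume F: "compact F"
    show "\<forall>\<^sub>F n in sequentially. emeasure (state_law l) F \<le> ennreal c * emeasure lborel (thickening (1 / real (Suc n)) F)"
    proof (rule always_eventually, rule allI)
      fix n
      have "(\<lambda>m. (RV + RA) * \<bar>l - t m\<bar>) \<longlonglongrightarrow> (RV + RA) * \<bar>l - l\<bar>" by (intro tendsto_intros l)
      then have "\<forall>\<^sub>F m in sequentially. (RV + RA) * \<bar>l - t m\<bar> < 1 / real (Suc n)"
        by (rule order_tendstoD) simp
      then obtain m where m: "(RV + RA) * \<bar>l - t m\<bar> < 1 / real (Suc n)"
        by (auto simp: eventually_sequentially)
      have tm: "t m \<in> {0..T}" using t by auto
      let ?F = "thickening (1 / real (Suc n)) F"
      have F': "?F \<in> sets borel" by (rule borel_compact[OF compact_thickening[OF F]])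
      have "emeasure (state_law l) F = emeasure P ((\<lambda>z. (X l z, V l z)) -` F \<inter> space P)"
        by (rule emeasure_distr[OF flow_meas_P[OF lT] borel_compact[OF F]])
      also have "\<dots> \<le> emeasure P ((\<lambda>z. (X (t m) z, V (t m) z)) -` ?F \<inter> space P)"
      proof (rule emeasure_mono_AE)
        show "AE z in P. z \<in> (\<lambda>z. (X l z, V l z)) -` F \<inter> space P \<longrightarrow> z \<in> (\<lambda>z. (X (t m) z, V (t m) z)) -` ?F \<inter> space P"
          using supp
        proof eventually_elim
          case (elim z)
          have "dist (X (t m) z, V (t m) z) (X l z, V l z) \<le> norm (X (t m) z - X l z) + norm (V (t m) z - V l z)"
            unfolding dist_norm by (simp add: norm_Pair_le)
          also have "\<dots> \<le> RV * \<bar>t m - l\<bar> + RA * \<bar>t m - l\<bar>"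
            using X_diff[OF elim lT tm] V_diff[OF elim lT tm] by (rule add_mono)
          also have "\<dots> \<le> 1 / real (Suc n)" using m by (simp add: algebra_simps abs_minus_commute)
          finally show ?case unfolding thickening_def by auto
        qed
      qed (rule measurable_sets[OF flow_meas_P[OF tm] F'])
      also have "\<dots> = emeasure (state_law (t m)) ?F"
        by (rule emeasure_distr[OF flow_meas_P[OF tm] F', symmetric])
      also have "\<dots> \<le> ennreal c * emeasure lborel ?F"
        using dens F' unfolding density_le_def by blast
      finally show "emeasure (state_law l) F \<le> ennreal c * emeasure lborel ?F" .
    qed
  qed simp_all
  then show "density_sup l \<le> c" using c0 by (rule density_sup_le)
qed

text \<open>Here the circularity is resolved: \<open>density_transport\<close> supplies a comparison
  constant free of the local bound, and the comparison starts at time 0, where the law is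
  \<open>P\<close> itself.\<close>

lemma density_le_max: "t \<in> {0..T} \<Longrightarrow> density_le density_max (state_law t)"
proof -
  assume t: "t \<in> {0..T}"
  have 0: "0 \<in> {0..T}" using T_pos by simp
  have "density_sup t \<le> exp (DIM('a) * \<kappa> * T) * density_sup 0"
  proof (rule bounded_of_local_comparison[OF density_sup_sublevel_closed _ _ 0 t])
    fix s t assume st: "s \<in> {0..T}" "t \<in> {0..T}" and "bdd_above (density_sup ` closed_segment s t)"
    then obtain c where c: "\<And>\<tau>. \<tau> \<in> closed_segment s t \<Longrightarrow> density_sup \<tau> \<le> c"
      unfolding bdd_above_def by auto
    have sub: "closed_segment s t \<subseteq> {0..T}" using st by (simp add: closed_segment_eq_real_ivl)
    have "0 \<le> c" using c[of s] density_sup_nonneg[OF st(1)] by simp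
    moreover have "density_le c (state_law \<tau>)" if "\<tau> \<in> closed_segment s t" for \<tau>
      using sub that by (intro density_le_mono[OF density_le_density_sup c]) auto
    ultimately have "density_le (density_sup s * exp (DIM('a) * \<kappa> * T)) (state_law t)"
      using density_sup_nonneg[OF st(1)] by (intro density_transport[OF st _ _ density_le_density_sup[OF st(1)]])
    then show "density_sup t \<le> exp (DIM('a) * \<kappa> * T) * density_sup s"
      using density_sup_nonneg[OF st(1)] by (subst mult.commute, intro density_sup_le) auto
  qed auto
  also have "density_sup 0 \<le> c0"
  proof (rule density_sup_le[OF _ c0_nonneg])
    have "state_law 0 = P" using distr_id2[OF sets_P[symmetric]] by (simp add: init)
    then show "density_le c0 (state_law 0)" using dens0 by simp
  qed
  finally have "density_sup t \<le> density_max"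
    by (simp add: density_max_def mult.commute)
  then show ?thesis by (rule density_le_mono[OF density_le_density_sup[OF t]])
qed

lemma density_max_nonneg: "0 \<le> density_max"
  using c0_nonneg by (simp add: density_max_def)

lemma shell_max_ge_1: "1 \<le> shell_max"
  by (simp add: shell_max_def shell_const_def)

lemma M_shell_max:
  "t \<in> {0..T} \<Longrightarrow> x \<in> cball 0 RX \<Longrightarrow> 0 \<le> h \<Longrightarrow> M t x (r + h) \<le> M t x r + shell_max * h"
  unfolding shell_max_def by (rule M_shell[OF _ density_le_max density_max_nonneg])

text \<open>The 4 is 2 from \<open>A\<close> and 2 from \<open>B\<close>. The splitting lets the
  difference of \<open>B\<close> multiply \<open>v\<close>, so only \<open>v\<close> has to be
  bounded.\<close>

lemma force_lipschitz:
  assumes t: "t \<in> {0..T}" and xy: "x \<in> cball 0 RX" "y \<in> cball 0 RX" and v: "norm v \<le> RV"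
  shows "norm ((A t x - B t x *\<^sub>R v) - (A t y - B t y *\<^sub>R w)) \<le> 4 * L * shell_max * RV * norm (x - y) + \<kappa> * norm (v - w)"
proof -
  note dens = density_le_max[OF t] density_le_max[OF t] density_max_nonneg
  have dA: "norm (A t x - A t y) \<le> 2 * L * shell_max * norm (x - y) * RV"
    using A_lipschitz[OF t t dens xy] by (simp add: shell_max_def)
  have "\<bar>B t x - B t y\<bar> \<le> 2 * L * shell_max * norm (x - y)"
    using B_lipschitz[OF t t dens xy] by (simp add: shell_max_def)
  then have dB: "norm ((B t x - B t y) *\<^sub>R v) \<le> 2 * L * shell_max * norm (x - y) * RV"
    using v L_nonneg shell_max_ge_1 by (simp, intro mult_mono) auto
  have dv: "norm (B t y *\<^sub>R (v - w)) \<le> \<kappa> * norm (v - w)"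
    using B_le[OF t, of y] by (simp add: mult_right_mono)
  have "(A t x - B t x *\<^sub>R v) - (A t y - B t y *\<^sub>R w)
      = (A t x - A t y) - ((B t x - B t y) *\<^sub>R v + B t y *\<^sub>R (v - w))" by (simp add: algebra_simps)
  also have "norm \<dots> \<le> 2 * L * shell_max * norm (x - y) * RV + (2 * L * shell_max * norm (x - y) * RV + \<kappa> * norm (v - w))"
    by (rule order_trans[OF norm_triangle_ineq4 add_mono[OF dA order_trans[OF norm_triangle_ineq add_mono[OF dB dv]]]])
  finally show ?thesis by (simp add: algebra_simps)
qed

lemma lip_rate_ge_1: "1 \<le> lip_rate"
  using L_nonneg shell_max_ge_1 constants_nonneg \<kappa>_pos by (simp add: lip_rate_def)

lemma flow_lipschitz:
  assumes z: "z \<in> D" "z' \<in> D" and t: "t \<in> {0..T}"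
  shows "dist (X t z, V t z) (X t z', V t z') \<le> flow_lip * dist z z'"
proof -
  let ?U = "\<lambda>t. norm (X t z - X t z') + norm (V t z - V t z')"
  have "?U t + 0 \<le> 2 ^ nat \<lceil>2 * lip_rate * T\<rceil> * (?U 0 + 0)"
  proof (rule gronwall_sup[where U="?U" and a=0 and b=T])
    show "bdd_above (?U ` {0..T})"
      by (intro bounded_imp_bdd_above compact_imp_bounded compact_continuous_image continuous_intros X_cont V_cont) auto
    fix s t S assume st: "s \<in> {0..T}" "t \<in> {0..T}" and "0 \<le> S"
      and S: "\<And>\<tau>. \<tau> \<in> closed_segment s t \<Longrightarrow> ?U \<tau> \<le> S"
    have sub: "closed_segment s t \<subseteq> {0..T}" using st by (simp add: closed_segment_eq_real_ivl)
    have dX: "norm ((X t z - X t z') - (X s z - X s z')) \<le> S * \<bar>t - s\<bar>"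
    proof (rule norm_diff_le_of_derivative_bound[where f'="\<lambda>\<tau>. V \<tau> z - V \<tau> z'", OF _ st])
      show "((\<lambda>t. X t z - X t z') has_vector_derivative V \<tau> z - V \<tau> z') (at \<tau> within {0..T})"
        if "\<tau> \<in> {0..T}" for \<tau> using derX that by (intro has_vector_derivative_diff) auto
      show "norm (V \<tau> z - V \<tau> z') \<le> S" if "\<tau> \<in> closed_segment s t" for \<tau>
        using S[OF that] norm_ge_zero[of "X \<tau> z - X \<tau> z'"] by linarith
    qed
    have dV: "norm ((V t z - V t z') - (V s z - V s z')) \<le> ((4 * L * shell_max * RV + \<kappa>) * S) * \<bar>t - s\<bar>"
    proof (rule norm_diff_le_of_derivative_bound[OF _ st])
      show "((\<lambda>t. V t z - V t z') has_vector_derivative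
          (A \<tau> (X \<tau> z) - B \<tau> (X \<tau> z) *\<^sub>R V \<tau> z) - (A \<tau> (X \<tau> z') - B \<tau> (X \<tau> z') *\<^sub>R V \<tau> z')) (at \<tau> within {0..T})"
        if "\<tau> \<in> {0..T}" for \<tau> using derV' that by (intro has_vector_derivative_diff) auto
      fix \<tau> assume \<tau>: "\<tau> \<in> closed_segment s t"
      then have \<tau>': "\<tau> \<in> {0..T}" using sub by blast
      have "norm ((A \<tau> (X \<tau> z) - B \<tau> (X \<tau> z) *\<^sub>R V \<tau> z) - (A \<tau> (X \<tau> z') - B \<tau> (X \<tau> z') *\<^sub>R V \<tau> z'))
          \<le> 4 * L * shell_max * RV * norm (X \<tau> z - X \<tau> z') + \<kappa> * norm (V \<tau> z - V \<tau> z')"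
        by (intro force_lipschitz \<tau>' X_le V_le z)
      also have "\<dots> \<le> 4 * L * shell_max * RV * S + \<kappa> * S"
        using S[OF \<tau>] norm_ge_zero[of "X \<tau> z - X \<tau> z'"] norm_ge_zero[of "V \<tau> z - V \<tau> z'"]
          L_nonneg shell_max_ge_1 constants_nonneg \<kappa>_pos
        by (intro add_mono mult_left_mono) (linarith | simp)+
      finally show "norm ((A \<tau> (X \<tau> z) - B \<tau> (X \<tau> z) *\<^sub>R V \<tau> z) - (A \<tau> (X \<tau> z') - B \<tau> (X \<tau> z') *\<^sub>R V \<tau> z'))
          \<le> (4 * L * shell_max * RV + \<kappa>) * S" by (simp add: algebra_simps)
    qed
    have "?U t \<le> ?U s + S * \<bar>t - s\<bar> + ((4 * L * shell_max * RV + \<kappa>) * S) * \<bar>t - s\<bar>"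
      using dX dV norm_triangle_sub[of "X t z - X t z'" "X s z - X s z'"]
        norm_triangle_sub[of "V t z - V t z'" "V s z - V s z'"] by linarith
    then show "?U t \<le> ?U s + lip_rate * \<bar>t - s\<bar> * (S + 0)"
      by (simp add: lip_rate_def algebra_simps)
  qed (use lip_rate_ge_1 t T_pos in auto)
  then have "?U t \<le> growth lip_rate * (norm (fst z - fst z') + norm (snd z - snd z'))"
    by (simp add: growth_def init)
  also have "\<dots> \<le> growth lip_rate * (2 * dist z z')"
    using growth_ge_1[of lip_rate] norm_fst_le[of "fst z - fst z'" "snd z - snd z'"]
      norm_snd_le[of "snd z - snd z'" "fst z - fst z'"]
    by (intro mult_left_mono) (auto simp: dist_norm minus_prod_def)
  finally have "?U t \<le> flow_lip * dist z z'" by (simp add: flow_lip_def)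
  then show ?thesis
    using norm_Pair_le[of "X t z - X t z'" "V t z - V t z'"] unfolding dist_norm by simp
qed

end

section \<open>Agents close to the mean-field flow\<close>

text \<open>\<open>\<eta> = sqrt w\<close> balances the two error terms; for \<open>w = 0\<close>
  this choice is not admissible and \<eta> tends to 0 instead.\<close>

lemma le_of_sqrt_tradeoff:
  fixes a b s f w :: real
  assumes le: "\<And>\<eta>. \<eta> > 0 \<Longrightarrow> a \<le> b + s * \<eta> + f * w / \<eta>" and s: "s > 0" and w: "w \<ge> 0"
  shows "a \<le> b + (s + f) * sqrt w"
proof (cases "w = 0")
  case True
  have "a \<le> b + e" if "e > 0" for e
    using le[of "e / s"] that s True by simp
  then show ?thesis using True field_le_epsilon[of a b] by simp
next
  case False
  then have "f * w / sqrt w = f * sqrt w" using w by (simp add: real_div_sqrt flip: times_divide_eq_right)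
  then show ?thesis using le[of "sqrt w"] w False by (simp add: algebra_simps)
qed

text \<open>The Wasserstein distance tests scalar functions, so a difference of vector-valued forces
  is tested one direction at a time.\<close>

lemma norm_le_if_inner_le:
  fixes y :: "'a::real_inner"
  assumes "\<And>e. norm e = 1 \<Longrightarrow> y \<bullet> e \<le> c" "0 \<le> c"
  shows "norm y \<le> c"
proof (cases "y = 0")
  case False
  have "y \<bullet> (y /\<^sub>R norm y) = norm y" using False by (simp add: dot_square_norm power2_eq_square)
  then show ?thesis using assms(1)[of "y /\<^sub>R norm y"] False by simp
qed (use assms in simp)

lemma norm_scaleR_diff_le:
  fixes p q :: "'a::real_normed_vector"
  assumes "0 \<le> b"
  shows "norm (a *\<^sub>R p - b *\<^sub>R q) \<le> \<bar>a - b\<bar> * norm p + b * norm (p - q)"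
proof -
  have "a *\<^sub>R p - b *\<^sub>R q = (a - b) *\<^sub>R p + b *\<^sub>R (p - q)" by (simp add: algebra_simps)
  then show ?thesis using assms norm_triangle_ineq[of "(a - b) *\<^sub>R p" "b *\<^sub>R (p - q)"] by simp
qed

lemma norm_average_le:
  fixes f :: "nat \<Rightarrow> 'a::real_normed_vector"
  shows "norm ((\<Sum>i<n. f i) /\<^sub>R real n) \<le> (\<Sum>i<n. norm (f i)) / real n"
proof -
  have "norm ((\<Sum>i<n. f i) /\<^sub>R real n) = norm (\<Sum>i<n. f i) / real n"
    by (simp add: divide_inverse mult.commute)
  then show ?thesis using norm_sum[of f "{..<n}"] by (simp add: divide_right_mono)
qed

text \<open>\<open>w0\<close> stands for the initial Wasserstein distance, reduced to the property
  that is applied. The bound is one-sided; the other side follows from testing with the negative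
  function.\<close>

locale agents_near_flow = topological_flow P \<kappa> L T Rx Rv c0 K X V
  for P :: "('a::euclidean_space \<times> 'a) measure" and \<kappa> L T Rx Rv c0 K X V +
  fixes N :: nat and z :: "nat \<Rightarrow> 'a \<times> 'a" and XA VA :: "nat \<Rightarrow> real \<Rightarrow> 'a" and w0 :: real
  assumes N_pos: "N > 0" and z_in: "\<And>i. i < N \<Longrightarrow> z i \<in> D"
    and init_agents: "\<And>i. i < N \<Longrightarrow> XA i 0 = fst (z i)" "\<And>i. i < N \<Longrightarrow> VA i 0 = snd (z i)"
    and VA_cont: "\<And>i. i < N \<Longrightarrow> continuous_on {0..T} (VA i)"
    and derXA: "\<And>i t. i < N \<Longrightarrow> t \<in> {0..T} \<Longrightarrow> (XA i has_vector_derivative VA i t) (at t within {0..T})"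
    and integral_VA: "\<And>i t. i < N \<Longrightarrow> t \<in> {0..T} \<Longrightarrow>
      ((\<lambda>s. (\<Sum>j<N. K ((\<Sum>k<N. of_bool (norm (XA k s - XA i s) \<le> norm (XA i s - XA j s))) / N)
          *\<^sub>R (VA j s - VA i s)) /\<^sub>R N) has_integral (VA i t - VA i 0)) {0..t}"
    and w0: "\<And>\<phi>. \<lbrakk>continuous_on UNIV \<phi>; bounded (range \<phi>); 1-lipschitz_on UNIV \<phi>\<rbrakk>
      \<Longrightarrow> (LINT y|P. \<phi> y) - (\<Sum>i<N. \<phi> (z i)) / N \<le> w0"
begin

definition MA :: "real \<Rightarrow> 'a \<Rightarrow> real \<Rightarrow> real" where
  "MA s x r = (\<Sum>k<N. of_bool (norm (XA k s - x) \<le> r)) / N"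

definition forceA :: "nat \<Rightarrow> real \<Rightarrow> 'a" where
  "forceA i s = (\<Sum>j<N. K (MA s (XA i s) (norm (XA i s - XA j s))) *\<^sub>R (VA j s - VA i s)) /\<^sub>R N"

definition force :: "nat \<Rightarrow> real \<Rightarrow> 'a" where
  "force i s = A s (X s (z i)) - B s (X s (z i)) *\<^sub>R V s (z i)"

text \<open>A maximum instead of an average, because comparing counts of points in balls requires
  every agent to be displaced by at most a common amount.\<close>

definition gap :: "real \<Rightarrow> real" where
  "gap t = Max ((\<lambda>i. norm (X t (z i) - XA i t) + norm (V t (z i) - VA i t)) ` {..<N})"

lemma w0_nonneg: "0 \<le> w0"
  using w0[of "\<lambda>_. 0"] by (simp add: lipschitz_on_def)

lemma average_le: "(\<And>i. i < N \<Longrightarrow> f i \<le> c) \<Longrightarrow> (\<Sum>i<N. f i) / N \<le> (c::real)"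
  using sum_bounded_above[of "{..<N}" f c] N_pos by (simp add: field_simps)

lemma gap_ge: "i < N \<Longrightarrow> norm (X t (z i) - XA i t) + norm (V t (z i) - VA i t) \<le> gap t"
  unfolding gap_def by (intro Max_ge) auto

lemma gap_le: "(\<And>i. i < N \<Longrightarrow> norm (X t (z i) - XA i t) + norm (V t (z i) - VA i t) \<le> c) \<Longrightarrow> gap t \<le> c"
  unfolding gap_def using N_pos by (subst Max_le_iff) auto

lemma gap_nonneg: "0 \<le> gap t"
  using gap_ge[OF N_pos, of t] norm_ge_zero[of "X t (z 0) - XA 0 t"] norm_ge_zero[of "V t (z 0) - VA 0 t"] by linarith

text \<open>The flow is Lipschitz only on \<open>D\<close>, but \<open>P\<close> and the points
  \<open>z i\<close> live there: composing with the projection onto \<open>D\<close> extends the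
  test function with the same constant, and dividing by that constant makes it admissible.\<close>

lemma integral_minus_average_le:
  fixes h :: "'a \<times> 'a \<Rightarrow> real"
  assumes m: "h \<in> borel_measurable P" and lip: "l-lipschitz_on D h"
  shows "(LINT y|P. h y) - (\<Sum>i<N. h (z i)) / N \<le> l * w0"
proof -
  let ?l = "max l 1" and ?p = "closest_point D"
  have D: "convex D" "compact D" "closed D" "D \<noteq> {}"
    using Rx_pos Rv_pos by (auto intro!: convex_Times compact_Times closed_Times)
  have D_in: "?p y \<in> D" for y using D by (intro closest_point_in_set) auto
  have D_id: "?p y = y" if "y \<in> D" for y using that by (rule closest_point_self)
  have hp: "k-lipschitz_on UNIV (\<lambda>y. h (?p y))" if "k-lipschitz_on D h" for k
  proof (rule lipschitz_onI)
    fix x y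
    have "dist (h (?p x)) (h (?p y)) \<le> k * dist (?p x) (?p y)" by (rule lipschitz_onD[OF that D_in D_in])
    also have "\<dots> \<le> k * dist x y"
      using that D by (intro mult_left_mono closest_point_lipschitz) (auto simp: lipschitz_on_def)
    finally show "dist (h (?p x)) (h (?p y)) \<le> k * dist x y" .
  qed (use that in \<open>simp add: lipschitz_on_def\<close>)
  have cont: "continuous_on UNIV (\<lambda>y. h (?p y))" using hp[OF lip] by (rule lipschitz_on_continuous_on)
  have "range (\<lambda>y. h (?p y)) \<subseteq> h ` D" using D_in by auto
  moreover have "bounded (h ` D)"
    using lip D by (intro compact_imp_bounded compact_continuous_image lipschitz_on_continuous_on)
  ultimately have bdd: "bounded (range (\<lambda>y. h (?p y)))" using bounded_subset by blast
  have int: "(LINT y|P. h (?p y)) = (LINT y|P. h y)"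
    using m cont sets_P supp
    by (intro integral_cong_AE) (auto intro!: borel_measurable_continuous_onI cong: measurable_cong_sets elim!: eventually_mono simp: D_id)
  have l0: "0 \<le> l" using lip by (simp add: lipschitz_on_def)
  have le: "(LINT y|P. h y) - (\<Sum>i<N. h (z i)) / N \<le> k * w0" if k: "k > 0" "l \<le> k" for k
  proof -
    have "(inverse k * k)-lipschitz_on UNIV (\<lambda>y. inverse k *\<^sub>R h (?p y))"
      using lipschitz_on_cmult[OF hp[OF lipschitz_on_mono[OF lip _ k(2)]], of "inverse k"] k by simp
    then have "1-lipschitz_on UNIV (\<lambda>y. inverse k *\<^sub>R h (?p y))" using k by simp
    moreover have "bounded (range (\<lambda>y. inverse k *\<^sub>R h (?p y)))"
      using bounded_scaling[OF bdd, of "inverse k"] by (simp add: image_image)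
    ultimately have "(LINT y|P. inverse k *\<^sub>R h (?p y)) - (\<Sum>i<N. inverse k *\<^sub>R h (?p (z i))) / N \<le> w0"
      by (intro w0 continuous_intros cont) auto
    then have "inverse k * ((LINT y|P. h y) - (\<Sum>i<N. h (z i)) / N) \<le> w0"
      using z_in by (simp add: int D_id sum_distrib_left[symmetric] right_diff_distrib)
    then show ?thesis using k by (simp add: field_simps)
  qed
  show ?thesis
  proof (cases "l = 0")
    case False
    then show ?thesis using le[of l] l0 by simp
  next
    \<comment> \<open>Constant 0 cannot be normalised to 1; the function is treated as Lipschitz
      with an arbitrarily small positive constant.\<close>
    case True
    have "(LINT y|P. h y) - (\<Sum>i<N. h (z i)) / N \<le> 0 + e" if "e > 0" for e
    proof -
      have "e / (w0 + 1) * w0 \<le> e" using that w0_nonneg by (simp add: field_simps)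
      moreover have "(LINT y|P. h y) - (\<Sum>i<N. h (z i)) / N \<le> e / (w0 + 1) * w0"
        using that w0_nonneg True by (intro le) auto
      ultimately show ?thesis by simp
    qed
    then have "(LINT y|P. h y) - (\<Sum>i<N. h (z i)) / N \<le> 0" by (rule field_le_epsilon)
    then show ?thesis using True by simp
  qed
qed

lemma transported_integral_minus_average_le:
  fixes g :: "'a \<times> 'a \<Rightarrow> real"
  assumes t: "t \<in> {0..T}" and m: "g \<in> borel_measurable borel"
    and lip: "l-lipschitz_on (cball 0 RX \<times> cball 0 RV) g"
  shows "(LINT y|P. g (X t y, V t y)) - (\<Sum>i<N. g (X t (z i), V t (z i))) / N \<le> l * flow_lip * w0"
proof (rule integral_minus_average_le)
  show "(\<lambda>y. g (X t y, V t y)) \<in> borel_measurable P"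
    by (rule measurable_compose[OF flow_meas_P[OF t] m])
  have fl: "flow_lip-lipschitz_on D (\<lambda>y. (X t y, V t y))"
    using flow_lipschitz[OF _ _ t] growth_ge_1[of lip_rate] by (intro lipschitz_onI) (auto simp: flow_lip_def)
  have "l-lipschitz_on ((\<lambda>y. (X t y, V t y)) ` D) g"
    using X_le[OF _ t] V_le[OF _ t] by (intro lipschitz_on_subset[OF lip]) auto
  from lipschitz_on_compose2[OF fl this]
  show "(l * flow_lip)-lipschitz_on D (\<lambda>y. g (X t y, V t y))" .
qed

section \<open>Radial masses and forces of flow and agents\<close>

lemma flow_lip_nonneg: "0 \<le> flow_lip"
  using growth_ge_1[of lip_rate] by (simp add: flow_lip_def)

text \<open>The intermediate count: \<open>M\<close> weighs the mean-field law, \<open>MY\<close>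
  the flow images of the initial data, \<open>MA\<close> the agents.\<close>

definition MY :: "real \<Rightarrow> 'a \<Rightarrow> real \<Rightarrow> real" where
  "MY t x r = (\<Sum>k<N. of_bool (norm (X t (z k) - x) \<le> r)) / N"

lemma MY_discrepancy:
  assumes t: "t \<in> {0..T}" and \<eta>: "\<eta> > 0"
  shows "MY t x r \<le> M t x (r + \<eta>) + flow_lip * w0 / \<eta>"
    and "M t x r \<le> MY t x (r + \<eta>) + flow_lip * w0 / \<eta>"
proof -
  \<comment> \<open>A piecewise linear function of the distance lying between the indicators of the
    balls of radius \<open>r\<close> and \<open>r + \<eta>\<close>; its slope gives the factor
    \<open>1 / \<eta>\<close>. The two inequalities come from testing with \<open>cut\<close> and
    with its negative.\<close>
  define cut where "cut = (\<lambda>y :: 'a \<times> 'a. min 1 (max 0 ((r + \<eta> - norm (fst y - x)) / \<eta>)))"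
  have cut_cont: "continuous_on UNIV cut" unfolding cut_def using \<eta> by (intro continuous_intros) auto
  then have cut_m: "cut \<in> borel_measurable borel" by (rule borel_measurable_continuous_onI)
  have cut_lower: "of_bool (norm (fst y - x) \<le> r) \<le> cut y" for y
    using \<eta> by (auto simp: cut_def field_simps)
  have cut_upper: "cut y \<le> of_bool (norm (fst y - x) \<le> r + \<eta>)" for y
    using \<eta> by (auto simp: cut_def field_simps)
  have cut_range: "0 \<le> cut y" "cut y \<le> 1" for y by (auto simp: cut_def)
  have lip: "(1 / \<eta>)-lipschitz_on S cut" for S
  proof (rule lipschitz_onI)
    fix y y' :: "'a \<times> 'a"
    have "\<bar>norm (fst y - x) - norm (fst y' - x)\<bar> \<le> norm (fst y - fst y')"
      using norm_triangle_ineq3[of "fst y - x" "fst y' - x"] by simp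
    also have "\<dots> \<le> dist y y'"
      using dist_fst_le[of y y'] by (simp add: dist_norm)
    finally have d: "\<bar>norm (fst y - x) - norm (fst y' - x)\<bar> \<le> dist y y'" .
    have "\<bar>cut y - cut y'\<bar> \<le> \<bar>(r + \<eta> - norm (fst y - x)) / \<eta> - (r + \<eta> - norm (fst y' - x)) / \<eta>\<bar>"
      unfolding cut_def by linarith
    also have "\<dots> = \<bar>norm (fst y - x) - norm (fst y' - x)\<bar> / \<eta>"
      using \<eta> by (simp add: abs_minus_commute flip: diff_divide_distrib)
    also have "\<dots> \<le> dist y y' / \<eta>" using d \<eta> by (simp add: divide_right_mono)
    finally show "dist (cut y) (cut y') \<le> 1 / \<eta> * dist y y'" by (simp add: dist_real_def)
  qed (use \<eta> in simp)
  have lip': "(1 / \<eta>)-lipschitz_on S (\<lambda>y. - cut y)" for S using lip by (rule lipschitz_on_minus)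
  have int: "integrable P (\<lambda>y. cut (X t y, V t y))"
    by (rule integrable_const_bound[where B=1])
      (auto intro: measurable_compose[OF flow_meas_P[OF t] cut_m] simp: cut_range)
  have M_int: "M t x q = (LINT y|P. of_bool (norm (X t y - x) \<le> q))"
    and ind_int: "integrable P (\<lambda>y. of_bool (norm (X t y - x) \<le> q) :: real)" for q
  proof -
    have "(\<lambda>y. of_bool (norm (X t y - x) \<le> q)) = (indicator {y. norm (X t y - x) \<le> q} :: _ \<Rightarrow> real)"
      by (auto simp: indicator_def)
    then show "M t x q = (LINT y|P. of_bool (norm (X t y - x) \<le> q))"
      "integrable P (\<lambda>y. of_bool (norm (X t y - x) \<le> q) :: real)"
      using M_sets[OF t, of x q] by (auto simp: M_def less_top[symmetric])
  qed
  have "M t x r \<le> (LINT y|P. cut (X t y, V t y))"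
    unfolding M_int using cut_lower by (intro integral_mono ind_int int) (metis fst_conv)
  also have "\<dots> \<le> (\<Sum>k<N. cut (X t (z k), V t (z k))) / N + 1 / \<eta> * flow_lip * w0"
    using transported_integral_minus_average_le[OF t cut_m lip] by simp
  also have "(\<Sum>k<N. cut (X t (z k), V t (z k))) / N \<le> MY t x (r + \<eta>)"
    unfolding MY_def using cut_upper by (intro divide_right_mono sum_mono) (metis fst_conv, simp)
  finally show "M t x r \<le> MY t x (r + \<eta>) + flow_lip * w0 / \<eta>" by simp
  have "MY t x r \<le> (\<Sum>k<N. cut (X t (z k), V t (z k))) / N"
    unfolding MY_def using cut_lower by (intro divide_right_mono sum_mono) (metis fst_conv, simp)
  also have "\<dots> \<le> (LINT y|P. cut (X t y, V t y)) + 1 / \<eta> * flow_lip * w0"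
    using transported_integral_minus_average_le[OF t _ lip'] cut_m by (simp add: sum_negf)
  also have "(LINT y|P. cut (X t y, V t y)) \<le> M t x (r + \<eta>)"
    unfolding M_int using cut_upper by (intro integral_mono ind_int int) (metis fst_conv)
  finally show "MY t x r \<le> M t x (r + \<eta>) + flow_lip * w0 / \<eta>" by simp
qed

text \<open>The displacements of centre and agents, each at most \<open>S\<close>, change the radius
  by \<open>2 * S\<close> when agents are replaced by flow images. Smoothing at width \<eta> leads
  to the mean-field mass, and the shell bound brings the radius back to \<open>r\<close>; \<eta> is
  optimised last.\<close>

lemma M_MA_diff:
  assumes t: "t \<in> {0..T}" and x: "x \<in> cball 0 RX" and x': "norm (x - x') \<le> S"
    and S: "\<And>k. k < N \<Longrightarrow> norm (X t (z k) - XA k t) \<le> S"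
  shows "\<bar>M t x r - MA t x' r'\<bar> \<le> shell_max * (\<bar>r - r'\<bar> + 2 * S) + (shell_max + flow_lip) * sqrt w0"
proof -
  let ?b = "shell_max * (\<bar>r - r'\<bar> + 2 * S)"
  have S0: "0 \<le> S" using x' norm_ge_zero order_trans by blast
  have 1: "MA t x' r' \<le> MY t x (r' + 2 * S)"
    unfolding MA_def MY_def
  proof (intro divide_right_mono sum_mono)
    fix k assume "k \<in> {..<N}"
    then have k: "norm (X t (z k) - XA k t) \<le> S" using S by simp
    have "norm (X t (z k) - x) \<le> norm (X t (z k) - XA k t) + norm (XA k t - x') + norm (x - x')"
      using norm_triangle_ineq4[of "X t (z k) - x'" "x - x'"] norm_triangle_ineq[of "X t (z k) - XA k t" "XA k t - x'"]
      by simp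
    then show "of_bool (norm (XA k t - x') \<le> r') \<le> (of_bool (norm (X t (z k) - x) \<le> r' + 2 * S) :: real)"
      using k x' by auto
  qed simp
  have 2: "MY t x (r' - 2 * S) \<le> MA t x' r'"
    unfolding MA_def MY_def
  proof (intro divide_right_mono sum_mono)
    fix k assume "k \<in> {..<N}"
    then have k: "norm (X t (z k) - XA k t) \<le> S" using S by simp
    have "norm (XA k t - x') \<le> norm (X t (z k) - x) + norm (x - x') + norm (X t (z k) - XA k t)"
      using norm_triangle_ineq4[of "X t (z k) - x'" "X t (z k) - XA k t"] norm_triangle_ineq[of "X t (z k) - x" "x - x'"]
      by simp
    then show "of_bool (norm (X t (z k) - x) \<le> r' - 2 * S) \<le> (of_bool (norm (XA k t - x') \<le> r') :: real)"
      using k x' by auto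
  qed simp
  have "MA t x' r' \<le> M t x r + ?b + shell_max * \<eta> + flow_lip * w0 / \<eta>" if \<eta>: "\<eta> > 0" for \<eta>
  proof -
    have "MA t x' r' \<le> M t x (r' + 2 * S + \<eta>) + flow_lip * w0 / \<eta>"
      using 1 MY_discrepancy(1)[OF t \<eta>, of x "r' + 2 * S"] by linarith
    also have "M t x (r' + 2 * S + \<eta>) \<le> M t x (r + (\<bar>r - r'\<bar> + 2 * S + \<eta>))"
      by (rule monoD[OF M_mono[OF t]]) linarith
    also have "\<dots> \<le> M t x r + shell_max * (\<bar>r - r'\<bar> + 2 * S + \<eta>)"
      using S0 \<eta> by (intro M_shell_max t x) auto
    finally show ?thesis by (simp add: algebra_simps)
  qed
  then have "MA t x' r' \<le> M t x r + ?b + (shell_max + flow_lip) * sqrt w0"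
    using shell_max_ge_1 w0_nonneg by (intro le_of_sqrt_tradeoff) auto
  moreover have "M t x r \<le> MA t x' r' + ?b + shell_max * \<eta> + flow_lip * w0 / \<eta>" if \<eta>: "\<eta> > 0" for \<eta>
  proof -
    \<comment> \<open>Chosen so that the smoothed radius \<open>?q + \<eta>\<close> is
      \<open>r' - 2 * S\<close>. It may be negative, which the shell bound allows.\<close>
    let ?q = "r' - 2 * S - \<eta>"
    have "M t x r \<le> M t x (?q + (\<bar>r - r'\<bar> + 2 * S + \<eta>))"
      by (rule monoD[OF M_mono[OF t]]) linarith
    also have "\<dots> \<le> M t x ?q + shell_max * (\<bar>r - r'\<bar> + 2 * S + \<eta>)"
      using S0 \<eta> by (intro M_shell_max t x) auto
    also have "M t x ?q \<le> MA t x' r' + flow_lip * w0 / \<eta>"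
      using 2 MY_discrepancy(2)[OF t \<eta>, of x ?q] by simp
    finally show ?thesis by (simp add: algebra_simps)
  qed
  then have "M t x r \<le> MA t x' r' + ?b + (shell_max + flow_lip) * sqrt w0"
    using shell_max_ge_1 w0_nonneg by (intro le_of_sqrt_tradeoff) auto
  ultimately show ?thesis by linarith
qed

lemma M_radial_lipschitz:
  assumes t: "t \<in> {0..T}" and x: "x \<in> cball 0 RX"
  shows "\<bar>M t x r - M t x q\<bar> \<le> shell_max * \<bar>r - q\<bar>"
proof -
  have "M t x r \<le> M t x q + shell_max * \<bar>r - q\<bar>" for r q
  proof -
    have "M t x r \<le> M t x (q + \<bar>r - q\<bar>)" by (rule monoD[OF M_mono[OF t]]) linarith
    also have "\<dots> \<le> M t x q + shell_max * \<bar>r - q\<bar>" by (intro M_shell_max t x) auto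
    finally show ?thesis .
  qed
  from this[of r q] this[of q r] show ?thesis by (simp add: abs_le_iff abs_minus_commute)
qed

text \<open>For fixed \<open>x\<close> and \<open>v\<close> the integrand is a Lipschitz function of
  the state, since \<open>M t x\<close> is Lipschitz in the radius. Hence this error is linear in
  \<open>w0\<close>; the square root appears only when \<open>M\<close> is replaced by the agents'
  count.\<close>

lemma mean_field_force_diff:
  assumes t: "t \<in> {0..T}" and x: "x \<in> cball 0 RX" and v: "norm v \<le> RV"
  shows "norm ((A t x - B t x *\<^sub>R v) - (\<Sum>j<N. weight t x (z j) *\<^sub>R (V t (z j) - v)) /\<^sub>R N)
    \<le> (2 * L * shell_max * RV + \<kappa>) * flow_lip * w0"
proof (rule norm_le_if_inner_le)
  let ?l = "2 * L * shell_max * RV + \<kappa>"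
  have l0: "0 \<le> ?l" using L_nonneg shell_max_ge_1 constants_nonneg \<kappa>_pos by simp
  then show "0 \<le> ?l * flow_lip * w0" using flow_lip_nonneg w0_nonneg by simp
  fix e :: 'a assume e: "norm e = 1"
  define g where "g = (\<lambda>y. K (M t x (norm (x - fst y))) * ((snd y - v) \<bullet> e))"
  have "(\<lambda>y. M t x (norm (x - fst y))) \<in> borel_measurable (borel :: ('a \<times> 'a) measure)"
    by (rule measurable_compose[OF _ borel_measurable_mono[OF M_mono[OF t]]])
      (intro borel_measurable_continuous_onI continuous_intros)
  then have "(\<lambda>y. K (M t x (norm (x - fst y)))) \<in> borel_measurable (borel :: ('a \<times> 'a) measure)"
    by (rule measurable_compose[OF _ K_meas])
  moreover have "(\<lambda>y. (snd y - v) \<bullet> e) \<in> borel_measurable (borel :: ('a \<times> 'a) measure)"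
    by (intro borel_measurable_continuous_onI continuous_intros)
  ultimately have g_m: "g \<in> borel_measurable borel" unfolding g_def by (rule borel_measurable_times)
  have "?l-lipschitz_on (cball 0 RX \<times> cball 0 RV) g"
  proof (rule lipschitz_onI[OF _ l0])
    fix y y' :: "'a \<times> 'a" assume y: "y \<in> cball 0 RX \<times> cball 0 RV" "y' \<in> cball 0 RX \<times> cball 0 RV"
    let ?k = "K (M t x (norm (x - fst y)))" and ?k' = "K (M t x (norm (x - fst y')))"
    have d: "norm (fst y - fst y') \<le> dist y y'" "norm (snd y - snd y') \<le> dist y y'"
      using dist_fst_le[of y y'] dist_snd_le[of y y'] by (simp_all add: dist_norm)
    have "\<bar>?k - ?k'\<bar> \<le> L * \<bar>M t x (norm (x - fst y)) - M t x (norm (x - fst y'))\<bar>" by (rule K_lip)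
    also have "\<dots> \<le> L * (shell_max * \<bar>norm (x - fst y) - norm (x - fst y')\<bar>)"
      using L_nonneg by (intro mult_left_mono M_radial_lipschitz t x)
    also have "\<dots> \<le> L * (shell_max * dist y y')"
    proof (intro mult_left_mono)
      have "\<bar>norm (x - fst y) - norm (x - fst y')\<bar> \<le> norm (fst y - fst y')"
        using norm_triangle_ineq3[of "x - fst y" "x - fst y'"] by (simp add: norm_minus_commute)
      then show "\<bar>norm (x - fst y) - norm (x - fst y')\<bar> \<le> dist y y'" using d by linarith
    qed (use L_nonneg shell_max_ge_1 in auto)
    finally have k: "\<bar>?k - ?k'\<bar> \<le> L * (shell_max * dist y y')" .
    have "\<bar>(snd y - v) \<bullet> e\<bar> \<le> norm (snd y - v)" using Cauchy_Schwarz_ineq2[of "snd y - v" e] e by simp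
    also have "\<dots> \<le> 2 * RV" using y v norm_triangle_ineq4[of "snd y" v] by auto
    finally have w: "\<bar>(snd y - v) \<bullet> e\<bar> \<le> 2 * RV" .
    have w': "\<bar>(snd y - snd y') \<bullet> e\<bar> \<le> dist y y'"
      using Cauchy_Schwarz_ineq2[of "snd y - snd y'" e] e d by simp
    have "g y - g y' = (?k - ?k') * ((snd y - v) \<bullet> e) + ?k' * ((snd y - snd y') \<bullet> e)"
      by (simp add: g_def algebra_simps)
    then have "\<bar>g y - g y'\<bar> \<le> \<bar>?k - ?k'\<bar> * \<bar>(snd y - v) \<bullet> e\<bar> + \<bar>?k'\<bar> * \<bar>(snd y - snd y') \<bullet> e\<bar>"
      by (metis abs_mult abs_triangle_ineq)
    also have "\<dots> \<le> (L * (shell_max * dist y y')) * (2 * RV) + \<kappa> * dist y y'"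
      using k w w' K_nonneg K_le L_nonneg shell_max_ge_1 \<kappa>_pos by (intro add_mono mult_mono) auto
    finally show "dist (g y) (g y') \<le> ?l * dist y y'" by (simp add: dist_real_def algebra_simps)
  qed
  from transported_integral_minus_average_le[OF t g_m this]
  have le: "(LINT y|P. g (X t y, V t y)) - (\<Sum>i<N. g (X t (z i), V t (z i))) / N \<le> ?l * flow_lip * w0" .
  have F: "A t x - B t x *\<^sub>R v = (LINT y|P. weight t x y *\<^sub>R (V t y - v))"
    using weight_V_integrable[OF t] weight_integrable[OF t] by (simp add: scaleR_diff_right A_def B_def)
  have Fi: "integrable P (\<lambda>y. weight t x y *\<^sub>R (V t y - v))"
    using weight_V_integrable[OF t] weight_integrable[OF t] by (simp add: scaleR_diff_right)
  have "(A t x - B t x *\<^sub>R v) \<bullet> e = (LINT y|P. g (X t y, V t y))"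
    unfolding F using integral_inner_left[OF Fi, of e] by (simp add: g_def weight_def)
  moreover have "((\<Sum>j<N. weight t x (z j) *\<^sub>R (V t (z j) - v)) /\<^sub>R N) \<bullet> e = (\<Sum>i<N. g (X t (z i), V t (z i))) / N"
    by (simp add: g_def weight_def inner_sum_left divide_inverse mult.commute)
  ultimately show "((A t x - B t x *\<^sub>R v) - (\<Sum>j<N. weight t x (z j) *\<^sub>R (V t (z j) - v)) /\<^sub>R N) \<bullet> e \<le> ?l * flow_lip * w0"
    using le by (simp add: inner_diff_left)
qed

text \<open>The intermediate \<open>?F\<close> averages over the flow images but keeps the
  mean-field weights. From \<open>force\<close> to \<open>?F\<close> only sampling is charged; from
  \<open>?F\<close> to \<open>forceA\<close> weights and relative velocities are exchanged summand
  by summand.\<close>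

lemma force_gap:
  assumes i: "i < N" and t: "t \<in> {0..T}" and S: "gap t \<le> S"
  shows "norm (force i t - forceA i t) \<le> (agent_rate - 1) * (S + (w0 + sqrt w0))"
proof -
  let ?x = "X t (z i)" and ?v = "V t (z i)" and ?x' = "XA i t" and ?v' = "VA i t"
  let ?F = "(\<Sum>j<N. weight t ?x (z j) *\<^sub>R (V t (z j) - ?v)) /\<^sub>R N"
  let ?m = "\<lambda>j. M t ?x (norm (?x - X t (z j)))" and ?m' = "\<lambda>j. MA t ?x' (norm (?x' - XA j t))"
  let ?c = "L * (4 * shell_max * S + (shell_max + flow_lip) * sqrt w0) * (2 * RV) + \<kappa> * (2 * S)"
  have S0: "0 \<le> S" using gap_nonneg[of t] S by simp
  have near: "norm (X t (z k) - XA k t) \<le> S" "norm (V t (z k) - VA k t) \<le> S" if "k < N" for k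
    using gap_ge[OF that, of t] S norm_ge_zero[of "X t (z k) - XA k t"] norm_ge_zero[of "V t (z k) - VA k t"] by linarith+
  have x: "?x \<in> cball 0 RX" and v: "norm ?v \<le> RV" using X_le V_le z_in i t by auto
  have 1: "norm (force i t - ?F) \<le> (2 * L * shell_max * RV + \<kappa>) * flow_lip * w0"
    unfolding force_def by (rule mean_field_force_diff[OF t x v])
  have summand: "norm (weight t ?x (z j) *\<^sub>R (V t (z j) - ?v) - K (?m' j) *\<^sub>R (VA j t - ?v')) \<le> ?c" if j: "j < N" for j
  proof -
    have xx: "(?x - X t (z j)) - (?x' - XA j t) = (?x - ?x') - (X t (z j) - XA j t)" by simp
    have "\<bar>norm (?x - X t (z j)) - norm (?x' - XA j t)\<bar> \<le> norm (?x - ?x') + norm (X t (z j) - XA j t)"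
      by (rule order_trans[OF norm_triangle_ineq3]) (simp only: xx norm_triangle_ineq4)
    then have r: "\<bar>norm (?x - X t (z j)) - norm (?x' - XA j t)\<bar> \<le> 2 * S" using near[OF i] near[OF j] by linarith
    have "\<bar>?m j - ?m' j\<bar> \<le> shell_max * (\<bar>norm (?x - X t (z j)) - norm (?x' - XA j t)\<bar> + 2 * S) + (shell_max + flow_lip) * sqrt w0"
      by (rule M_MA_diff[OF t x near(1)[OF i] near(1)])
    moreover have "shell_max * (\<bar>norm (?x - X t (z j)) - norm (?x' - XA j t)\<bar> + 2 * S) \<le> shell_max * (4 * S)"
      using r shell_max_ge_1 by (intro mult_left_mono) auto
    ultimately have "\<bar>?m j - ?m' j\<bar> \<le> 4 * shell_max * S + (shell_max + flow_lip) * sqrt w0" by linarith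
    then have "L * \<bar>?m j - ?m' j\<bar> \<le> L * (4 * shell_max * S + (shell_max + flow_lip) * sqrt w0)"
      using L_nonneg by (rule mult_left_mono)
    then have k: "\<bar>weight t ?x (z j) - K (?m' j)\<bar> \<le> L * (4 * shell_max * S + (shell_max + flow_lip) * sqrt w0)"
      unfolding weight_def using K_lip[of "?m j" "?m' j"] by linarith
    have w: "norm (V t (z j) - ?v) \<le> 2 * RV"
      using norm_triangle_ineq4[of "V t (z j)" ?v] v V_le[OF z_in[OF j] t] by linarith
    have vv: "(V t (z j) - ?v) - (VA j t - ?v') = (V t (z j) - VA j t) - (?v - ?v')" by simp
    have w': "norm ((V t (z j) - ?v) - (VA j t - ?v')) \<le> 2 * S"
      unfolding vv
      using norm_triangle_ineq4[of "V t (z j) - VA j t" "?v - ?v'"] near[OF i] near[OF j] by linarith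
    have "norm (weight t ?x (z j) *\<^sub>R (V t (z j) - ?v) - K (?m' j) *\<^sub>R (VA j t - ?v'))
        \<le> \<bar>weight t ?x (z j) - K (?m' j)\<bar> * norm (V t (z j) - ?v)
        + K (?m' j) * norm ((V t (z j) - ?v) - (VA j t - ?v'))"
      using K_nonneg by (rule norm_scaleR_diff_le)
    also have "\<dots> \<le> ?c"
    proof (rule add_mono[OF mult_mono[OF k w] mult_mono[OF K_le w']])
      show "0 \<le> L * (4 * shell_max * S + (shell_max + flow_lip) * sqrt w0)"
        using L_nonneg S0 shell_max_ge_1 flow_lip_nonneg w0_nonneg by simp
    qed (use \<kappa>_pos in auto)
    finally show ?thesis .
  qed
  have diff: "?F - forceA i t = (\<Sum>j<N. weight t ?x (z j) *\<^sub>R (V t (z j) - ?v) - K (?m' j) *\<^sub>R (VA j t - ?v')) /\<^sub>R N"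
    by (simp add: forceA_def sum_subtractf scaleR_diff_right)
  have 2: "norm (?F - forceA i t) \<le> ?c"
    unfolding diff by (rule order_trans[OF norm_average_le average_le]) (rule summand)
  have "norm (force i t - forceA i t) \<le> (2 * L * shell_max * RV + \<kappa>) * flow_lip * w0 + ?c"
    by (rule norm_diff_triangle_le[OF 1 2])
  also have "\<dots> \<le> (agent_rate - 1) * (S + (w0 + sqrt w0))"
  proof -
    \<comment> \<open>\<open>?b1\<close> multiplies \<open>S\<close> and \<open>?b2\<close>
      multiplies \<open>sqrt w0\<close>; together they form the term with
      \<open>5 * shell_max + flow_lip\<close> in \<open>agent_rate\<close>.\<close>
    let ?a = "(2 * L * shell_max * RV + \<kappa>) * flow_lip"
    let ?b1 = "2 * L * RV * (4 * shell_max)" and ?b2 = "2 * L * RV * (shell_max + flow_lip)"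
    have nn: "0 \<le> ?a" "0 \<le> ?b1" "0 \<le> ?b2" "0 \<le> 2 * \<kappa>" "0 \<le> sqrt w0"
      using L_nonneg shell_max_ge_1 constants_nonneg \<kappa>_pos flow_lip_nonneg w0_nonneg by auto
    have "?a * w0 + ?c = ?a * w0 + ?b1 * S + ?b2 * sqrt w0 + 2 * \<kappa> * S" by (simp add: algebra_simps)
    also have "\<dots> \<le> ?a * (S + (w0 + sqrt w0)) + ?b1 * (S + (w0 + sqrt w0)) + ?b2 * (S + (w0 + sqrt w0)) + 2 * \<kappa> * (S + (w0 + sqrt w0))"
      using nn S0 w0_nonneg by (intro add_mono mult_left_mono) auto
    also have "\<dots> = (agent_rate - 1) * (S + (w0 + sqrt w0))" by (simp add: agent_rate_def algebra_simps)
    finally show ?thesis .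
  qed
  finally show ?thesis .
qed


section \<open>Gronwall estimate for the gap\<close>

lemma agent_rate_ge_1: "1 \<le> agent_rate"
  using L_nonneg shell_max_ge_1 constants_nonneg \<kappa>_pos flow_lip_nonneg by (simp add: agent_rate_def)

text \<open>The agents' velocities obey their equation only in integrated form, so the mean value
  inequality is replaced by bounding the integral of the difference of the two forces.\<close>

lemma velocity_gap_diff:
  assumes i: "i < N" and st: "0 \<le> s" "s \<le> t" "t \<le> T"
    and S: "\<And>\<tau>. \<tau> \<in> {s..t} \<Longrightarrow> gap \<tau> \<le> S"
  shows "norm ((V t (z i) - VA i t) - (V s (z i) - VA i s)) \<le> (agent_rate - 1) * (S + (w0 + sqrt w0)) * (t - s)"
proof -
  have sub: "{s..t} \<subseteq> {0..T}" using st by auto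
  have hi: "(forceA i has_integral (VA i u - VA i 0)) {0..u}" if "u \<in> {0..T}" for u
    using integral_VA[OF i that] unfolding forceA_def[abs_def] MA_def .
  have 0: "(forceA i has_integral (VA i t - VA i 0)) {0..t}" "(forceA i has_integral (VA i s - VA i 0)) {0..s}"
    using hi[of t] hi[of s] st by simp_all
  have "forceA i integrable_on {s..t}"
    by (rule integrable_subinterval_real[OF has_integral_integrable[OF 0(1)]]) (use st in simp)
  then obtain I where I: "(forceA i has_integral I) {s..t}" unfolding integrable_on_def by blast
  have "(forceA i has_integral (VA i s - VA i 0 + I)) {0..t}"
    by (rule has_integral_combine[OF st(1,2) 0(2) I])
  then have I_eq: "VA i s - VA i 0 + I = VA i t - VA i 0" using 0(1) by (rule has_integral_unique)
  have "I = (VA i s - VA i 0 + I) - (VA i s - VA i 0)" by simp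
  also have "\<dots> = VA i t - VA i s" unfolding I_eq by simp
  finally have FA: "(forceA i has_integral (VA i t - VA i s)) {s..t}" using I by simp
  have F: "(force i has_integral (V t (z i) - V s (z i))) {s..t}"
    unfolding force_def[abs_def]
  proof (rule fundamental_theorem_of_calculus[OF st(2)])
    fix \<tau> assume "\<tau> \<in> {s..t}"
    then have "\<tau> \<in> {0..T}" using sub by blast
    from has_vector_derivative_within_subset[OF derV'[OF this] sub]
    show "((\<lambda>a. V a (z i)) has_vector_derivative A \<tau> (X \<tau> (z i)) - B \<tau> (X \<tau> (z i)) *\<^sub>R V \<tau> (z i)) (at \<tau> within {s..t})" .
  qed
  have eq: "(V t (z i) - VA i t) - (V s (z i) - VA i s) = (V t (z i) - V s (z i)) - (VA i t - VA i s)" by simp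
  have "norm ((V t (z i) - V s (z i)) - (VA i t - VA i s)) \<le> ((agent_rate - 1) * (S + (w0 + sqrt w0))) * measure lborel {s..t}"
  proof (rule has_integral_bound_real[OF _ _ has_integral_diff[OF F FA], where S="{}"])
    have "0 \<le> S" using S[of s] gap_nonneg[of s] st by auto
    then show "0 \<le> (agent_rate - 1) * (S + (w0 + sqrt w0))"
      using agent_rate_ge_1 w0_nonneg by simp
    show "norm (force i \<tau> - forceA i \<tau>) \<le> (agent_rate - 1) * (S + (w0 + sqrt w0))" if "\<tau> \<in> {s..t} - {}" for \<tau>
      using that sub by (intro force_gap[OF i _ S]) auto
  qed simp
  then show ?thesis unfolding eq using st(2) by simp
qed

lemma gap_step:
  assumes st: "s \<in> {0..T}" "t \<in> {0..T}" and S: "\<And>\<tau>. \<tau> \<in> closed_segment s t \<Longrightarrow> gap \<tau> \<le> S"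
  shows "gap t \<le> gap s + agent_rate * \<bar>t - s\<bar> * (S + (w0 + sqrt w0))"
proof (rule gap_le)
  fix i assume i: "i < N"
  let ?E = "w0 + sqrt w0"
  have E0: "0 \<le> ?E" using w0_nonneg by simp
  have sub: "closed_segment s t \<subseteq> {0..T}" using st by (simp add: closed_segment_eq_real_ivl)
  have dX: "norm ((X t (z i) - XA i t) - (X s (z i) - XA i s)) \<le> S * \<bar>t - s\<bar>"
  proof (rule norm_diff_le_of_derivative_bound[where f'="\<lambda>\<tau>. V \<tau> (z i) - VA i \<tau>", OF _ st])
    show "((\<lambda>t. X t (z i) - XA i t) has_vector_derivative V \<tau> (z i) - VA i \<tau>) (at \<tau> within {0..T})"
      if "\<tau> \<in> {0..T}" for \<tau> by (intro has_vector_derivative_diff derX derXA i that)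
    show "norm (V \<tau> (z i) - VA i \<tau>) \<le> S" if "\<tau> \<in> closed_segment s t" for \<tau>
      using S[OF that] gap_ge[OF i, of \<tau>] norm_ge_zero[of "X \<tau> (z i) - XA i \<tau>"] by linarith
  qed
  have dV: "norm ((V t (z i) - VA i t) - (V s (z i) - VA i s)) \<le> (agent_rate - 1) * (S + ?E) * \<bar>t - s\<bar>"
  proof (cases "s \<le> t")
    case True
    then show ?thesis using velocity_gap_diff[OF i, of s t S] st S by (simp add: closed_segment_eq_real_ivl)
  next
    case False
    then show ?thesis
      using velocity_gap_diff[OF i, of t s S] st S
      by (simp add: closed_segment_eq_real_ivl norm_minus_commute)
  qed
  have "norm (X t (z i) - XA i t) + norm (V t (z i) - VA i t)
      \<le> (norm (X s (z i) - XA i s) + norm (V s (z i) - VA i s)) + S * \<bar>t - s\<bar> + (agent_rate - 1) * (S + ?E) * \<bar>t - s\<bar>"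
    using dX dV norm_triangle_sub[of "X t (z i) - XA i t" "X s (z i) - XA i s"]
      norm_triangle_sub[of "V t (z i) - VA i t" "V s (z i) - VA i s"] by linarith
  also have "\<dots> \<le> gap s + (S + ?E) * \<bar>t - s\<bar> + (agent_rate - 1) * (S + ?E) * \<bar>t - s\<bar>"
    using E0 S[of s] gap_nonneg[of s] by (intro add_mono gap_ge i mult_right_mono) auto
  also have "\<dots> = gap s + agent_rate * \<bar>t - s\<bar> * (S + ?E)" by (simp add: algebra_simps)
  finally show "norm (X t (z i) - XA i t) + norm (V t (z i) - VA i t) \<le> gap s + agent_rate * \<bar>t - s\<bar> * (S + ?E)" .
qed

lemma gap_bound: "t \<in> {0..T} \<Longrightarrow> gap t \<le> growth agent_rate * (w0 + sqrt w0)"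
proof -
  assume t: "t \<in> {0..T}"
  have E0: "0 \<le> w0 + sqrt w0" using w0_nonneg by simp
  have "gap t + (w0 + sqrt w0) \<le> 2 ^ nat \<lceil>2 * agent_rate * T\<rceil> * (gap 0 + (w0 + sqrt w0))"
  proof (rule gronwall_sup[where U=gap and a=0 and b=T])
    \<comment> \<open>The sum over the agents is continuous and dominates the maximum, which
      supplies the boundedness that \<open>gronwall_sup\<close> asks for.\<close>
    let ?g = "\<lambda>t. \<Sum>i<N. norm (X t (z i) - XA i t) + norm (V t (z i) - VA i t)"
    have XA_cont: "continuous_on {0..T} (XA i)" if "i < N" for i
      using derXA[OF that] by (meson continuous_on_eq_continuous_within has_vector_derivative_continuous)
    have "bdd_above (?g ` {0..T})"
      by (intro bounded_imp_bdd_above compact_imp_bounded compact_continuous_image continuous_intros X_cont V_cont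
          XA_cont VA_cont) auto
    then obtain c where c: "\<And>\<tau>. \<tau> \<in> {0..T} \<Longrightarrow> ?g \<tau> \<le> c" unfolding bdd_above_def by blast
    have "gap \<tau> \<le> ?g \<tau>" for \<tau>
      by (rule gap_le, rule member_le_sum) auto
    then have "gap \<tau> \<le> c" if "\<tau> \<in> {0..T}" for \<tau> using c[OF that] order_trans by blast
    then show "bdd_above (gap ` {0..T})" unfolding bdd_above_def by blast
    show "gap t' \<le> gap s' + agent_rate * \<bar>t' - s'\<bar> * (S + (w0 + sqrt w0))"
      if "s' \<in> {0..T}" "t' \<in> {0..T}" "\<And>\<tau>. \<tau> \<in> closed_segment s' t' \<Longrightarrow> gap \<tau> \<le> S" for s' t' S
      using that by (rule gap_step)
  qed (use agent_rate_ge_1 E0 gap_nonneg t T_pos in auto)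
  moreover have "gap 0 \<le> 0"
    by (rule gap_le) (simp add: init init_agents)
  ultimately show ?thesis using E0 gap_nonneg[of 0] by (simp add: growth_def)
qed

lemma integral_minus_agent_average_le:
  fixes \<phi> :: "'a \<times> 'a \<Rightarrow> real"
  assumes t: "t \<in> {0..T}" and \<phi>: "1-lipschitz_on UNIV \<phi>"
  shows "(LINT y|P. \<phi> (X t y, V t y)) - (\<Sum>i<N. \<phi> (XA i t, VA i t)) / N \<le> stability_const * max w0 (sqrt w0)"
proof -
  have m: "\<phi> \<in> borel_measurable borel"
    using \<phi> by (intro borel_measurable_continuous_onI lipschitz_on_continuous_on)
  have "1-lipschitz_on (cball 0 RX \<times> cball 0 RV) \<phi>" using \<phi> by (rule lipschitz_on_subset) simp
  from transported_integral_minus_average_le[OF t m this]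
  have 1: "(LINT y|P. \<phi> (X t y, V t y)) - (\<Sum>i<N. \<phi> (X t (z i), V t (z i))) / N \<le> flow_lip * w0" by simp
  have "\<phi> (X t (z i), V t (z i)) - \<phi> (XA i t, VA i t) \<le> gap t" if i: "i < N" for i
  proof -
    have "\<phi> (X t (z i), V t (z i)) - \<phi> (XA i t, VA i t) \<le> dist (X t (z i), V t (z i)) (XA i t, VA i t)"
      using lipschitz_onD[OF \<phi>, of "(X t (z i), V t (z i))" "(XA i t, VA i t)"] by (simp add: dist_real_def)
    also have "\<dots> \<le> gap t"
      using gap_ge[OF i, of t] norm_Pair_le[of "X t (z i) - XA i t" "V t (z i) - VA i t"] by (simp add: dist_norm)
    finally show ?thesis .
  qed
  then have "(\<Sum>i<N. \<phi> (X t (z i), V t (z i)) - \<phi> (XA i t, VA i t)) / N \<le> gap t" by (rule average_le)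
  then have 2: "(\<Sum>i<N. \<phi> (X t (z i), V t (z i))) / N - (\<Sum>i<N. \<phi> (XA i t, VA i t)) / N \<le> gap t"
    by (simp add: sum_subtractf diff_divide_distrib)
  \<comment> \<open>\<open>w0 + sqrt w0 \<le> 2 * ?m\<close> is the origin of the 2 in
    \<open>stability_const\<close>.\<close>
  let ?m = "max w0 (sqrt w0)"
  have "flow_lip * w0 \<le> flow_lip * (2 * ?m)"
    using w0_nonneg flow_lip_nonneg by (intro mult_left_mono) auto
  moreover have "growth agent_rate * (w0 + sqrt w0) \<le> growth agent_rate * (2 * ?m)"
    using growth_ge_1[of agent_rate] by (intro mult_left_mono) auto
  ultimately show ?thesis
    using 1 2 gap_bound[OF t] by (simp add: stability_const_def algebra_simps)
qed

end

section \<open>From solutions to flows\<close>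

text \<open>Nothing is assumed about \<open>K\<close> outside \<open>[0, 1]\<close>; composing it with \<open>unit_clamp\<close> makes it bounded
  and Lipschitz on the whole line.\<close>

definition unit_clamp :: "real \<Rightarrow> real" where "unit_clamp r = max 0 (min 1 r)"

lemma unit_clamp_in: "unit_clamp r \<in> {0..1}"
  by (simp add: unit_clamp_def)

lemma unit_clamp_id: "r \<in> {0..1} \<Longrightarrow> unit_clamp r = r"
  by (simp add: unit_clamp_def)

lemma unit_clamp_lip: "\<bar>unit_clamp r - unit_clamp s\<bar> \<le> \<bar>r - s\<bar>"
  unfolding unit_clamp_def by linarith

lemma mass_within_distr:
  fixes X :: "'z \<Rightarrow> 'a::euclidean_space" and V :: "'z \<Rightarrow> 'a"
  assumes XV: "(\<lambda>z. (X z, V z)) \<in> borel_measurable P"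
  shows "mass_within (spatial_marginal (distr P borel (\<lambda>z. (X z, V z)))) x r
    = measure P {z \<in> space P. norm (X z - x) \<le> r}"
proof -
  have fst_m: "fst \<in> borel_measurable (borel :: ('a \<times> 'a) measure)"
    by (intro borel_measurable_continuous_onI continuous_intros)
  have X: "X \<in> borel_measurable P" using measurable_compose[OF XV fst_m] by simp
  have S: "{y. norm (y - x) \<le> r} \<in> sets borel" by measurable
  have "spatial_marginal (distr P borel (\<lambda>z. (X z, V z))) = distr P borel X"
    unfolding spatial_marginal_def using XV fst_m by (simp add: distr_distr comp_def)
  then show ?thesis
    unfolding mass_within_def using measure_distr[OF X S] by (simp add: vimage_def Int_def conj_commute)
qed

text \<open>One formula serves both sides: \<open>P\<close> is the initial law for the mean field
  and the uniform measure on the indices for the agents. The clamp is harmless because masses lie in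
  \<open>[0, 1]\<close>.\<close>

lemma interaction_distr:
  fixes X :: "'z \<Rightarrow> 'a::euclidean_space" and V :: "'z \<Rightarrow> 'a"
  assumes P: "prob_space P" and XV: "(\<lambda>z. (X z, V z)) \<in> borel_measurable P" and K: "continuous_on {0..1} K"
  defines "\<mu> \<equiv> distr P borel (\<lambda>z. (X z, V z))"
  shows "interaction K (spatial_marginal \<mu>) \<mu> x v = (LINT z|P. K (unit_clamp
      (measure P {z' \<in> space P. norm (X z' - x) \<le> norm (x - X z)})) *\<^sub>R (V z - v))"
proof -
  interpret prob_space P by (rule P)
  have X: "X \<in> borel_measurable P"
    using measurable_compose[OF XV, of fst borel]
    by (simp add: borel_measurable_continuous_onI continuous_on_fst)
  define m where "m r = measure P {z' \<in> space P. norm (X z' - x) \<le> r}" for r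
  have "mono m"
    unfolding m_def mono_def
    using X by (intro allI impI finite_measure_mono) (auto intro: order_trans)
  then have m_meas: "m \<in> borel_measurable borel" by (rule borel_measurable_mono)
  have m01: "unit_clamp (m r) = m r" for r by (rule unit_clamp_id) (simp add: m_def)
  have "continuous_on UNIV (\<lambda>r. K (unit_clamp r))"
    by (rule continuous_on_compose2[OF K])
      (auto simp: unit_clamp_def intro!: continuous_intros)
  then have K_meas: "(\<lambda>r. K (unit_clamp r)) \<in> borel_measurable borel" by (rule borel_measurable_continuous_onI)
  have "(\<lambda>y. norm (x - fst y)) \<in> borel_measurable (borel :: ('a \<times> 'a) measure)"
    by (intro borel_measurable_continuous_onI continuous_intros)
  then have "(\<lambda>y. K (unit_clamp (m (norm (x - fst y))))) \<in> borel_measurable (borel :: ('a \<times> 'a) measure)"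
    by (intro measurable_compose[OF _ K_meas] measurable_compose[OF _ m_meas])
  moreover have "(\<lambda>y. snd y - v) \<in> borel_measurable (borel :: ('a \<times> 'a) measure)"
    by (intro borel_measurable_continuous_onI continuous_intros)
  ultimately have meas: "(\<lambda>y. K (unit_clamp (m (norm (x - fst y)))) *\<^sub>R (snd y - v)) \<in> borel_measurable borel"
    by (rule borel_measurable_scaleR)
  have "interaction K (spatial_marginal \<mu>) \<mu> x v = (LINT y|\<mu>. K (unit_clamp (m (norm (x - fst y)))) *\<^sub>R (snd y - v))"
    unfolding interaction_def \<mu>_def mass_within_distr[OF XV] by (simp only: m01 m_def[symmetric])
  also have "\<dots> = (LINT z|P. K (unit_clamp (m (norm (x - X z)))) *\<^sub>R (V z - v))"
    unfolding \<mu>_def by (simp add: integral_distr[OF XV meas])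
  finally show ?thesis unfolding m_def .
qed

lemma bounded_prob_density_law:
  fixes f :: "'b::euclidean_space \<Rightarrow> real"
  assumes "bounded_prob_density f"
  shows "prob_space (law f)" "sets (law f) = sets borel"
    "0 \<le> real_of_ereal (Linf_norm f)" "density_le (real_of_ereal (Linf_norm f)) (law f)"
proof -
  have nn: "AE z in lborel. 0 \<le> f z" and int: "integrable lborel f" "integral\<^sup>L lborel f = 1"
    and fin: "Linf_norm f < \<infinity>"
    using assms by (auto simp: bounded_prob_density_def has_bochner_integral_iff)
  have m: "f \<in> borel_measurable lborel" using int(1) by simp
  have "emeasure (law f) (space (law f)) = (\<integral>\<^sup>+z. ennreal (f z) \<partial>lborel)"
    unfolding law_def using m by (subst emeasure_density) simp_all
  also have "\<dots> = 1" using nn_integral_eq_integral[OF int(1) nn] int(2) by simp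
  finally show "prob_space (law f)" by (rule prob_spaceI)
  show "sets (law f) = sets borel" by (simp add: law_def)
  have le: "AE z in lborel. ereal \<bar>f z\<bar> \<le> Linf_norm f" unfolding Linf_norm_def by (rule esssup_AE)
  \<comment> \<open>Some point satisfies the almost-everywhere bound, so the essential supremum is
    nonnegative and its conversion to a real loses nothing.\<close>
  have "\<exists>z. ereal \<bar>f z\<bar> \<le> Linf_norm f"
  proof (rule ccontr)
    assume "\<nexists>z. ereal \<bar>f z\<bar> \<le> Linf_norm f"
    with le have "AE z in lborel :: 'b measure. False" by (auto elim: eventually_mono)
    then show False by (simp add: eventually_False ae_filter_eq_bot_iff)
  qed
  then have "0 \<le> Linf_norm f" by (meson abs_ge_zero ereal_less_eq(5) order_trans)
  then obtain c where c: "Linf_norm f = ereal c" "0 \<le> c" using fin by (cases "Linf_norm f") auto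
  then show "0 \<le> real_of_ereal (Linf_norm f)" by simp
  have le': "AE z in lborel. ennreal (f z) \<le> ennreal c"
    using le unfolding c(1) by eventually_elim (auto intro: ennreal_leI)
  show "density_le (real_of_ereal (Linf_norm f)) (law f)"
    unfolding density_le_def c(1)
  proof
    fix A :: "'b set" assume A: "A \<in> sets borel"
    have "emeasure (law f) A = (\<integral>\<^sup>+z. ennreal (f z) * indicator A z \<partial>lborel)"
      unfolding law_def using m A by (intro emeasure_density) auto
    also have "\<dots> \<le> (\<integral>\<^sup>+z. ennreal c * indicator A z \<partial>lborel)"
      using le' by (intro nn_integral_mono_AE) (auto elim!: eventually_mono intro: mult_right_mono)
    also have "\<dots> = ennreal c * emeasure lborel A" using A by (simp add: nn_integral_cmult_indicator)
    finally show "emeasure (law f) A \<le> ennreal (real_of_ereal (ereal c)) * emeasure lborel A" by simp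
  qed
qed

text \<open>\<open>K 0\<close> is the maximum of the decreasing kernel. Change of variables moves
  moment and force to the initial law, and each \<open>Linf_norm (f t)\<close> gives a density bound
  at its own time only.\<close>

lemma topological_flow_of_weak_solution:
  fixes f0 :: "'a::euclidean_space \<times> 'a \<Rightarrow> real"
  assumes K: "\<forall>r\<in>{0..1}. 0 < K r" "antimono_on {0..1} K" "L-lipschitz_on {0..1} K"
    and pos: "T > 0" "Rx > 0" "Rv > 0"
    and f0: "bounded_prob_density f0" "supported_in (law f0) (cball 0 Rx \<times> cball 0 Rv)"
    and sol: "weak_solution K T f0 f"
  obtains X V where
    "topological_flow (law f0) (K 0) L T Rx Rv (real_of_ereal (Linf_norm f0)) (\<lambda>r. K (unit_clamp r)) X V"
    "\<And>t. t \<in> {0..T} \<Longrightarrow> law (f t) = distr (law f0) borel (\<lambda>z. (X t z, V t z))"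
proof -
  obtain X V where init: "\<And>x v. X 0 (x, v) = x \<and> V 0 (x, v) = v"
    and der: "\<And>t z. t \<in> {0..T} \<Longrightarrow> ((\<lambda>s. X s z) has_vector_derivative V t z) (at t within {0..T})"
      "\<And>t z. t \<in> {0..T} \<Longrightarrow> ((\<lambda>s. V s z) has_vector_derivative
        interaction K (spatial_marginal (law (f t))) (law (f t)) (X t z) (V t z)) (at t within {0..T})"
    and meas: "\<And>t. t \<in> {0..T} \<Longrightarrow> (\<lambda>z. (X t z, V t z)) \<in> borel_measurable borel"
    and law_f: "\<And>t. t \<in> {0..T} \<Longrightarrow> law (f t) = distr (law f0) borel (\<lambda>z. (X t z, V t z))"
    using sol unfolding weak_solution_def by blast
  have moment: "integrable (law (f t)) snd" and dens: "bounded_prob_density (f t)" if "t \<in> {0..T}" for t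
    using sol that unfolding weak_solution_def Cw_Linf_def by auto
  note law0 = bounded_prob_density_law[OF f0(1)]
  interpret P: prob_space "law f0" by (rule law0(1))
  have sp: "space (law f0) = UNIV" using sets_eq_imp_space_eq[OF law0(2)] by simp
  have meas': "(\<lambda>z. (X t z, V t z)) \<in> borel_measurable (law f0)" if "t \<in> {0..T}" for t
    using meas[OF that] law0(2) by (simp cong: measurable_cong_sets)
  have L0: "0 \<le> L" using K(3) by (simp add: lipschitz_on_def)
  have cont: "continuous_on {0..1} K" using K(3) by (rule lipschitz_on_continuous_on)
  have snd_m: "snd \<in> borel_measurable (borel :: ('a \<times> 'a) measure)"
    by (intro borel_measurable_continuous_onI continuous_intros)
  have "topological_flow (law f0) (K 0) L T Rx Rv (real_of_ereal (Linf_norm f0)) (\<lambda>r. K (unit_clamp r)) X V"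
  proof
    show "0 < K 0" using K(1) by simp
    show "0 \<le> K (unit_clamp r)" for r using K(1) unit_clamp_in[of r] by (meson less_imp_le)
    show "K (unit_clamp r) \<le> K 0" for r
      using monotone_onD[OF K(2), of 0 "unit_clamp r"] unit_clamp_in[of r] by auto
    show "\<bar>K (unit_clamp r) - K (unit_clamp s)\<bar> \<le> L * \<bar>r - s\<bar>" for r s
      using lipschitz_onD[OF K(3) unit_clamp_in unit_clamp_in, of r s] mult_left_mono[OF unit_clamp_lip[of r s] L0]
      by (simp add: dist_real_def)
    show "AE z in law f0. z \<in> cball 0 Rx \<times> cball 0 Rv" using f0(2) by (simp add: supported_in_def)
    show "X 0 z = fst z" "V 0 z = snd z" for z using init[of "fst z" "snd z"] by simp_all
  next
    fix t assume t: "t \<in> {0..T}"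
    show "integrable (law f0) (V t)"
      using moment[OF t] unfolding law_f[OF t] by (subst (asm) integrable_distr_eq[OF meas'[OF t] snd_m]) simp
    show "\<exists>c\<ge>0. density_le c (distr (law f0) borel (\<lambda>z. (X t z, V t z)))"
      using bounded_prob_density_law(3,4)[OF dens[OF t]] unfolding law_f[OF t] by blast
    show "((\<lambda>s. V s z) has_vector_derivative (LINT z'|law f0. K (unit_clamp
        (P.prob {z''. norm (X t z'' - X t z) \<le> norm (X t z - X t z')})) *\<^sub>R (V t z' - V t z))) (at t within {0..T})" for z
      using der(2)[OF t, of z] unfolding law_f[OF t] interaction_distr[OF law0(1) meas'[OF t] cont] by (simp add: sp)
  qed (use pos L0 law0 meas der in auto)
  then show thesis using that law_f by blast
qed

section \<open>Empirical measures and the conclusion\<close>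

lemma prob_space_uniform_count_measure': "N > 0 \<Longrightarrow> prob_space (uniform_count_measure {..<N::nat})"
  by (rule prob_space_uniform_count_measure) auto

lemma integral_empirical:
  fixes \<phi> :: "'a::euclidean_space \<times> 'a \<Rightarrow> real"
  assumes "N > 0" "\<phi> \<in> borel_measurable borel"
  shows "(LINT y|empirical N x v. \<phi> y) = (\<Sum>i<N. \<phi> (x i, v i)) / N"
proof -
  have m: "(\<lambda>i. (x i, v i)) \<in> uniform_count_measure {..<N} \<rightarrow>\<^sub>M borel"
    by (simp add: measurable_def sets_uniform_count_measure space_uniform_count_measure)
  show ?thesis
    unfolding empirical_def using assms
    by (simp add: integral_distr[OF m assms(2)] integral_uniform_count_measure)
qed

lemma interaction_empirical:
  fixes x v :: "nat \<Rightarrow> 'a::euclidean_space"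
  assumes N: "N > 0" and K: "continuous_on {0..1} K"
  shows "interaction K (spatial_marginal (empirical N x v)) (empirical N x v) y w
    = (\<Sum>j<N. K (unit_clamp ((\<Sum>k<N. of_bool (norm (x k - y) \<le> norm (y - x j))) / N)) *\<^sub>R (v j - w)) /\<^sub>R N"
proof -
  let ?U = "uniform_count_measure {..<N}"
  have m: "(\<lambda>i. (x i, v i)) \<in> borel_measurable ?U"
    by (simp add: measurable_def sets_uniform_count_measure space_uniform_count_measure)
  have "measure ?U {z' \<in> space ?U. norm (x z' - y) \<le> r} = (\<Sum>k<N. of_bool (norm (x k - y) \<le> r)) / N" for r
  proof -
    have eq: "{z' \<in> space ?U. norm (x z' - y) \<le> r} = {..<N} \<inter> {k. norm (x k - y) \<le> r}"
      by (auto simp: space_uniform_count_measure)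
    show ?thesis unfolding eq by (simp add: measure_uniform_count_measure)
  qed
  then show ?thesis
    unfolding empirical_def interaction_distr[OF prob_space_uniform_count_measure'[OF N] m K]
    by (simp add: uniform_count_measure_def lebesgue_integral_point_measure_finite scaleR_sum_right divide_inverse)
qed

lemma empirical_supported_in:
  fixes x v :: "nat \<Rightarrow> 'a::euclidean_space"
  assumes "supported_in (empirical N x v) S" "closed S" "i < N"
  shows "(x i, v i) \<in> S"
proof -
  have m: "(\<lambda>i. (x i, v i)) \<in> uniform_count_measure {..<N} \<rightarrow>\<^sub>M borel"
    by (simp add: measurable_def sets_uniform_count_measure space_uniform_count_measure)
  have "{y \<in> space (borel :: ('a \<times> 'a) measure). y \<in> S} \<in> sets borel" using assms(2) by simp
  from AE_distr_iff[OF m this] assms(1)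
  have "AE i in uniform_count_measure {..<N}. (x i, v i) \<in> S"
    unfolding supported_in_def empirical_def by simp
  then show ?thesis
    unfolding uniform_count_measure_def using assms(3) by (subst (asm) AE_point_measure) auto
qed

text \<open>A real supremum dominates its members only if they are bounded above. Both measures have
  mass 1, so the value of a test function at 0 cancels, and on the box the function deviates from it
  by at most \<open>Rx + Rv\<close>.\<close>

lemma integral_minus_average_le_wasserstein1:
  fixes \<phi> :: "'a::euclidean_space \<times> 'a \<Rightarrow> real"
  assumes P: "prob_space P" "sets P = sets borel" and supp: "AE z in P. z \<in> cball 0 Rx \<times> cball 0 Rv"
    and N: "N > 0" and in_D: "\<And>i. i < N \<Longrightarrow> (x i, v i) \<in> cball 0 Rx \<times> cball 0 Rv"
    and \<phi>: "continuous_on UNIV \<phi>" "bounded (range \<phi>)" "1-lipschitz_on UNIV \<phi>"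
  shows "(LINT z|P. \<phi> z) - (\<Sum>i<N. \<phi> (x i, v i)) / N \<le> wasserstein1 P (empirical N x v)"
proof -
  interpret prob_space P by (rule P(1))
  have near_0: "\<bar>\<psi> z - \<psi> 0\<bar> \<le> Rx + Rv"
    if "1-lipschitz_on UNIV \<psi>" "z \<in> cball 0 Rx \<times> cball 0 Rv" for \<psi> :: "'a \<times> 'a \<Rightarrow> real" and z
  proof -
    have "\<bar>\<psi> z - \<psi> 0\<bar> \<le> norm z" using lipschitz_onD[OF that(1), of z 0] by (simp add: dist_real_def)
    also have "\<dots> \<le> norm (fst z) + norm (snd z)" using norm_Pair_le[of "fst z" "snd z"] by simp
    also have "\<dots> \<le> Rx + Rv" using that(2) by (intro add_mono) auto
    finally show ?thesis .
  qed
  have le: "(LINT z|P. \<psi> z) - (LINT z|empirical N x v. \<psi> z) \<le> 2 * (Rx + Rv)"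
    if \<psi>: "continuous_on UNIV \<psi>" "1-lipschitz_on UNIV \<psi>" for \<psi> :: "'a \<times> 'a \<Rightarrow> real"
  proof -
    have m: "\<psi> \<in> borel_measurable borel" using \<psi>(1) by (rule borel_measurable_continuous_onI)
    have mP: "\<psi> \<in> borel_measurable P" using m P(2) by (simp cong: measurable_cong_sets)
    have "AE z in P. \<psi> z \<le> \<psi> 0 + (Rx + Rv)"
      using supp by eventually_elim (use near_0[OF \<psi>(2)] in \<open>force simp: abs_le_iff\<close>)
    moreover have "integrable P \<psi>"
    proof (rule integrable_const_bound[where B="\<bar>\<psi> 0\<bar> + (Rx + Rv)"])
      show "AE z in P. norm (\<psi> z) \<le> \<bar>\<psi> 0\<bar> + (Rx + Rv)"
        using supp
      proof eventually_elim
        case (elim z)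
        show ?case using near_0[OF \<psi>(2) elim] by (simp add: abs_le_iff) linarith
      qed
    qed (rule mP)
    ultimately have "(LINT z|P. \<psi> z) \<le> (LINT z|P. \<psi> 0 + (Rx + Rv))"
      by (intro integral_mono_AE) auto
    then have 1: "(LINT z|P. \<psi> z) \<le> \<psi> 0 + (Rx + Rv)" by (simp add: prob_space)
    have "\<psi> 0 - (Rx + Rv) \<le> \<psi> (x i, v i)" if "i < N" for i
      using near_0[OF \<psi>(2) in_D[OF that]] by (simp add: abs_le_iff)
    then have "(\<psi> 0 - (Rx + Rv)) * N \<le> (\<Sum>i<N. \<psi> (x i, v i))"
      using sum_bounded_below[of "{..<N}" "\<psi> 0 - (Rx + Rv)" "\<lambda>i. \<psi> (x i, v i)"] by (simp add: mult.commute)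
    then have "\<psi> 0 - (Rx + Rv) \<le> (\<Sum>i<N. \<psi> (x i, v i)) / N" using N by (simp add: pos_le_divide_eq)
    with 1 have "(LINT z|P. \<psi> z) - (\<Sum>i<N. \<psi> (x i, v i)) / N \<le> (\<psi> 0 + (Rx + Rv)) - (\<psi> 0 - (Rx + Rv))"
      by (rule diff_mono)
    then show ?thesis unfolding integral_empirical[OF N m] by simp
  qed
  have m: "\<phi> \<in> borel_measurable borel" using \<phi>(1) by (rule borel_measurable_continuous_onI)
  have "(LINT z|P. \<phi> z) - (LINT z|empirical N x v. \<phi> z) \<le> wasserstein1 P (empirical N x v)"
    unfolding wasserstein1_def
  proof (rule cSUP_upper)
    show "bdd_above ((\<lambda>\<psi>. (LINT z|P. \<psi> z) - (LINT z|empirical N x v. \<psi> z)) `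
        {\<psi> :: 'a \<times> 'a \<Rightarrow> real. continuous_on UNIV \<psi> \<and> bounded (range \<psi>) \<and> 1-lipschitz_on UNIV \<psi>})"
      by (rule bdd_aboveI2, rule le) auto
  qed (use \<phi> in blast)
  then show ?thesis unfolding integral_empirical[OF N m] .
qed

theorem theorem5p1:
  fixes K :: "real \<Rightarrow> real" and \<gamma> :: real
  assumes K_pos: "\<forall>z\<in>{0..1}. 0 < K z"
    and K_decreasing: "antimono_on {0..1} K"
    and K_lipschitz: "\<exists>L. L-lipschitz_on {0..1} K"
    and K_integral: "(K has_integral \<gamma>) {0..1}"
  shows "\<exists>C :: real \<Rightarrow> real \<Rightarrow> real \<Rightarrow> real \<Rightarrow> real.
    \<forall>T > 0. \<forall>Rx > 0. \<forall>Rv > 0.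
    \<forall>(f0 :: 'a::euclidean_space \<times> 'a \<Rightarrow> real) (f :: real \<Rightarrow> 'a \<times> 'a \<Rightarrow> real).
      bounded_prob_density f0 \<longrightarrow>
      supported_in (law f0) (cball 0 Rx \<times> cball 0 Rv) \<longrightarrow>
      weak_solution K T f0 f \<longrightarrow>
      (\<forall>(N :: nat) (x :: nat \<Rightarrow> 'a) (v :: nat \<Rightarrow> 'a) (X :: nat \<Rightarrow> real \<Rightarrow> 'a) (V :: nat \<Rightarrow> real \<Rightarrow> 'a).
         N > 0 \<longrightarrow>
         supported_in (empirical N x v) (cball 0 Rx \<times> cball 0 Rv) \<longrightarrow>
         agent_solution K N x v X V \<longrightarrow>
         (\<forall>t\<in>{0..T}.
            wasserstein1 (law (f t)) (empirical N (\<lambda>i. X i t) (\<lambda>i. V i t))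
              \<le> C T Rx Rv (real_of_ereal (Linf_norm f0)) *
                 max (wasserstein1 (law f0) (empirical N x v))
                     (sqrt (wasserstein1 (law f0) (empirical N x v)))))"
proof -
  obtain L where L: "L-lipschitz_on {0..1} K" using K_lipschitz ..
  have cont_K: "continuous_on {0..1} K" using L by (rule lipschitz_on_continuous_on)
  show ?thesis
  \<comment> \<open>The witness is fixed before any solution or \<open>N\<close> appears: besides
    its four arguments it uses only \<open>K 0\<close>, the Lipschitz constant \<open>L\<close> and
    the dimension.\<close>
  proof (intro exI[of _ "\<lambda>T Rx Rv c0. flow_constants.stability_const (K 0) L T Rx Rv c0 DIM('a)"] allI impI ballI)
    fix T Rx Rv :: real and f0 :: "'a \<times> 'a \<Rightarrow> real" and f
      and N :: nat and x v :: "nat \<Rightarrow> 'a" and XA VA :: "nat \<Rightarrow> real \<Rightarrow> 'a" and t :: real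
    assume pos: "0 < T" "0 < Rx" "0 < Rv" and f0: "bounded_prob_density f0"
      and supp: "supported_in (law f0) (cball 0 Rx \<times> cball 0 Rv)" and sol: "weak_solution K T f0 f"
      and N: "0 < N" and supp_N: "supported_in (empirical N x v) (cball 0 Rx \<times> cball 0 Rv)"
      and agents: "agent_solution K N x v XA VA" and t: "t \<in> {0..T}"
    let ?w = "wasserstein1 (law f0) (empirical N x v)"
    obtain X V where flow: "topological_flow (law f0) (K 0) L T Rx Rv (real_of_ereal (Linf_norm f0)) (\<lambda>r. K (unit_clamp r)) X V"
      and law_f: "\<And>t. t \<in> {0..T} \<Longrightarrow> law (f t) = distr (law f0) borel (\<lambda>z. (X t z, V t z))"
      using topological_flow_of_weak_solution[OF K_pos K_decreasing L pos f0 supp sol] by metis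
    interpret topological_flow "law f0" "K 0" L T Rx Rv "real_of_ereal (Linf_norm f0)" "\<lambda>r. K (unit_clamp r)" X V
      by (rule flow)
    have in_D: "(x i, v i) \<in> cball 0 Rx \<times> cball 0 Rv" if "i < N" for i
      using supp_N that by (intro empirical_supported_in closed_Times) auto
    have agent: "XA i 0 = x i" "VA i 0 = v i" "continuous_on {0..} (VA i)"
      "\<And>s. 0 \<le> s \<Longrightarrow> (XA i has_vector_derivative VA i s) (at s within {0..})"
      "\<And>s. 0 \<le> s \<Longrightarrow> ((\<lambda>s. interaction K (spatial_marginal (empirical N (\<lambda>i. XA i s) (\<lambda>i. VA i s)))
          (empirical N (\<lambda>i. XA i s) (\<lambda>i. VA i s)) (XA i s) (VA i s)) has_integral (VA i s - VA i 0)) {0..s}"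
      if "i < N" for i
      using agents that unfolding agent_solution_def Let_def by blast+
    interpret agents_near_flow "law f0" "K 0" L T Rx Rv "real_of_ereal (Linf_norm f0)" "\<lambda>r. K (unit_clamp r)" X V
      N "\<lambda>i. (x i, v i)" XA VA ?w
    proof
      fix i assume i: "i < N"
      show "(x i, v i) \<in> D" by (rule in_D[OF i])
      show "XA i 0 = fst (x i, v i)" "VA i 0 = snd (x i, v i)" using agent(1,2)[OF i] by simp_all
      show "continuous_on {0..T} (VA i)" by (rule continuous_on_subset[OF agent(3)[OF i]]) auto
      fix s assume s: "s \<in> {0..T}"
      show "(XA i has_vector_derivative VA i s) (at s within {0..T})"
        by (rule has_vector_derivative_within_subset[OF agent(4)[OF i]]) (use s in auto)
      show "((\<lambda>s. (\<Sum>j<N. K (unit_clamp ((\<Sum>k<N. of_bool (norm (XA k s - XA i s) \<le> norm (XA i s - XA j s))) / N))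
          *\<^sub>R (VA j s - VA i s)) /\<^sub>R N) has_integral (VA i s - VA i 0)) {0..s}"
        using agent(5)[OF i, of s] s unfolding interaction_empirical[OF N cont_K] by simp
    qed (use N in_D pos integral_minus_average_le_wasserstein1[OF prob_space_axioms sets_P supp[unfolded supported_in_def] N in_D] in auto)
    show "wasserstein1 (law (f t)) (empirical N (\<lambda>i. XA i t) (\<lambda>i. VA i t)) \<le> stability_const * max ?w (sqrt ?w)"
      unfolding wasserstein1_def[of "law (f t)"]
    proof (rule cSUP_least)
      show "{\<phi> :: 'a \<times> 'a \<Rightarrow> real. continuous_on UNIV \<phi> \<and> bounded (range \<phi>) \<and> 1-lipschitz_on UNIV \<phi>} \<noteq> {}"
        by (auto intro!: exI[of _ "\<lambda>_. 0"] simp: lipschitz_on_def)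
      fix \<phi> :: "'a \<times> 'a \<Rightarrow> real"
      assume "\<phi> \<in> {\<phi>. continuous_on UNIV \<phi> \<and> bounded (range \<phi>) \<and> 1-lipschitz_on UNIV \<phi>}"
      then have \<phi>: "continuous_on UNIV \<phi>" "1-lipschitz_on UNIV \<phi>" by auto
      have m: "\<phi> \<in> borel_measurable borel" using \<phi>(1) by (rule borel_measurable_continuous_onI)
      have "(LINT z|law (f t). \<phi> z) = (LINT y|law f0. \<phi> (X t y, V t y))"
        unfolding law_f[OF t] by (rule integral_distr[OF flow_meas_P[OF t] m])
      then show "(LINT z|law (f t). \<phi> z) - (LINT z|empirical N (\<lambda>i. XA i t) (\<lambda>i. VA i t). \<phi> z)
          \<le> stability_const * max ?w (sqrt ?w)"
        unfolding integral_empirical[OF N m] using integral_minus_agent_average_le[OF t \<phi>(2)] by simp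
    qed
  qed
qed

end
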